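(* Let $\mathbf{k}$ be a field of characteristic $0$, let $R=\mathbf{k}[\![x,y]\!]$, let $h=(1,2,\dots,t,h_t,\dots,h_s,0)$ be the Hilbert function of $R/J_0$ for some proper ideal $J_0\subset R$ of finite colength $n$, and let $L=(x^t,x^{t-1}y^{m_1},\dots,y^{m_t})$ be the lex-segment ideal with Hilbert function $h$. Identify the Gröbner cell $V(L)$ with the affine space $\mathbb{A}^D$, $D=n-t-\sum_{l\ge 2}n_l\binom{l}{2}$, with coordinates $c_1,\dots,c_D$, by means of the bijection $\Phi_L$ (see context). Let $\bar N$ be the $(t+1)\times t$ matrix with entries in $\mathbf{k}[c_1,\dots,c_D]$ consisting of the constant terms (with respect to $y$) of the general element $N$ of $\mathcal{M}(L)$. Then for every integer $d$ with $\Delta(h)+1\le d\le t+1$, the $d$-Betti stratum $V_d(L)=\{J\in V(L):\mu(J)=d\}$ is the quasi-affine variety $$V_d(L)=\mathcal{V}\bigl(I_{t+2-d}(\bar N)\bigr)\setminus \mathcal{V}\bigl(I_{t+1-d}(\bar N)\bigr)\subset V(L)\simeq\mathbb{A}^D .$$ In particular, $V_{t+1}(L)$ is an affine space, and $$V_{\Delta(h)+1}(L)=\mathbb{A}^D\setminus \mathcal{V}\bigl(I_{t-\Delta(h)}(\bar N)\bigr)$$ is a $D$-dimensional quasi-affine variety.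
   Context: Let $P=\mathbf{k}[x,y]$, $R=\mathbf{k}[\![x,y]\!]$, and $\mathfrak m=(x,y)\subset R$. The Hilbert function of $R/J$ is $i\mapsto\dim_{\mathbf{k}}\mathfrak m^i/(\mathfrak m^{i+1}+(J\cap\mathfrak m^i))$. For an ideal of finite colength it has the form $h=(1,2,\dots,t,h_t,\dots,h_s,0)$ with $h_i=i+1$ for $0\le i\le t-1$ and $t\ge h_t\ge\dots\ge h_s>0$, $h_{s+1}=0$. Put $\Delta(h)=\max\{|h_i-h_{i-1}| : 1\le i\le s+1\}$, and let $n_l$ be the number of indices $1\le i\le s+1$ with $|h_i-h_{i-1}|=l$ (jumps of height $l$, including the final drop to $0$). $\mu(J)$ is the minimal number of generators of $J$. Local ordering: fix a term ordering $\tau$ on $P$ with $x>_\tau y$. The induced local ordering $\overline\tau$ is defined on monomials by $m>_{\overline\tau}m'$ iff $\deg m<\deg m'$, or $\deg m=\deg m'$ and $m>_\tau m'$. $\operatorname{Lt}_{\overline\tau}(f)$ is the $\overline\tau$-largest monomial occurring in $f\in R\setminus\{0\}$, and $\operatorname{Lt}_{\overline\tau}(J)=(\operatorname{Lt}_{\overline\tau}(f): f\in J\setminus\{0\})$. For a monomial ideal $E$ of finite colength, the Gröbner cell is $V(E)=\{J\subset R \text{ ideal}: \operatorname{Lt}_{\overline\tau}(J)=E\}$ (monomial ideals of $P$ and of $R$ being identified). Lex-segment ideals: a monomial ideal $L=(x^t,\dots,x^{t-i}y^{m_i},\dots,y^{m_t})$ with $0=m_0<m_1<\dots<m_t$ is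 called lex-segment; each sequence $h=(1,2,\dots,t,h_t,\dots,h_s,0)$ with $t\ge h_t\ge\dots\ge h_s>0$ is the Hilbert function of $R/L$ for exactly one lex-segment ideal $L$. Put $d_i=m_i-m_{i-1}$ for $1\le i\le t$. The canonical Hilbert-Burch matrix $H$ of $L$ is the $(t+1)\times t$ matrix with $H_{i,i}=y^{d_i}$, $H_{i+1,i}=-x$ for $1\le i\le t$, and all other entries $0$. The degree matrix has entries $u_{i,j}=m_j-m_{i-1}+i-j$, $1\le i\le t+1$, $1\le j\le t$. $\mathcal{M}(L)$ is the set of $(t+1)\times t$ matrices $N=(n_{i,j})$ with entries in $\mathbf{k}[y]$ such that $n_{i,j}=0$ for $i\le j$ and, for $i>j$, each nonzero $n_{i,j}$ satisfies $u_{i,j}\le\operatorname{ord}(n_{i,j})\le\deg(n_{i,j})<d_j$ (order and degree in $y$). It is a $\mathbf{k}$-vector space of dimension $D$; the coefficients of the allowed powers of $y$ in the entries are denoted $c_1,\dots,c_D$, and the general element $N$ of $\mathcal M(L)$ is the one with these coefficients as indeterminates. Previously known theorem used for the identification: the map $\Phi_L:\mathcal{M}(L)\to V(L)$, $N\mapsto I_t(H+N)$ (the ideal of $R$ generated by the $t\times t$ minors) is a bijection. Via $\Phi_L$, $V(L)$ is identified with $\mathcal M(L)\simeq\mathbb{A}^D$. For a matrix $M$, $I_k(M)$ is the ideal generated by its $k\times k$ minors, with $I_0(M)=(1)$ and $I_k(M)=0$ if $k$ exceeds the number of rows or columns. $\mathcal V(\mathcal I)\subset\mathbb{A}^D$ is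 the vanishing set of an ideal $\mathcal I\subset\mathbf{k}[c_1,\dots,c_D]$. *)

theory Defs
  imports
    "HOL-Library.Poly_Mapping"
    "HOL-Library.Product_Plus"
    "HOL-Computational_Algebra.Computational_Algebra"
    "Jordan_Normal_Form.Determinant"
    "Jordan_Normal_Form.DL_Submatrix"
begin

section \<open>The ring of bivariate power series and its ideals\<close>

text \<open>
  \<open>k[[x,y]]\<close> is the type \<open>'k fps fps\<close>: a power series in the outer variable \<open>x\<close> with
  coefficients in \<open>k[[y]]\<close>. Ideals are the submodules of a ring over itself.
\<close>

abbreviation is_ideal :: "'r::comm_ring_1 set \<Rightarrow> bool" where
  "is_ideal \<equiv> module.subspace (*)"

abbreviation ideal_span :: "'r::comm_ring_1 set \<Rightarrow> 'r set" where
  "ideal_span \<equiv> module.span (*)"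

type_synonym 'k series = "'k fps fps"

definition from_ky :: "'k::field poly \<Rightarrow> 'k series" where
  "from_ky p = fps_const (fps_of_poly p)"

definition varx :: "'k::field series" where
  "varx = fps_X"

definition vary :: "'k::field series" where
  "vary = fps_const fps_X"

definition kscale :: "'k::field \<Rightarrow> 'k series \<Rightarrow> 'k series" where
  "kscale c f = fps_const (fps_const c) * f"

definition min_gens :: "'k::field series set \<Rightarrow> nat" where
  "min_gens J = (LEAST n. \<exists>G. finite G \<and> card G = n \<and> ideal_span G = J)"

primrec mpow :: "nat \<Rightarrow> 'k::field series set" where
  "mpow 0 = UNIV"
| "mpow (Suc i) = ideal_span {a * b | a b. a \<in> ideal_span {varx, vary} \<and> b \<in> mpow i}"

text \<open>
  \<open>has_quot_dim V W n\<close>: for \<open>k\<close>-subspaces \<open>W \<subseteq> V\<close> of \<open>k[[x,y]]\<close>, the quotient \<open>V/W\<close> has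
  dimension \<open>n\<close>, that is, \<open>V\<close> contains \<open>n\<close> elements whose classes form a basis of \<open>V/W\<close>.
\<close>

definition has_quot_dim :: "'k::field series set \<Rightarrow> 'k series set \<Rightarrow> nat \<Rightarrow> bool" where
  "has_quot_dim V W n \<longleftrightarrow>
     (\<exists>B. finite B \<and> card B = n \<and> B \<subseteq> V \<and>
          (\<forall>v\<in>V. \<exists>c. v - (\<Sum>b\<in>B. kscale (c b) b) \<in> W) \<and>
          (\<forall>c. (\<Sum>b\<in>B. kscale (c b) b) \<in> W \<longrightarrow> (\<forall>b\<in>B. c b = 0)))"

definition has_colength :: "'k::field series set \<Rightarrow> nat \<Rightarrow> bool" where
  "has_colength J n \<longleftrightarrow> has_quot_dim UNIV J n"

definition hilbert_fun :: "'k::field series set \<Rightarrow> nat \<Rightarrow> nat" where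
  "hilbert_fun J i =
     (THE n. has_quot_dim (mpow i) {a + b | a b. a \<in> mpow (Suc i) \<and> b \<in> J \<inter> mpow i} n)"

section \<open>Hilbert functions\<close>

text \<open>\<open>h = (1, 2, ..., t, h t, ..., h s, 0)\<close> with \<open>t \<ge> h t \<ge> ... \<ge> h s > 0\<close>; \<open>s = t - 1\<close> is allowed.\<close>

definition hilbert_shape :: "(nat \<Rightarrow> nat) \<Rightarrow> nat \<Rightarrow> nat \<Rightarrow> bool" where
  "hilbert_shape h t s \<longleftrightarrow>
     (\<forall>i<t. h i = i + 1) \<and> h t \<le> t \<and> (\<forall>i. t \<le> i \<and> i < s \<longrightarrow> h (Suc i) \<le> h i) \<and>
     (\<forall>i\<le>s. 0 < h i) \<and> (\<forall>i>s. h i = 0)"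

definition jump :: "(nat \<Rightarrow> nat) \<Rightarrow> nat \<Rightarrow> nat" where
  "jump h i = nat \<bar>int (h i) - int (h (i - 1))\<bar>"

definition max_jump :: "(nat \<Rightarrow> nat) \<Rightarrow> nat \<Rightarrow> nat" where
  "max_jump h s = Max (jump h ` {1..s+1})"

definition num_jumps :: "(nat \<Rightarrow> nat) \<Rightarrow> nat \<Rightarrow> nat \<Rightarrow> nat" where
  "num_jumps h s l = card {i \<in> {1..s+1}. jump h i = l}"

section \<open>Leading terms and Groebner cells\<close>

text \<open>
  The monomial \<open>x^a y^b\<close> is encoded by its exponent pair \<open>(a, b)\<close>; an ordering is given by its
  strict relation \<open>gt m m'\<close>, meaning \<open>m > m'\<close>.
\<close>

definition monomial :: "nat \<times> nat \<Rightarrow> 'k::field series" where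
  "monomial m = varx ^ fst m * vary ^ snd m"

definition mcoeff :: "'k::field series \<Rightarrow> nat \<times> nat \<Rightarrow> 'k" where
  "mcoeff f m = fps_nth (fps_nth f (fst m)) (snd m)"

definition term_ordering :: "(nat \<times> nat \<Rightarrow> nat \<times> nat \<Rightarrow> bool) \<Rightarrow> bool" where
  "term_ordering gt \<longleftrightarrow>
     (\<forall>m. \<not> gt m m) \<and>
     (\<forall>m m' m''. gt m m' \<longrightarrow> gt m' m'' \<longrightarrow> gt m m'') \<and>
     (\<forall>m m'. m \<noteq> m' \<longrightarrow> gt m m' \<or> gt m' m) \<and>
     (\<forall>m m' q. gt m m' \<longrightarrow> gt (m + q) (m' + q)) \<and>
     (\<forall>m. m \<noteq> 0 \<longrightarrow> gt m 0)"

definition local_gt :: "(nat \<times> nat \<Rightarrow> nat \<times> nat \<Rightarrow> bool) \<Rightarrow> nat \<times> nat \<Rightarrow> nat \<times> nat \<Rightarrow> bool" where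
  "local_gt gt m m' \<longleftrightarrow>
     fst m + snd m < fst m' + snd m' \<or> (fst m + snd m = fst m' + snd m' \<and> gt m m')"

definition lead_exp :: "(nat \<times> nat \<Rightarrow> nat \<times> nat \<Rightarrow> bool) \<Rightarrow> 'k::field series \<Rightarrow> nat \<times> nat" where
  "lead_exp gt f =
     (THE m. mcoeff f m \<noteq> 0 \<and> (\<forall>m'. mcoeff f m' \<noteq> 0 \<and> m' \<noteq> m \<longrightarrow> local_gt gt m m'))"

definition lead_ideal :: "(nat \<times> nat \<Rightarrow> nat \<times> nat \<Rightarrow> bool) \<Rightarrow> 'k::field series set \<Rightarrow> 'k series set" where
  "lead_ideal gt J = ideal_span {monomial (lead_exp gt f) | f. f \<in> J \<and> f \<noteq> 0}"

definition cell :: "(nat \<times> nat \<Rightarrow> nat \<times> nat \<Rightarrow> bool) \<Rightarrow> 'k::field series set \<Rightarrow> 'k series set set" where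
  "cell gt E = {J. is_ideal J \<and> lead_ideal gt J = E}"

definition betti_stratum ::
  "(nat \<times> nat \<Rightarrow> nat \<times> nat \<Rightarrow> bool) \<Rightarrow> 'k::field series set \<Rightarrow> nat \<Rightarrow> 'k series set set" where
  "betti_stratum gt E d = {J \<in> cell gt E. min_gens J = d}"

section \<open>Lex-segment ideals and their Hilbert-Burch matrices\<close>

definition lex_exponents :: "nat \<Rightarrow> (nat \<Rightarrow> nat) \<Rightarrow> bool" where
  "lex_exponents t m \<longleftrightarrow> m 0 = 0 \<and> (\<forall>i<t. m i < m (Suc i))"

definition lex_ideal :: "nat \<Rightarrow> (nat \<Rightarrow> nat) \<Rightarrow> 'k::field series set" where
  "lex_ideal t m = ideal_span {monomial (t - i, m i) | i. i \<le> t}"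

text \<open>
  \<open>ddiff\<close> and \<open>udeg\<close> use the customary one-based indices. Matrices are indexed from zero, so that
  the entry at \<open>(i, j)\<close> below is the one in row \<open>Suc i\<close> and column \<open>Suc j\<close>.
\<close>

definition ddiff :: "(nat \<Rightarrow> nat) \<Rightarrow> nat \<Rightarrow> nat" where
  "ddiff m i = m i - m (i - 1)"

definition udeg :: "(nat \<Rightarrow> nat) \<Rightarrow> nat \<Rightarrow> nat \<Rightarrow> int" where
  "udeg m i j = int (m j) - int (m (i - 1)) + int i - int j"

definition HB :: "nat \<Rightarrow> (nat \<Rightarrow> nat) \<Rightarrow> 'k::field series mat" where
  "HB t m = mat (t + 1) t
     (\<lambda>(i, j). if i = j then vary ^ ddiff m (Suc j) else if i = Suc j then - varx else 0)"

text \<open>In the next definition \<open>Polynomial.order 0 p\<close> is the \<open>y\<close>-adic order of the polynomial \<open>p\<close>.\<close>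

definition HB_params :: "nat \<Rightarrow> (nat \<Rightarrow> nat) \<Rightarrow> 'k::field poly mat set" where
  "HB_params t m = {N \<in> carrier_mat (t + 1) t. \<forall>i<t+1. \<forall>j<t.
     (i \<le> j \<longrightarrow> N $$ (i, j) = 0) \<and>
     (j < i \<longrightarrow> N $$ (i, j) \<noteq> 0 \<longrightarrow>
        udeg m (Suc i) (Suc j) \<le> int (Polynomial.order 0 (N $$ (i, j))) \<and>
        Polynomial.degree (N $$ (i, j)) < ddiff m (Suc j))}"

definition minors :: "nat \<Rightarrow> 'r::comm_ring_1 mat \<Rightarrow> 'r set" where
  "minors k M = {det (submatrix M I J) | I J.
     I \<subseteq> {..<dim_row M} \<and> J \<subseteq> {..<dim_col M} \<and> card I = k \<and> card J = k}"

definition Phi :: "nat \<Rightarrow> (nat \<Rightarrow> nat) \<Rightarrow> 'k::field poly mat \<Rightarrow> 'k series set" where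
  "Phi t m N = ideal_span (minors t (HB t m + map_mat from_ky N))"

section \<open>Affine space and its Zariski topology\<close>

text \<open>
  Multivariate polynomials are taken from the ring \<open>k[c\<^sub>0, c\<^sub>1, ...]\<close>, in which \<open>polys D\<close> is the
  subring \<open>k[c\<^sub>0, ..., c\<^sub>D\<^sub>-\<^sub>1]\<close>. Affine \<open>D\<close>-space is its set \<open>carrier_vec D\<close> of \<open>k\<close>-points.
\<close>

type_synonym 'k mpoly = "(nat \<Rightarrow>\<^sub>0 nat) \<Rightarrow>\<^sub>0 'k"

definition mvar :: "nat \<Rightarrow> 'k::field mpoly" where
  "mvar i = Poly_Mapping.single (Poly_Mapping.single i 1) 1"

definition polys :: "nat \<Rightarrow> 'k::field mpoly set" where
  "polys D = {p. \<forall>mon \<in> Poly_Mapping.keys p. Poly_Mapping.keys mon \<subseteq> {..<D}}"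

definition eval_at :: "'k::field vec \<Rightarrow> 'k mpoly \<Rightarrow> 'k" where
  "eval_at v p = (\<Sum>mon \<in> Poly_Mapping.keys p. Poly_Mapping.lookup p mon *
     (\<Prod>i \<in> Poly_Mapping.keys mon. (v $ i) ^ Poly_Mapping.lookup mon i))"

text \<open>The ideal of \<open>polys D\<close> generated by a subset \<open>S\<close> of \<open>polys D\<close>.\<close>

definition poly_ideal :: "nat \<Rightarrow> 'k::field mpoly set \<Rightarrow> 'k mpoly set" where
  "poly_ideal D S = {(\<Sum>g\<in>F. q g * g) | q F. finite F \<and> F \<subseteq> S \<and> (\<forall>g\<in>F. q g \<in> polys D)}"

definition vanishing :: "nat \<Rightarrow> 'k::field mpoly set \<Rightarrow> 'k vec set" where
  "vanishing D I = {v \<in> carrier_vec D. \<forall>p\<in>I. eval_at v p = 0}"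

definition det_ideal :: "nat \<Rightarrow> nat \<Rightarrow> 'k::field mpoly mat \<Rightarrow> 'k mpoly set" where
  "det_ideal D k M = poly_ideal D (minors k M)"

definition zariski_closed :: "nat \<Rightarrow> 'k::field vec set \<Rightarrow> bool" where
  "zariski_closed D Z \<longleftrightarrow> (\<exists>S \<subseteq> polys D. Z = vanishing D S)"

text \<open>Quasi-affine varieties are not required to be irreducible.\<close>

definition quasi_affine :: "nat \<Rightarrow> 'k::field vec set \<Rightarrow> bool" where
  "quasi_affine D X \<longleftrightarrow> (\<exists>Z W. zariski_closed D Z \<and> zariski_closed D W \<and> X = Z - W)"

definition irreducible_subset :: "nat \<Rightarrow> 'k::field vec set \<Rightarrow> bool" where
  "irreducible_subset D Y \<longleftrightarrow> Y \<noteq> {} \<and>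
     (\<forall>Z W. zariski_closed D Z \<and> zariski_closed D W \<and> Y \<subseteq> Z \<union> W \<longrightarrow> Y \<subseteq> Z \<or> Y \<subseteq> W)"

definition irreducible_chain :: "nat \<Rightarrow> 'k::field vec set \<Rightarrow> nat \<Rightarrow> bool" where
  "irreducible_chain D X n \<longleftrightarrow> (\<exists>Y.
     (\<forall>i\<le>n. irreducible_subset D (Y i) \<and> (\<exists>Z. zariski_closed D Z \<and> Y i = X \<inter> Z)) \<and>
     (\<forall>i<n. Y i \<subset> Y (Suc i)))"

text \<open>Krull dimension of \<open>X\<close> in the topology induced by the Zariski topology of affine \<open>D\<close>-space.\<close>

definition has_dimension :: "nat \<Rightarrow> 'k::field vec set \<Rightarrow> nat \<Rightarrow> bool" where
  "has_dimension D X n \<longleftrightarrow>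
     irreducible_chain D X n \<and> (\<forall>n'. irreducible_chain D X n' \<longrightarrow> n' \<le> n)"

definition poly_map :: "nat \<Rightarrow> (nat \<Rightarrow> 'k::field mpoly) \<Rightarrow> 'k vec \<Rightarrow> 'k vec" where
  "poly_map E f v = vec E (\<lambda>i. eval_at v (f i))"

text \<open>
  A closed subset of affine \<open>D\<close>-space is an affine space if it is isomorphic, by polynomial maps
  inverse to each other, to some affine \<open>r\<close>-space.
\<close>

definition is_affine_space :: "nat \<Rightarrow> 'k::field vec set \<Rightarrow> bool" where
  "is_affine_space D X \<longleftrightarrow> zariski_closed D X \<and>
     (\<exists>r f g. (\<forall>i<D. f i \<in> polys r) \<and> (\<forall>j<r. g j \<in> polys D) \<and>
        (\<forall>v \<in> carrier_vec r. poly_map D f v \<in> X \<and> poly_map r g (poly_map D f v) = v) \<and>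
        (\<forall>w \<in> X. poly_map D f (poly_map r g w) = w))"

section \<open>Coordinates on the Groebner cell\<close>

text \<open>
  \<open>(i, j, k)\<close> stands for the coefficient of \<open>y^k\<close> in the entry at \<open>(i, j)\<close> of a matrix in
  \<open>HB_params t m\<close>. A numbering \<open>e\<close> of these triples by \<open>0, ..., D-1\<close> gives the coordinates.
\<close>

definition coords :: "nat \<Rightarrow> (nat \<Rightarrow> nat) \<Rightarrow> (nat \<times> nat \<times> nat) set" where
  "coords t m = {(i, j, k). j < i \<and> i \<le> t \<and>
     udeg m (Suc i) (Suc j) \<le> int k \<and> k < ddiff m (Suc j)}"

definition general_element ::
  "nat \<Rightarrow> nat \<Rightarrow> (nat \<Rightarrow> nat \<times> nat \<times> nat) \<Rightarrow> 'k::field mpoly poly mat" where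
  "general_element t D e = mat (t + 1) t (\<lambda>(i, j).
     \<Sum>\<nu><D. case e \<nu> of (i', j', k) \<Rightarrow> if i' = i \<and> j' = j then Polynomial.monom (mvar \<nu>) k else 0)"

definition specialize :: "'k::field mpoly poly mat \<Rightarrow> 'k vec \<Rightarrow> 'k poly mat" where
  "specialize N v = map_mat (map_poly (eval_at v)) N"

definition const_terms :: "'k::field mpoly poly mat \<Rightarrow> 'k mpoly mat" where
  "const_terms N = map_mat (\<lambda>p. Polynomial.coeff p 0) N"

definition cell_chart ::
  "nat \<Rightarrow> (nat \<Rightarrow> nat) \<Rightarrow> nat \<Rightarrow> (nat \<Rightarrow> nat \<times> nat \<times> nat) \<Rightarrow> 'k::field vec \<Rightarrow> 'k series set" where
  "cell_chart t m D e v = Phi t m (specialize (general_element t D e) v)"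

text \<open>The Betti stratum as a subset of affine space, under the identification by \<open>cell_chart\<close>.\<close>

definition stratum_coords ::
  "(nat \<times> nat \<Rightarrow> nat \<times> nat \<Rightarrow> bool) \<Rightarrow> nat \<Rightarrow> (nat \<Rightarrow> nat) \<Rightarrow> nat \<Rightarrow>
   (nat \<Rightarrow> nat \<times> nat \<times> nat) \<Rightarrow> nat \<Rightarrow> 'k::field vec set" where
  "stratum_coords gt t m D e d =
     {v \<in> carrier_vec D. cell_chart t m D e v \<in> betti_stratum gt (lex_ideal t m) d}"

end

theory Submission
  imports Defs "HOL-Library.Nat_Bijection"
begin

text \<open>
  An ideal \<open>J\<close> in the cell has reduced elements \<open>F\<^sub>i\<close> with leading monomials \<open>x^(t-i) y^(m i)\<close>. Because the
  \<open>m i - i\<close> are nondecreasing, \<open>F\<^sub>i\<close> is a polynomial of degree \<open>t - i\<close> in \<open>x\<close>, and \<open>J\<close> is the direct sum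
  of \<open>k[[x,y]] F\<^sub>0\<close> and of \<open>k[[y]] F\<^sub>i\<close> for \<open>i \<ge> 1\<close>. Descending from \<open>f\<^sub>t = y^(m t)\<close>, one changes \<open>F\<^sub>j\<close> in
  exactly one way into \<open>f\<^sub>j\<close> such that \<open>y^d f\<^sub>j - x f\<^sub>j\<^sub>+\<^sub>1\<close>, where \<open>d = m (j + 1) - m j\<close>, is a combination of
  \<open>f\<^sub>j\<^sub>+\<^sub>1, ..., f\<^sub>t\<close> with coefficients in \<open>k[y]\<close> of degree less than \<open>d\<close>. These relations are the columns
  of \<open>H + N\<close>, and Laplace expansion shows that they determine the \<open>f\<^sub>i\<close> to be its signed maximal minors;
  leading monomials translate into the order conditions on \<open>N\<close>. So \<open>N \<mapsto> I\<^sub>t(H + N)\<close> is bijective.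

  In the basis \<open>f\<^sub>0, ..., f\<^sub>t\<close> the same relations identify \<open>J\<close> modulo its product with the maximal ideal
  with the cokernel of the constant part of \<open>N\<close>, whence \<open>\<mu>(J)\<close> is \<open>t + 1\<close> minus its rank. The
  jump heights are the lengths of the blocks on which \<open>m i - i\<close> is constant; this bounds the rank by
  \<open>t - \<Delta>(h)\<close>, a value that is attained, and also gives the count of the coordinates.
\<close>

text \<open>The term ordering enters only through \<open>loc_rank\<close>: once x > y is known, all
  term orderings agree within a fixed degree, and the monomials in decreasing local order form a
  single sequence. Completeness of k[[x,y]] is used by approximating series up to a given rank, and
  sums of multiples of the generators cannot cancel because their leading monomials have different
  powers of x. The ground field need not be algebraically closed, so varieties are sets of k-points
  and no Nullstellensatz is at hand. That a nonempty open subset of affine D-space has dimension D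
  is shown directly. Irreducibility is tested on lines, which have infinitely many points in
  characteristic 0. The length of a chain of irreducible sets is bounded by counting: functions
  separating the n + 1 members of a chain have s^n independent monomials with exponents below s,
  while the polynomials in D variables in which these live span a space that grows only like
  s^D.\<close>

declare split_paired_All [simp del] split_paired_Ex [simp del]

section \<open>Polynomial functions and Krull dimension\<close>

text \<open>Gaussian elimination, one equation \<open>b\<close> at a time. The vectors are indexed
  by an arbitrary set \<open>A\<close>, so families with repetitions are covered; this serves the
  chain bound, the count of generators and the comparison of quotient dimensions.\<close>

lemma linear_dependence:
  fixes M :: "'a \<Rightarrow> 'b \<Rightarrow> 'k::field"
  assumes "finite B" "finite A" "card B < card A"
  shows "\<exists>c. (\<exists>a\<in>A. c a \<noteq> 0) \<and> (\<forall>b\<in>B. (\<Sum>a\<in>A. c a * M a b) = 0)"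
  using assms
proof (induction B arbitrary: A M rule: finite_induct)
  case empty
  then obtain a where "a \<in> A" by fastforce
  then show ?case by (intro exI[of _ "\<lambda>_. 1"]) auto
next
  case (insert b B)
  show ?case
  proof (cases "\<forall>a\<in>A. M a b = 0")
    case True
    from insert.IH[OF insert.prems(1), of M] insert.prems insert.hyps
    obtain c where "\<exists>a\<in>A. c a \<noteq> 0" "\<forall>b\<in>B. (\<Sum>a\<in>A. c a * M a b) = 0" by auto
    then show ?thesis using True by (intro exI[of _ c]) auto
  next
    case False
    then obtain p where p: "p \<in> A" "M p b \<noteq> 0" by auto
    define A' where "A' = A - {p}"
    have A: "A = insert p A'" "p \<notin> A'" "finite A'" using p insert.prems by (auto simp: A'_def)
    have "card B < card A'" using insert.prems insert.hyps A by simp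
    from insert.IH[OF A(3) this, of "\<lambda>a x. M a x - M a b / M p b * M p x"]
    obtain c where c: "\<exists>a\<in>A'. c a \<noteq> 0"
      "\<forall>x\<in>B. (\<Sum>a\<in>A'. c a * (M a x - M a b / M p b * M p x)) = 0" by auto
    \<comment> \<open>The coefficient of the pivot \<open>p\<close> is the one that makes each
      original equation agree with its reduced form.\<close>
    define c' where "c' = c(p := - (\<Sum>a\<in>A'. c a * (M a b / M p b)))"
    have eq: "(\<Sum>a\<in>A. c' a * M a x) = (\<Sum>a\<in>A'. c a * (M a x - M a b / M p b * M p x))" for x
    proof -
      have "(\<Sum>a\<in>A'. c' a * M a x) = (\<Sum>a\<in>A'. c a * M a x)"
        using A by (intro sum.cong) (auto simp: c'_def)
      then have "(\<Sum>a\<in>A. c' a * M a x) = c' p * M p x + (\<Sum>a\<in>A'. c a * M a x)" using A by simp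
      also have "c' p = - (\<Sum>a\<in>A'. c a * (M a b / M p b))" by (simp add: c'_def)
      finally show ?thesis
        by (simp add: algebra_simps sum_subtractf sum_distrib_left sum_distrib_right)
    qed
    have "(\<Sum>a\<in>A. c' a * M a b) = 0" unfolding eq using p by simp
    moreover have "\<exists>a\<in>A. c' a \<noteq> 0" using c(1) A by (auto simp: c'_def)
    ultimately show ?thesis using c(2) eq by (intro exI[of _ c']) auto
  qed
qed

section \<open>Evaluation of polynomials and determinantal ideals\<close>

definition monom_eval :: "'k::field vec \<Rightarrow> (nat \<Rightarrow>\<^sub>0 nat) \<Rightarrow> 'k" where
  "monom_eval v \<mu> = (\<Prod>i\<in>Poly_Mapping.keys \<mu>. vec_index v i ^ Poly_Mapping.lookup \<mu> i)"

lemma monom_eval_superset: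
  assumes "finite S" "Poly_Mapping.keys \<mu> \<subseteq> S"
  shows "monom_eval v \<mu> = (\<Prod>i\<in>S. vec_index v i ^ Poly_Mapping.lookup \<mu> i)"
  unfolding monom_eval_def using assms
  by (intro prod.mono_neutral_left) (auto simp: in_keys_iff)

lemma monom_eval_zero [simp]: "monom_eval v 0 = 1"
  by (simp add: monom_eval_def)

lemma monom_eval_add: "monom_eval v (a + b) = monom_eval v a * monom_eval v b"
proof -
  let ?S = "Poly_Mapping.keys a \<union> Poly_Mapping.keys b"
  have "monom_eval v (a + b) = (\<Prod>i\<in>?S. vec_index v i ^ Poly_Mapping.lookup (a + b) i)"
    using keys_add[of a b] by (intro monom_eval_superset) auto
  also have "\<dots> = (\<Prod>i\<in>?S. vec_index v i ^ Poly_Mapping.lookup a i) * (\<Prod>i\<in>?S. vec_index v i ^ Poly_Mapping.lookup b i)"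
    by (simp add: lookup_add power_add prod.distrib)
  also have "\<dots> = monom_eval v a * monom_eval v b"
    by (subst (1 2) monom_eval_superset[where S = ?S]) auto
  finally show ?thesis .
qed

lemma eval_at_monom_eval:
  "eval_at v p = (\<Sum>\<mu>\<in>Poly_Mapping.keys p. Poly_Mapping.lookup p \<mu> * monom_eval v \<mu>)"
  by (simp add: eval_at_def monom_eval_def)

lemma eval_at_zero [simp]: "eval_at v 0 = 0"
  by (simp add: eval_at_monom_eval)

lemma eval_at_add: "eval_at v (p + q) = eval_at v p + eval_at v q"
  unfolding eval_at_monom_eval
  by (rule setsum_keys_plus_distrib) (auto simp: algebra_simps)

lemma eval_at_single: "eval_at v (Poly_Mapping.single \<mu> c) = c * monom_eval v \<mu>"
  by (cases "c = 0") (auto simp: eval_at_monom_eval)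

lemma eval_at_one [simp]: "eval_at v 1 = 1"
  using eval_at_single[of v 0 1] by simp

lemma eval_at_mvar [simp]: "eval_at v (mvar i) = vec_index v i"
  by (simp add: mvar_def eval_at_single monom_eval_def)

lemma eval_at_sum: "eval_at v (\<Sum>x\<in>A. f x) = (\<Sum>x\<in>A. eval_at v (f x))"
  by (induction A rule: infinite_finite_induct) (auto simp: eval_at_add)

lemma mpoly_as_sum:
  fixes p :: "'k::field mpoly"
  shows "p = (\<Sum>\<mu>\<in>Poly_Mapping.keys p. Poly_Mapping.single \<mu> (Poly_Mapping.lookup p \<mu>))"
  by (rule poly_mapping_eqI) (auto simp: lookup_sum lookup_single when_def in_keys_iff)

lemma eval_at_mult: "eval_at v (p * q) = eval_at v p * eval_at v q"
proof -
  have "p * q = (\<Sum>a\<in>Poly_Mapping.keys p. Poly_Mapping.single a (Poly_Mapping.lookup p a)) *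
     (\<Sum>b\<in>Poly_Mapping.keys q. Poly_Mapping.single b (Poly_Mapping.lookup q b))"
    using mpoly_as_sum[of p] mpoly_as_sum[of q] by simp
  also have "\<dots> = (\<Sum>a\<in>Poly_Mapping.keys p. \<Sum>b\<in>Poly_Mapping.keys q.
      Poly_Mapping.single (a + b) (Poly_Mapping.lookup p a * Poly_Mapping.lookup q b))"
    by (simp add: sum_product mult_single)
  finally show ?thesis
    by (simp add: eval_at_sum eval_at_single monom_eval_add eval_at_monom_eval[of v p]
        eval_at_monom_eval[of v q] sum_product mult_ac)
qed

lemma comm_ring_hom_eval_at: "comm_ring_hom (eval_at v)"
  by unfold_locales (auto simp: eval_at_add eval_at_mult)

lemma polys_zero [simp]: "0 \<in> polys D"
  and polys_one [simp]: "1 \<in> polys D"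
  by (auto simp: polys_def)

lemma polys_mvar: "i < D \<Longrightarrow> mvar i \<in> polys D"
  by (auto simp: polys_def mvar_def)

lemma polys_add: "p \<in> polys D \<Longrightarrow> q \<in> polys D \<Longrightarrow> p + q \<in> polys D"
  using keys_add[of p q] by (auto simp: polys_def)

lemma polys_mult:
  assumes "p \<in> polys D" "q \<in> polys D"
  shows "p * q \<in> polys D"
  unfolding polys_def
proof (intro CollectI ballI)
  fix \<mu> assume "\<mu> \<in> Poly_Mapping.keys (p * q)"
  then obtain a b where "\<mu> = a + b" "a \<in> Poly_Mapping.keys p" "b \<in> Poly_Mapping.keys q"
    using keys_mult[of p q] by auto
  then show "Poly_Mapping.keys \<mu> \<subseteq> {..<D}"
    using keys_add[of a b] assms by (fastforce simp: polys_def)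
qed

lemma polys_uminus: "p \<in> polys D \<Longrightarrow> - p \<in> polys D"
  by (auto simp: polys_def in_keys_iff)

lemma polys_sum: "(\<And>x. x \<in> A \<Longrightarrow> f x \<in> polys D) \<Longrightarrow> (\<Sum>x\<in>A. f x) \<in> polys D"
  by (induction A rule: infinite_finite_induct) (auto intro: polys_add)

lemma polys_prod: "(\<And>x. x \<in> A \<Longrightarrow> f x \<in> polys D) \<Longrightarrow> (\<Prod>x\<in>A. f x) \<in> polys D"
  by (induction A rule: infinite_finite_induct) (auto intro: polys_mult)

lemma polys_power: "p \<in> polys D \<Longrightarrow> p ^ n \<in> polys D"
  by (induction n) (auto intro: polys_mult)

lemma polys_det:
  assumes "\<And>i j. i < dim_row A \<Longrightarrow> j < dim_col A \<Longrightarrow> A $$ (i, j) \<in> polys D"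
  shows "det A \<in> polys D"
proof (cases "dim_row A = dim_col A")
  case True
  have "signof p \<in> polys D" for p :: "nat \<Rightarrow> nat"
    by (auto simp: sign_def intro: polys_uminus)
  then show ?thesis unfolding det_def using True
    by (auto intro!: polys_sum polys_mult polys_prod assms dest: permutes_in_image)
qed (simp add: det_def)

lemma eval_at_det: "eval_at v (det A) = det (map_mat (eval_at v) A)"
  by (metis comm_ring_hom.hom_det comm_ring_hom_eval_at)

lemma submatrix_map_mat:
  "submatrix (map_mat f A) I J = map_mat f (submatrix A I J)"
proof -
  have "pick I i < dim_row A" if "i < card {i. i < dim_row A \<and> i \<in> I}" for i using pick_le[OF that] .
  moreover have "pick J i < dim_col A" if "i < card {i. i < dim_col A \<and> i \<in> J}" for i using pick_le[OF that] .
  ultimately show ?thesis by (intro eq_matI) (auto simp: submatrix_def)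
qed

lemma minors_map_eval_at: "minors k (map_mat (eval_at v) A) = eval_at v ` minors k A"
  unfolding minors_def image_Collect submatrix_map_mat eval_at_det[symmetric]
  by (simp, blast)

lemma vanishing_poly_ideal: "vanishing D (poly_ideal D S) = vanishing D S"
proof
  have "s \<in> poly_ideal D S" if "s \<in> S" for s
    using that unfolding poly_ideal_def by (intro CollectI exI[of _ "\<lambda>_. 1"] exI[of _ "{s}"]) auto
  then show "vanishing D (poly_ideal D S) \<subseteq> vanishing D S" by (auto simp: vanishing_def)
  show "vanishing D S \<subseteq> vanishing D (poly_ideal D S)"
    by (fastforce simp: vanishing_def poly_ideal_def eval_at_sum eval_at_mult intro!: sum.neutral)
qed

text \<open>Vanishing of a determinantal ideal at \<open>v\<close> becomes a rank condition on a
  matrix over k; this is how the constant part of an individual \<open>N\<close> meets the generic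
  matrix.\<close>

lemma vanishing_det_ideal:
  "v \<in> vanishing D (det_ideal D k M) \<longleftrightarrow>
     v \<in> carrier_vec D \<and> (\<forall>x\<in>minors k (map_mat (eval_at v) M). x = 0)"
  unfolding det_ideal_def vanishing_poly_ideal minors_map_eval_at by (auto simp: vanishing_def)

lemma zariski_closed_det_ideal:
  assumes "\<And>i j. i < dim_row M \<Longrightarrow> j < dim_col M \<Longrightarrow> M $$ (i, j) \<in> polys D"
  shows "zariski_closed D (vanishing D (det_ideal D k M))"
  unfolding zariski_closed_def det_ideal_def vanishing_poly_ideal
proof (intro exI conjI)
  show "minors k M \<subseteq> polys D"
    unfolding minors_def
    by (auto intro!: polys_det simp: submatrix_def intro!: assms dest!: pick_le)
qed simp

text \<open>Restriction to a line turns questions about zeros in D variables into the finiteness of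
  the roots of one polynomial in one variable.\<close>

lemma polynomial_on_line:
  fixes a b :: "'k::field vec"
  assumes "p \<in> polys D" "a \<in> carrier_vec D" "b \<in> carrier_vec D"
  shows "\<exists>P. \<forall>s. poly P s = eval_at (a + s \<cdot>\<^sub>v (b - a)) p"
proof (intro exI allI)
  fix s
  let ?l = "\<lambda>i. [:vec_index a i, vec_index b i - vec_index a i:]"
  have "monom_eval (a + s \<cdot>\<^sub>v (b - a)) \<mu> = (\<Prod>i\<in>Poly_Mapping.keys \<mu>. poly (?l i) s ^ Poly_Mapping.lookup \<mu> i)"
    if "\<mu> \<in> Poly_Mapping.keys p" for \<mu>
    unfolding monom_eval_def using that assms
    by (intro prod.cong refl arg_cong2[where f = "(^)"]) (force simp: polys_def algebra_simps)
  then show "poly (\<Sum>\<mu>\<in>Poly_Mapping.keys p. Polynomial.smult (Poly_Mapping.lookup p \<mu>)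
      (\<Prod>i\<in>Poly_Mapping.keys \<mu>. ?l i ^ Poly_Mapping.lookup \<mu> i)) s = eval_at (a + s \<cdot>\<^sub>v (b - a)) p"
    by (simp add: poly_sum poly_prod eval_at_monom_eval)
qed

text \<open>Each member has only finitely many zeros on the line. Characteristic 0 is used here, to
  have infinitely many parameters \<open>s\<close>.\<close>

lemma common_nonzero_on_line:
  fixes a b :: "'k::field_char_0 vec"
  assumes "finite F" "F \<subseteq> polys D" "a \<in> carrier_vec D" "b \<in> carrier_vec D"
    and ne: "\<And>f. f \<in> F \<Longrightarrow> \<exists>s. eval_at (a + s \<cdot>\<^sub>v (b - a)) f \<noteq> 0"
  shows "infinite {s. \<forall>f\<in>F. eval_at (a + s \<cdot>\<^sub>v (b - a)) f \<noteq> 0}"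
proof -
  have "finite {s. eval_at (a + s \<cdot>\<^sub>v (b - a)) f = 0}" if f: "f \<in> F" for f
  proof -
    obtain P where P: "\<And>s. poly P s = eval_at (a + s \<cdot>\<^sub>v (b - a)) f"
      using polynomial_on_line[of f D a b] assms f by blast
    have "P \<noteq> 0" using ne[OF f] P by force
    then show ?thesis using poly_roots_finite[of P] P by simp
  qed
  then have fin: "finite (\<Union>f\<in>F. {s. eval_at (a + s \<cdot>\<^sub>v (b - a)) f = 0})" using assms(1) by blast
  have "{s. \<forall>f\<in>F. eval_at (a + s \<cdot>\<^sub>v (b - a)) f \<noteq> 0} =
      UNIV - (\<Union>f\<in>F. {s. eval_at (a + s \<cdot>\<^sub>v (b - a)) f = 0})" by auto
  then show ?thesis using Diff_infinite_finite[OF fin infinite_UNIV_char_0] by simp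
qed

lemma line_start: "a \<in> carrier_vec D \<Longrightarrow> b \<in> carrier_vec D \<Longrightarrow> a + 0 \<cdot>\<^sub>v (b - a) = (a :: 'k::field vec)"
  by (intro eq_vecI) auto

lemma line_end: "a \<in> carrier_vec D \<Longrightarrow> b \<in> carrier_vec D \<Longrightarrow> a + 1 \<cdot>\<^sub>v (b - a) = (b :: 'k::field vec)"
  by (intro eq_vecI) auto

text \<open>Zariski openness in the pointwise form that the arguments on lines use.\<close>

definition principal_open_nbhds :: "nat \<Rightarrow> 'k::field vec set \<Rightarrow> bool" where
  "principal_open_nbhds D X \<longleftrightarrow> X \<subseteq> carrier_vec D \<and>
     (\<forall>x\<in>X. \<exists>\<delta>\<in>polys D. eval_at x \<delta> \<noteq> 0 \<and> (\<forall>v\<in>carrier_vec D. eval_at v \<delta> \<noteq> 0 \<longrightarrow> v \<in> X))"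

lemma principal_open_nbhds_Compl:
  assumes "zariski_closed D Z"
  shows "principal_open_nbhds D (carrier_vec D - Z)"
  using assms unfolding principal_open_nbhds_def zariski_closed_def vanishing_def
  by (auto 0 4)

text \<open>If Z misses \<open>a\<close> and W misses \<open>b\<close>, the line through
  \<open>a\<close> and \<open>b\<close> contains a point where the polynomials separating
  \<open>a\<close> from Z and \<open>b\<close> from W are both nonzero, and this point escapes both
  closed sets.\<close>

lemma irreducible_open_affine_subspace:
  fixes X :: "'k::field_char_0 vec set"
  assumes X: "principal_open_nbhds D X" and ne: "X \<inter> A \<noteq> {}"
    and A: "\<And>a b s. a \<in> A \<Longrightarrow> b \<in> A \<Longrightarrow> a + s \<cdot>\<^sub>v (b - a) \<in> A"
  shows "irreducible_subset D (X \<inter> A)"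
  unfolding irreducible_subset_def
proof (intro conjI allI impI ne)
  fix Z W assume ZW: "zariski_closed D Z \<and> zariski_closed D W \<and> X \<inter> A \<subseteq> Z \<union> W"
  show "X \<inter> A \<subseteq> Z \<or> X \<inter> A \<subseteq> W"
  proof (rule ccontr)
    assume "\<not> ?thesis"
    then obtain a b where ab: "a \<in> X" "a \<in> A" "a \<notin> Z" "b \<in> X" "b \<in> A" "b \<notin> W" by auto
    have car: "a \<in> carrier_vec D" "b \<in> carrier_vec D" using ab X by (auto simp: principal_open_nbhds_def)
    have sep: "\<exists>f\<in>polys D. eval_at c f \<noteq> 0 \<and> (\<forall>v\<in>T. eval_at v f = 0)"
      if "zariski_closed D T" "c \<in> carrier_vec D" "c \<notin> T" for c T
      using that unfolding zariski_closed_def vanishing_def by auto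
    obtain f where f: "f \<in> polys D" "eval_at a f \<noteq> 0" "\<And>v. v \<in> Z \<Longrightarrow> eval_at v f = 0"
      using sep[of Z a] ZW ab(3) car by auto
    obtain g where g: "g \<in> polys D" "eval_at b g \<noteq> 0" "\<And>v. v \<in> W \<Longrightarrow> eval_at v g = 0"
      using sep[of W b] ZW ab(6) car by auto
    \<comment> \<open>A neighbourhood of \<open>a\<close> alone is enough: not vanishing at one
      point of the line, \<open>\<delta>\<close> keeps all but finitely many points of the line
      inside X.\<close>
    obtain \<delta> where d: "\<delta> \<in> polys D" "eval_at a \<delta> \<noteq> 0" "\<And>v. v \<in> carrier_vec D \<Longrightarrow> eval_at v \<delta> \<noteq> 0 \<Longrightarrow> v \<in> X"
      using X ab(1) unfolding principal_open_nbhds_def by auto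
    have "infinite {s. \<forall>q\<in>{f, g, \<delta>}. eval_at (a + s \<cdot>\<^sub>v (b - a)) q \<noteq> 0}"
    proof (rule common_nonzero_on_line)
      fix q assume "q \<in> {f, g, \<delta>}"
      then consider "q = f \<or> q = \<delta>" | "q = g" by auto
      then show "\<exists>s. eval_at (a + s \<cdot>\<^sub>v (b - a)) q \<noteq> 0"
      proof cases
        case 1
        then show ?thesis using f d by (intro exI[of _ 0]) (auto simp: line_start[OF car])
      next
        case 2
        then show ?thesis using g(2) by (intro exI[of _ 1]) (simp only: line_end[OF car] not_False_eq_True)
      qed
    qed (use f g d car in auto)
    then obtain s where s: "\<forall>q\<in>{f, g, \<delta>}. eval_at (a + s \<cdot>\<^sub>v (b - a)) q \<noteq> 0"
      using infinite_imp_nonempty by auto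
    let ?p = "a + s \<cdot>\<^sub>v (b - a)"
    have "?p \<in> X \<inter> A" using s d(3)[of ?p] A ab car by auto
    moreover have "?p \<notin> Z" "?p \<notin> W" using s f g by auto
    ultimately show False using ZW by auto
  qed
qed

text \<open>The chain is cut out on X by the coordinate subspaces through a point \<open>p\<close>,
  in which the first 0, 1, ..., D coordinates are left free.\<close>

lemma irreducible_chain_open:
  fixes X :: "'k::field_char_0 vec set"
  assumes X: "principal_open_nbhds D X" and ne: "X \<noteq> {}"
  shows "irreducible_chain D X D"
proof -
  obtain p where p: "p \<in> X" using ne by auto
  have pc: "p \<in> carrier_vec D" using p X by (auto simp: principal_open_nbhds_def)
  define A where "A i = {v \<in> carrier_vec D. \<forall>j<D. i \<le> j \<longrightarrow> vec_index v j = vec_index p j}" for i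
  have Acl: "zariski_closed D (A i)" for i
  proof -
    let ?S = "{mvar j + Poly_Mapping.single 0 (- vec_index p j) | j. j < D \<and> i \<le> j}"
    have "(Poly_Mapping.single 0 c :: 'k mpoly) \<in> polys D" for c by (auto simp: polys_def)
    then have "?S \<subseteq> polys D" by (auto intro!: polys_add polys_mvar)
    moreover have "A i = vanishing D ?S"
      by (auto simp: A_def vanishing_def eval_at_add eval_at_single)
    ultimately show ?thesis unfolding zariski_closed_def by blast
  qed
  have irr: "irreducible_subset D (X \<inter> A i)" for i
  proof (rule irreducible_open_affine_subspace[OF X])
    show "X \<inter> A i \<noteq> {}" using p pc by (auto simp: A_def)
    show "a + s \<cdot>\<^sub>v (b - a) \<in> A i" if "a \<in> A i" "b \<in> A i" for a b s using that by (auto simp: A_def)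
  qed
  have strict: "X \<inter> A i \<subset> X \<inter> A (Suc i)" if i: "i < D" for i
  proof -
    obtain \<delta> where d: "\<delta> \<in> polys D" "eval_at p \<delta> \<noteq> 0" "\<And>v. v \<in> carrier_vec D \<Longrightarrow> eval_at v \<delta> \<noteq> 0 \<Longrightarrow> v \<in> X"
      using X p unfolding principal_open_nbhds_def by auto
    \<comment> \<open>Moving from \<open>p\<close> in direction i stays in \<open>A (Suc i)\<close>
      and leaves \<open>A i\<close> as soon as the parameter is nonzero; infinitely many parameters
      keep the point in X.\<close>
    define b where "b = p + unit_vec D i"
    have b: "b \<in> carrier_vec D" using pc by (auto simp: b_def)
    have "infinite {s. \<forall>q\<in>{\<delta>}. eval_at (p + s \<cdot>\<^sub>v (b - p)) q \<noteq> 0}"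
      using d by (intro common_nonzero_on_line[OF _ _ pc b]) (auto intro!: exI[of _ 0] simp: line_start[OF pc b])
    then have "\<not> {s. eval_at (p + s \<cdot>\<^sub>v (b - p)) \<delta> \<noteq> 0} \<subseteq> {0}" using finite_subset[of _ "{0}"] by auto
    then obtain s where s: "eval_at (p + s \<cdot>\<^sub>v (b - p)) \<delta> \<noteq> 0" "s \<noteq> 0" by auto
    let ?v = "p + s \<cdot>\<^sub>v (b - p)"
    have "?v \<in> X" using s d(3) pc b by auto
    moreover have "?v \<in> A (Suc i)" using pc b i by (auto simp: A_def b_def)
    moreover have "?v \<notin> A i" using pc b i s by (auto simp: A_def b_def)
    moreover have "A i \<subseteq> A (Suc i)" by (auto simp: A_def)
    ultimately show ?thesis by blast
  qed
  show ?thesis unfolding irreducible_chain_def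
    by (intro exI[of _ "\<lambda>i. X \<inter> A i"]) (use Acl irr strict in blast)
qed

text \<open>The head of a list is the exponent of the last function, so that recursion peels off the top of a chain.\<close>

primrec list_monomial :: "(nat \<Rightarrow> 'k::field mpoly) \<Rightarrow> nat list \<Rightarrow> 'k mpoly" where
  "list_monomial f [] = 1"
| "list_monomial f (k # xs) = f (length xs) ^ k * list_monomial f xs"

definition exp_lists :: "nat \<Rightarrow> nat \<Rightarrow> nat list set" where
  "exp_lists s n = {xs. set xs \<subseteq> {..<s} \<and> length xs = n}"

lemma finite_exp_lists [simp]: "finite (exp_lists s n)"
  unfolding exp_lists_def by (rule finite_lists_length_eq) simp

lemma card_exp_lists: "card (exp_lists s n) = s ^ n"
  unfolding exp_lists_def by (subst card_lists_length_eq) auto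

lemma exp_lists_0: "exp_lists s 0 = {[]}"
  by (auto simp: exp_lists_def)

lemma sum_exp_lists_Suc:
  "(\<Sum>xs\<in>exp_lists s (Suc n). g xs) = (\<Sum>k<s. \<Sum>xs\<in>exp_lists s n. g (k # xs))"
proof -
  have eq: "exp_lists s (Suc n) = (\<lambda>(k, xs). k # xs) ` ({..<s} \<times> exp_lists s n)"
    by (auto simp: exp_lists_def length_Suc_conv image_iff)
  have "inj_on (\<lambda>(k, xs). k # xs) ({..<s} \<times> exp_lists s n)" by (auto simp: inj_on_def)
  then show ?thesis unfolding eq by (subst sum.reindex) (auto simp: sum.cartesian_product case_prod_beta)
qed

lemma polys_list_monomial:
  "(\<And>i. i < length xs \<Longrightarrow> f i \<in> polys D) \<Longrightarrow> list_monomial f xs \<in> polys D"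
  by (induction xs) (auto intro!: polys_mult polys_power)

text \<open>
  If \<open>f i\<close> vanishes on \<open>Y i\<close> but not on \<open>Y (Suc i)\<close>, a relation between the monomials in the \<open>f i\<close>
  is divided by the power of the last one, which is possible on an irreducible set, and
  then restricted to the previous member of the chain.
\<close>

lemma list_monomials_independent:
  fixes f :: "nat \<Rightarrow> 'k::field mpoly"
  assumes "\<And>i. i \<le> n \<Longrightarrow> irreducible_subset D (Y i)" "\<And>i. i \<le> n \<Longrightarrow> Y i \<subseteq> carrier_vec D"
    and "\<And>i. i < n \<Longrightarrow> Y i \<subseteq> Y (Suc i)"
    and "\<And>i. i < n \<Longrightarrow> f i \<in> polys D" "\<And>i y. i < n \<Longrightarrow> y \<in> Y i \<Longrightarrow> eval_at y (f i) = 0"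
    and "\<And>i. i < n \<Longrightarrow> \<exists>y\<in>Y (Suc i). eval_at y (f i) \<noteq> 0"
    and "\<And>y. y \<in> Y n \<Longrightarrow> (\<Sum>xs\<in>exp_lists s n. c xs * eval_at y (list_monomial f xs)) = 0"
    and "xs \<in> exp_lists s n"
  shows "c xs = 0"
  using assms
proof (induction n arbitrary: c xs)
  case 0
  then show ?case by (auto simp: exp_lists_0 irreducible_subset_def)
next
  case (Suc n)
  \<comment> \<open>Inner induction on the exponent of the last function: coefficients with a
    smaller exponent are already known to vanish.\<close>
  have "c (k # ys) = 0" if "k < s" "ys \<in> exp_lists s n" for k ys
    using that
  proof (induction k arbitrary: ys rule: less_induct)
    case (less k)
    define G where "G j = (\<Sum>xs\<in>exp_lists s n. Poly_Mapping.single 0 (c (j # xs)) * list_monomial f xs)" for j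
    \<comment> \<open>The relation after division by \<open>f n ^ k\<close>; \<open>G j\<close> is
      the coefficient of \<open>f n ^ j\<close> in it.\<close>
    define H where "H = (\<Sum>j\<in>{k..<s}. f n ^ (j - k) * G j)"
    have len: "length xs = n" if "xs \<in> exp_lists s n" for xs using that by (simp add: exp_lists_def)
    have const: "(Poly_Mapping.single 0 a :: 'k mpoly) \<in> polys D" for a by (auto simp: polys_def)
    have G: "G j \<in> polys D" for j unfolding G_def
      using Suc.prems(4) len by (intro polys_sum polys_mult const polys_list_monomial) auto
    have H: "H \<in> polys D" unfolding H_def using Suc.prems(4) by (auto intro!: polys_sum polys_mult polys_power G)
    have evG: "eval_at y (G j) = (\<Sum>xs\<in>exp_lists s n. c (j # xs) * eval_at y (list_monomial f xs))" for y j
      by (simp add: G_def eval_at_sum eval_at_mult eval_at_single)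
    interpret ev: comm_ring_hom "eval_at y" for y by (rule comm_ring_hom_eval_at)
    have cover: "Y (Suc n) \<subseteq> vanishing D {f n} \<union> vanishing D {H}"
    proof
      fix y assume y: "y \<in> Y (Suc n)"
      have "0 = (\<Sum>j<s. \<Sum>xs\<in>exp_lists s n. c (j # xs) * eval_at y (f n ^ j * list_monomial f xs))"
        using Suc.prems(7)[OF y] len by (simp add: sum_exp_lists_Suc)
      also have "\<dots> = (\<Sum>j<s. eval_at y (f n) ^ j * eval_at y (G j))"
        by (simp add: evG eval_at_mult ev.hom_power sum_distrib_left mult_ac)
      also have "\<dots> = (\<Sum>j\<in>{k..<s}. eval_at y (f n) ^ j * eval_at y (G j))"
        by (intro sum.mono_neutral_right) (auto simp: evG less.IH intro!: sum.neutral)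
      also have "\<dots> = eval_at y (f n) ^ k * eval_at y H"
        unfolding H_def eval_at_sum eval_at_mult ev.hom_power sum_distrib_left
        by (intro sum.cong refl) (simp add: mult.assoc[symmetric] power_add[symmetric])
      finally have "eval_at y (f n) = 0 \<or> eval_at y H = 0" by auto
      then show "y \<in> vanishing D {f n} \<union> vanishing D {H}"
        using y Suc.prems(2)[of "Suc n"] by (auto simp: vanishing_def)
    qed
    moreover have "\<not> Y (Suc n) \<subseteq> vanishing D {f n}" using Suc.prems(6)[of n] by (auto simp: vanishing_def)
    moreover have "zariski_closed D (vanishing D {f n})" "zariski_closed D (vanishing D {H})"
      using H Suc.prems(4)[of n] unfolding zariski_closed_def by blast+
    ultimately have sub: "Y (Suc n) \<subseteq> vanishing D {H}"
      using Suc.prems(1)[of "Suc n"] unfolding irreducible_subset_def by blast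
    have "(\<Sum>xs\<in>exp_lists s n. c (k # xs) * eval_at y (list_monomial f xs)) = 0" if y: "y \<in> Y n" for y
    proof -
      have "0 = eval_at y H" using sub y Suc.prems(3)[of n] by (auto simp: vanishing_def)
      also have "\<dots> = (\<Sum>j\<in>{k..<s}. 0 ^ (j - k) * eval_at y (G j))"
        using Suc.prems(5)[OF _ y] by (simp add: H_def eval_at_sum eval_at_mult ev.hom_power)
      \<comment> \<open>On \<open>Y n\<close> the function \<open>f n\<close> is zero, so only the
        term with exponent 0 survives.\<close>
      also have "\<dots> = (\<Sum>j\<in>{k}. 0 ^ (j - k) * eval_at y (G j))"
        using less.prems by (intro sum.mono_neutral_right) (auto simp: power_0_left)
      finally show ?thesis by (simp add: evG)
    qed
    then show ?case using Suc.prems(1-6) less.prems(2)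
      by (intro Suc.IH[where c = "\<lambda>xs. c (k # xs)"]) auto
  qed
  then show ?case using Suc.prems(8) by (auto simp: exp_lists_def length_Suc_conv)
qed

definition exps_bounded :: "nat \<Rightarrow> 'k::field mpoly \<Rightarrow> bool" where
  "exps_bounded B p \<longleftrightarrow> (\<forall>\<mu>\<in>Poly_Mapping.keys p. \<forall>i. Poly_Mapping.lookup \<mu> i \<le> B)"

lemma exps_bounded_mult: "exps_bounded B p \<Longrightarrow> exps_bounded C q \<Longrightarrow> exps_bounded (B + C) (p * q)"
  unfolding exps_bounded_def using keys_mult[of p q] by (fastforce simp: lookup_add intro: add_mono)

lemma exps_bounded_one: "exps_bounded B 1"
  by (auto simp: exps_bounded_def)

lemma exps_bounded_power: "exps_bounded B p \<Longrightarrow> exps_bounded (k * B) (p ^ k)"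
  by (induction k) (auto simp: exps_bounded_one intro: exps_bounded_mult)

lemma exps_bounded_mono: "exps_bounded B p \<Longrightarrow> B \<le> C \<Longrightarrow> exps_bounded C p"
  by (auto simp: exps_bounded_def intro: order_trans)

lemma exps_bounded_exists: "\<exists>B. exps_bounded B p"
proof -
  have "\<exists>B. \<forall>i. Poly_Mapping.lookup \<mu> i \<le> B" for \<mu> :: "nat \<Rightarrow>\<^sub>0 nat"
    by (rule exI[of _ "\<Sum>i\<in>Poly_Mapping.keys \<mu>. Poly_Mapping.lookup \<mu> i"])
      (metis finite_keys in_keys_iff le0 member_le_sum)
  then have "\<forall>\<mu>::nat \<Rightarrow>\<^sub>0 nat. \<exists>B. \<forall>i. Poly_Mapping.lookup \<mu> i \<le> B" by blast
  from choice[OF this] obtain b :: "(nat \<Rightarrow>\<^sub>0 nat) \<Rightarrow> nat"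
    where b: "\<And>\<mu> i. Poly_Mapping.lookup \<mu> i \<le> b \<mu>" by blast
  have "exps_bounded (\<Sum>\<mu>\<in>Poly_Mapping.keys p. b \<mu>) p"
    unfolding exps_bounded_def using b by (meson finite_keys le0 member_le_sum order_trans)
  then show ?thesis by blast
qed

lemma exps_bounded_list_monomial:
  assumes "\<And>i. i < length xs \<Longrightarrow> exps_bounded B (f i)" "set xs \<subseteq> {..<s}"
  shows "exps_bounded (length xs * s * B) (list_monomial f xs)"
  using assms
proof (induction xs)
  case (Cons k xs)
  have "exps_bounded (k * B + length xs * s * B) (list_monomial f (k # xs))"
    unfolding list_monomial.simps using Cons by (intro exps_bounded_mult exps_bounded_power Cons.IH) auto
  then show ?case using Cons.prems(2) by (elim exps_bounded_mono) (simp add: algebra_simps)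
qed (simp add: exps_bounded_one)

lemma card_bounded_monomials:
  fixes B D :: nat
  defines "S \<equiv> {\<mu>. Poly_Mapping.keys \<mu> \<subseteq> {..<D} \<and> (\<forall>i. Poly_Mapping.lookup \<mu> i \<le> B)}"
  shows "finite S" "card S \<le> (B + 1) ^ D"
proof -
  let ?f = "\<lambda>\<mu>. map (Poly_Mapping.lookup \<mu>) [0..<D]"
  have inj: "inj_on ?f S"
  proof (rule inj_onI)
    fix \<mu> \<nu> assume h: "\<mu> \<in> S" "\<nu> \<in> S" "?f \<mu> = ?f \<nu>"
    have "Poly_Mapping.lookup \<mu> i = Poly_Mapping.lookup \<nu> i" for i
    proof (cases "i < D")
      case True then show ?thesis using h(3) by auto
    next
      case False
      then have "i \<notin> Poly_Mapping.keys \<mu>" "i \<notin> Poly_Mapping.keys \<nu>" using h by (auto simp: S_def)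
      then show ?thesis by (simp add: in_keys_iff)
    qed
    then show "\<mu> = \<nu>" by (rule poly_mapping_eqI)
  qed
  have sub: "?f ` S \<subseteq> exp_lists (B + 1) D" by (auto simp: S_def exp_lists_def less_Suc_eq_le)
  show "finite S" using inj sub by (meson finite_exp_lists finite_subset finite_imageD)
  show "card S \<le> (B + 1) ^ D"
    using card_inj_on_le[OF inj sub] by (simp add: card_exp_lists)
qed

text \<open>Counting in place of transcendence degree. If n exceeded D, the s^n monomials in
  separating functions of the chain would outnumber the available monomials in D variables for large
  \<open>s\<close>; a linear dependence between them then contradicts their independence on the top
  member.\<close>

lemma irreducible_chain_le:
  fixes X :: "'k::field vec set"
  assumes X: "X \<subseteq> carrier_vec D" and ch: "irreducible_chain D X n"
  shows "n \<le> D"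
proof (rule ccontr)
  assume nD: "\<not> n \<le> D"
  obtain Y where Y: "\<And>i. i \<le> n \<Longrightarrow> irreducible_subset D (Y i)"
    "\<And>i. i \<le> n \<Longrightarrow> \<exists>Z. zariski_closed D Z \<and> Y i = X \<inter> Z" "\<And>i. i < n \<Longrightarrow> Y i \<subset> Y (Suc i)"
    using ch unfolding irreducible_chain_def by auto
  have "\<exists>p\<in>polys D. (\<forall>y\<in>Y i. eval_at y p = 0) \<and> (\<exists>y\<in>Y (Suc i). eval_at y p \<noteq> 0)" if i: "i < n" for i
  proof -
    obtain Z where Z: "zariski_closed D Z" "Y i = X \<inter> Z" using Y(2)[of i] i by auto
    obtain y where y: "y \<in> Y (Suc i)" "y \<notin> Y i" using Y(3)[OF i] by auto
    moreover have "y \<in> X" using y(1) Y(2)[of "Suc i"] i by auto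
    ultimately show ?thesis using Z X unfolding zariski_closed_def vanishing_def by blast
  qed
  then obtain f where f: "\<And>i. i < n \<Longrightarrow> f i \<in> polys D" "\<And>i y. i < n \<Longrightarrow> y \<in> Y i \<Longrightarrow> eval_at y (f i) = 0"
    "\<And>i. i < n \<Longrightarrow> \<exists>y\<in>Y (Suc i). eval_at y (f i) \<noteq> 0" by metis
  have "\<forall>i. \<exists>B. exps_bounded B (f i)" using exps_bounded_exists by blast
  from choice[OF this] obtain b where b: "\<And>i. exps_bounded (b i) (f i)" by blast
  define e where "e = (\<Sum>i<n. b i)"
  have e: "exps_bounded e (f i)" if "i < n" for i
    using that member_le_sum[of i "{..<n}" b] by (intro exps_bounded_mono[OF b]) (auto simp: e_def)
  \<comment> \<open>Chosen so that \<open>(n * e + 1) ^ D < s\<close>. As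
    \<open>n * s * e + 1\<close> is at most \<open>(n * e + 1) * s\<close>, its D-th power is then
    below \<open>s ^ (D + 1)\<close>.\<close>
  define s where "s = (n * e + 1) ^ D + 1"
  define S where "S = {\<mu>. Poly_Mapping.keys \<mu> \<subseteq> {..<D} \<and> (\<forall>i. Poly_Mapping.lookup \<mu> i \<le> n * s * e)}"
  have S: "finite S" "card S \<le> (n * s * e + 1) ^ D" unfolding S_def by (rule card_bounded_monomials)+
  have "n * s * e + 1 \<le> (n * e + 1) * s" by (simp add: s_def algebra_simps)
  then have "(n * s * e + 1) ^ D \<le> (n * e + 1) ^ D * s ^ D"
    by (metis power_mono power_mult_distrib zero_le)
  also have "\<dots> < s * s ^ D" by (simp add: s_def)
  also have "\<dots> \<le> s ^ n" using nD power_increasing[of "Suc D" n s] by (simp add: s_def)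
  finally have "card S < card (exp_lists s n)" using S by (simp add: card_exp_lists)
  from linear_dependence[OF S(1) finite_exp_lists this, of "\<lambda>xs. Poly_Mapping.lookup (list_monomial f xs)"]
  obtain c where c: "\<exists>xs\<in>exp_lists s n. c xs \<noteq> 0"
    "\<And>\<mu>. \<mu> \<in> S \<Longrightarrow> (\<Sum>xs\<in>exp_lists s n. c xs * Poly_Mapping.lookup (list_monomial f xs) \<mu>) = 0" by auto
  define P where "P = (\<Sum>xs\<in>exp_lists s n. Poly_Mapping.single 0 (c xs) * list_monomial f xs)"
  have keys: "Poly_Mapping.keys (list_monomial f xs) \<subseteq> S" if "xs \<in> exp_lists s n" for xs
  proof -
    have "length xs = n" "set xs \<subseteq> {..<s}" using that by (auto simp: exp_lists_def)
    then have "list_monomial f xs \<in> polys D" "exps_bounded (n * s * e) (list_monomial f xs)"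
      using f(1) e exps_bounded_list_monomial[of xs e f s] by (auto intro: polys_list_monomial)
    then show ?thesis by (auto simp: S_def polys_def exps_bounded_def)
  qed
  \<comment> \<open>The dependence is between coefficient vectors, so the combination is the zero
    polynomial and vanishes at every point.\<close>
  have ev: "(\<Sum>xs\<in>exp_lists s n. c xs * eval_at y (list_monomial f xs)) = 0" for y
  proof -
    have "eval_at y (list_monomial f xs) = (\<Sum>\<mu>\<in>S. Poly_Mapping.lookup (list_monomial f xs) \<mu> * monom_eval y \<mu>)"
      if "xs \<in> exp_lists s n" for xs
      unfolding eval_at_monom_eval using S(1) keys[OF that]
      by (intro sum.mono_neutral_left) (auto simp: in_keys_iff)
    then have "(\<Sum>xs\<in>exp_lists s n. c xs * eval_at y (list_monomial f xs)) =
       (\<Sum>xs\<in>exp_lists s n. \<Sum>\<mu>\<in>S. c xs * Poly_Mapping.lookup (list_monomial f xs) \<mu> * monom_eval y \<mu>)"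
      by (simp add: sum_distrib_left mult.assoc)
    also have "\<dots> = (\<Sum>\<mu>\<in>S. (\<Sum>xs\<in>exp_lists s n. c xs * Poly_Mapping.lookup (list_monomial f xs) \<mu>) * monom_eval y \<mu>)"
      by (subst sum.swap) (simp add: sum_distrib_right)
    also have "\<dots> = 0" using c(2) by simp
    finally show ?thesis .
  qed
  have "c xs = 0" if "xs \<in> exp_lists s n" for xs
  proof (rule list_monomials_independent[where D = D and Y = Y and f = f and n = n and s = s and c = c, OF _ _ _ _ _ _ ev that])
    show "Y i \<subseteq> carrier_vec D" if "i \<le> n" for i using Y(2)[OF that] X by auto
  qed (use Y(1) Y(3) f in auto)
  then show False using c(1) by auto
qed

lemma has_dimension_open:
  fixes X :: "'k::field_char_0 vec set"
  assumes "zariski_closed D Z" "X = carrier_vec D - Z" "X \<noteq> {}"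
  shows "has_dimension D X D"
  unfolding has_dimension_def
  using assms irreducible_chain_open[OF principal_open_nbhds_Compl[OF assms(1)]] irreducible_chain_le[of X D]
  by auto

section \<open>Minors\<close>

lemma bij_betw_pick:
  assumes "finite I"
  shows "bij_betw (pick I) {..<card I} I"
proof -
  have inj: "inj_on (pick I) {..<card I}"
  proof (rule inj_onI)
    fix a b assume "a \<in> {..<card I}" "b \<in> {..<card I}" "pick I a = pick I b"
    then show "a = b" using pick_mono_le[of b I a] pick_mono_le[of a I b] by (metis lessThan_iff nat_neq_iff)
  qed
  moreover have "pick I ` {..<card I} \<subseteq> I" using pick_in_set_le by blast
  ultimately show ?thesis unfolding bij_betw_def
    using assms by (metis card_image card_lessThan card_subset_eq)
qed

lemma submatrix_subset:
  assumes "I \<subseteq> {..<dim_row A}" "J \<subseteq> {..<dim_col A}"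
  shows "submatrix A I J = mat (card I) (card J) (\<lambda>(a, b). A $$ (pick I a, pick J b))"
proof -
  have "{i. i < dim_row A \<and> i \<in> I} = I" "{j. j < dim_col A \<and> j \<in> J} = J" using assms by auto
  then show ?thesis by (simp add: submatrix_def)
qed

text \<open>Bordering a minor puts the new row and column last, so the indices need not be increasing.\<close>

definition fminor :: "'a::comm_ring_1 mat \<Rightarrow> nat \<Rightarrow> (nat \<Rightarrow> nat) \<Rightarrow> (nat \<Rightarrow> nat) \<Rightarrow> 'a" where
  "fminor A k p q = det (mat k k (\<lambda>(a, b). A $$ (p a, q b)))"

text \<open>A repeated row index makes the determinant 0; otherwise sorting the rows costs a sign.
  Sorted index sequences are the ones that \<open>minors\<close> ranges over.\<close>

lemma fminor_sort_rows:
  fixes A :: "'a::comm_ring_1 mat"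
  shows "fminor A k p q = 0 \<or> inj_on p {..<k} \<and> (\<exists>\<sigma>. fminor A k p q = signof \<sigma> * fminor A k (pick (p ` {..<k})) q)"
proof (cases "inj_on p {..<k}")
  case False
  then obtain a b where ab: "a < k" "b < k" "a \<noteq> b" "p a = p b" by (auto simp: inj_on_def)
  have "fminor A k p q = 0" unfolding fminor_def
    by (rule det_identical_rows[OF _ ab(3,1,2)]) (use ab in \<open>auto simp: row_def\<close>)
  then show ?thesis by simp
next
  case True
  define I where "I = p ` {..<k}"
  have I: "finite I" "card I = k" using True by (auto simp: I_def card_image)
  have bij: "bij_betw (pick I) {..<k} I" using bij_betw_pick[OF I(1)] I(2) by simp
  \<comment> \<open>\<open>\<sigma>\<close> sends a position to the place of its row in the
    increasing listing, and is the identity from \<open>k\<close> on, as a permutation of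
    \<open>{0..<k}\<close> requires.\<close>
  define \<sigma> where "\<sigma> a = (if a < k then inv_into {..<k} (pick I) (p a) else a)" for a
  have "bij_betw (inv_into {..<k} (pick I) \<circ> p) {..<k} {..<k}"
    using bij_betw_trans[OF _ bij_betw_inv_into[OF bij], of p "{..<k}"] True by (simp add: bij_betw_def I_def)
  then have "bij_betw \<sigma> {..<k} {..<k}" by (rule bij_betw_cong[THEN iffD1, rotated]) (simp add: \<sigma>_def)
  then have perm: "\<sigma> permutes {0..<k}" by (intro bij_imp_permutes) (auto simp: \<sigma>_def atLeast0LessThan)
  have \<sigma>: "pick I (\<sigma> a) = p a" "\<sigma> a < k" if "a < k" for a
  proof -
    have "p a \<in> I" using that by (auto simp: I_def)
    then show "pick I (\<sigma> a) = p a" using bij that by (simp add: \<sigma>_def f_inv_into_f bij_betw_def)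
    show "\<sigma> a < k" using perm that permutes_in_image[OF perm, of a] by auto
  qed
  have "fminor A k p q = det (mat k k (\<lambda>(i, j). mat k k (\<lambda>(a, b). A $$ (pick I a, q b)) $$ (\<sigma> i, j)))"
    unfolding fminor_def by (rule arg_cong[where f = det]) (auto intro!: eq_matI simp: \<sigma>)
  also have "\<dots> = signof \<sigma> * fminor A k (pick I) q" unfolding fminor_def
    by (rule det_permute_rows[OF _ perm]) simp
  finally show ?thesis using True by (auto simp: I_def)
qed

lemma fminor_transpose:
  assumes "\<And>a. a < k \<Longrightarrow> p a < dim_row A" "\<And>a. a < k \<Longrightarrow> q a < dim_col A"
  shows "fminor (transpose_mat A) k q p = fminor (A :: 'a::comm_ring_1 mat) k p q"
proof -
  have "mat k k (\<lambda>(a, b). A $$ (p a, q b)) = transpose_mat (mat k k (\<lambda>(a, b). transpose_mat A $$ (q a, p b)))"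
    using assms by (intro eq_matI) auto
  then show ?thesis unfolding fminor_def by (simp add: det_transpose[of _ k])
qed

text \<open>Rows are sorted first; columns are sorted by the same lemma applied to the
  transpose.\<close>

lemma fminor_eq_0:
  fixes A :: "'a::comm_ring_1 mat"
  assumes z: "\<forall>x\<in>minors k A. x = 0"
    and p: "\<And>a. a < k \<Longrightarrow> p a < dim_row A" and q: "\<And>a. a < k \<Longrightarrow> q a < dim_col A"
  shows "fminor A k p q = 0"
proof (rule ccontr)
  assume nz: "fminor A k p q \<noteq> 0"
  define I J where "I = p ` {..<k}" and "J = q ` {..<k}"
  from nz fminor_sort_rows[of A k p q] have p': "inj_on p {..<k}" and "fminor A k (pick I) q \<noteq> 0"
    by (auto simp: I_def)
  have I: "finite I" "card I = k" "I \<subseteq> {..<dim_row A}" using p p' by (auto simp: I_def card_image)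
  have pI: "pick I a < dim_row A" if "a < k" for a using pick_in_set_le[of a I] that I by auto
  from \<open>fminor A k (pick I) q \<noteq> 0\<close> have "fminor (transpose_mat A) k q (pick I) \<noteq> 0"
    using fminor_transpose[of k "pick I" A q] pI q by auto
  with fminor_sort_rows[of "transpose_mat A" k q "pick I"]
  have q': "inj_on q {..<k}" and n: "fminor (transpose_mat A) k (pick J) (pick I) \<noteq> 0"
    by (auto simp: J_def)
  have J: "finite J" "card J = k" "J \<subseteq> {..<dim_col A}" using q q' by (auto simp: J_def card_image)
  have pJ: "pick J a < dim_col A" if "a < k" for a using pick_in_set_le[of a J] that J by auto
  have "fminor A k (pick I) (pick J) \<noteq> 0" using fminor_transpose[of k "pick I" A "pick J"] pI pJ n by auto
  then have "det (submatrix A I J) \<noteq> 0" using I J by (simp add: submatrix_subset fminor_def)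
  moreover have "det (submatrix A I J) \<in> minors k A" using I J unfolding minors_def by blast
  ultimately show False using z by blast
qed

text \<open>Bordering the nonzero minor by row i and column j gives a vanishing determinant, and
  expansion along row i solves for the entry (i, j). The cofactors do not depend on i, so whole
  columns are expressed.\<close>

lemma columns_in_span_of_minor:
  fixes A :: "'k::field mat"
  assumes z: "\<forall>x\<in>minors (Suc r) A. x = 0" and nz: "\<exists>x\<in>minors r A. x \<noteq> 0"
  shows "\<exists>q l. (\<forall>b<r. q b < dim_col A) \<and>
    (\<forall>i<dim_row A. \<forall>j<dim_col A. A $$ (i, j) = (\<Sum>b<r. l j b * A $$ (i, q b)))"
proof -
  from nz obtain I J where IJ: "I \<subseteq> {..<dim_row A}" "J \<subseteq> {..<dim_col A}" "card I = r" "card J = r"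
    and d: "det (submatrix A I J) \<noteq> 0" unfolding minors_def by auto
  define p q where "p = pick I" and "q = pick J"
  have p: "p a < dim_row A" if "a < r" for a using that pick_in_set_le[of a I] IJ by (auto simp: p_def)
  have q: "q a < dim_col A" if "a < r" for a using that pick_in_set_le[of a J] IJ by (auto simp: q_def)
  define M where "M i j = mat (Suc r) (Suc r) (\<lambda>(a, b). A $$ ((p(r := i)) a, (q(r := j)) b))" for i j
  have Mc: "M i j \<in> carrier_mat (Suc r) (Suc r)" for i j by (simp add: M_def)
  define C where "C j b = cofactor (M 0 j) r b" for j b
  \<comment> \<open>Row i is the last row of \<open>M i j\<close>, and the cofactors delete
    it.\<close>
  have cof: "cofactor (M i j) r b = C j b" for i j b
  proof -
    have "mat_delete (M i j) r b = mat_delete (M 0 j) r b"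
      by (rule eq_matI) (auto simp: mat_delete_def M_def)
    then show ?thesis by (simp add: C_def cofactor_def)
  qed
  \<comment> \<open>The corner cofactor is the chosen nonzero minor, by which the expansion is
    divided.\<close>
  have Cr: "C j r = det (submatrix A I J)" for j
  proof -
    have "mat_delete (M 0 j) r r = submatrix A I J"
      by (rule eq_matI) (auto simp: mat_delete_def M_def submatrix_subset IJ p_def q_def)
    then show ?thesis by (simp add: C_def cofactor_def)
  qed
  show ?thesis
  proof (intro exI conjI allI impI)
    fix i j assume ij: "i < dim_row A" "j < dim_col A"
    have "det (M i j) = fminor A (Suc r) (p(r := i)) (q(r := j))" by (simp add: M_def fminor_def)
    also have "\<dots> = 0" using p q ij by (intro fminor_eq_0[OF z]) auto
    also have "det (M i j) = (\<Sum>b<Suc r. M i j $$ (r, b) * C j b)"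
      using laplace_expansion_row[OF Mc, of r i j] by (simp add: cof)
    also have "\<dots> = (\<Sum>b<r. A $$ (i, q b) * C j b) + A $$ (i, j) * det (submatrix A I J)"
      by (simp add: M_def Cr)
    finally have "A $$ (i, j) * det (submatrix A I J) = - (\<Sum>b<r. A $$ (i, q b) * C j b)"
      by (simp add: eq_neg_iff_add_eq_0 add.commute)
    then have "A $$ (i, j) = - (\<Sum>b<r. A $$ (i, q b) * C j b) / det (submatrix A I J)"
      using d by (simp add: field_simps)
    then show "A $$ (i, j) = (\<Sum>b<r. (- C j b / det (submatrix A I J)) * A $$ (i, q b))"
      by (simp add: sum_negf sum_divide_distrib mult_ac)
  qed (rule q)
qed

lemma minors_0: "minors 0 (A :: 'a::comm_ring_1 mat) = {1}"
proof -
  have "I = {} \<and> J = {} " if "I \<subseteq> {..<dim_row A}" "J \<subseteq> {..<dim_col A}" "card I = 0" "card J = 0" for I J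
    using that by (auto dest: finite_subset)
  moreover have "det (submatrix A {} {}) = 1" by (simp add: submatrix_def)
  ultimately show ?thesis unfolding minors_def by (auto intro!: exI[of _ "{}"])
qed

lemma minors_gt: "dim_col (A :: 'a::comm_ring_1 mat) < k \<Longrightarrow> minors k A = {}"
  unfolding minors_def by (auto dest: card_mono[rotated])

section \<open>Maximal minors and matrices with a zero block\<close>

definition drop_row :: "'a mat \<Rightarrow> nat \<Rightarrow> 'a mat" where
  "drop_row M i = mat (dim_row M - 1) (dim_col M) (\<lambda>(a, b). M $$ (if a < i then a else Suc a, b))"

lemma pick_lessThan: "b < t \<Longrightarrow> pick {..<t} b = b"
proof -
  assume b: "b < t"
  then have "{a \<in> {..<t}. a < b} = {..<b}" by auto
  then show ?thesis using pick_card_in_set[of b "{..<t}"] b by simp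
qed

lemma pick_delete: "i \<le> t \<Longrightarrow> a < t \<Longrightarrow> pick ({..<Suc t} - {i}) a = (if a < i then a else Suc a)"
proof -
  assume i: "i \<le> t" "a < t"
  show ?thesis
  proof (cases "a < i")
    case True
    then have "{b \<in> {..<Suc t} - {i}. b < a} = {..<a}" using i by auto
    then show ?thesis using pick_card_in_set[of a "{..<Suc t} - {i}"] i True by simp
  next
    case False
    then have "{b \<in> {..<Suc t} - {i}. b < Suc a} = {..<Suc a} - {i}" using i by auto
    moreover have "card ({..<Suc a} - {i}) = a" using False by simp
    ultimately show ?thesis using pick_card_in_set[of "Suc a" "{..<Suc t} - {i}"] i False by auto
  qed
qed

lemma maximal_minors:
  assumes M: "M \<in> carrier_mat (Suc t) t"
  shows "minors t M = {det (drop_row M i) | i. i \<le> t}"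
proof -
  have sub: "submatrix M ({..<Suc t} - {i}) {..<t} = drop_row M i" if "i \<le> t" for i
    using M that by (subst submatrix_subset) (auto intro!: eq_matI simp: drop_row_def pick_lessThan pick_delete)
  have "\<exists>i\<le>t. I = {..<Suc t} - {i} \<and> J = {..<t}"
    if "I \<subseteq> {..<Suc t}" "J \<subseteq> {..<t}" "card I = t" "card J = t" for I J
  proof -
    have "J = {..<t}" using that by (intro card_subset_eq) auto
    have "card ({..<Suc t} - I) = 1" using that by (subst card_Diff_subset) (auto intro: finite_subset)
    then obtain i where "{..<Suc t} - I = {i}" by (auto simp: card_1_singleton_iff)
    then show ?thesis using that \<open>J = _\<close> by (intro exI[of _ i]) auto
  qed
  note sets = this
  have card: "card ({..<Suc t} - {i}) = t" if "i \<le> t" for i using that by simp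
  show ?thesis
  proof (intro equalityI subsetI)
    fix x assume "x \<in> minors t M"
    then obtain I J where "x = det (submatrix M I J)" "I \<subseteq> {..<Suc t}" "J \<subseteq> {..<t}" "card I = t" "card J = t"
      using M unfolding minors_def by auto
    then show "x \<in> {det (drop_row M i) | i. i \<le> t}" using sets[of I J] sub by (auto, metis)
  next
    fix x assume "x \<in> {det (drop_row M i) | i. i \<le> t}"
    then obtain i where "i \<le> t" "x = det (submatrix M ({..<Suc t} - {i}) {..<t})" using sub by auto
    then show "x \<in> minors t M" using card[of i] M unfolding minors_def
      by (intro CollectI exI[of _ "{..<Suc t} - {i}"] exI[of _ "{..<t}"]) auto
  qed
qed

text \<open>Prepending column j to \<open>M\<close> gives a square matrix with two equal columns;
  the relation is its expansion along the new column. These are the Hilbert-Burch syzygies.\<close>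

lemma maximal_minors_relation:
  fixes M :: "'a::comm_ring_1 mat"
  assumes M: "M \<in> carrier_mat (Suc t) t" and j: "j < t"
  shows "(\<Sum>i\<le>t. M $$ (i, j) * ((-1) ^ i * det (drop_row M i))) = 0"
proof -
  define A where "A = mat (Suc t) (Suc t) (\<lambda>(a, b). if b = 0 then M $$ (a, j) else M $$ (a, b - 1))"
  have A: "A \<in> carrier_mat (Suc t) (Suc t)" by (simp add: A_def)
  have "0 = det A"
    by (rule det_identical_columns[OF A, of 0 "Suc j", symmetric]) (use j in \<open>auto simp: A_def col_def\<close>)
  also have "\<dots> = (\<Sum>i<Suc t. A $$ (i, 0) * cofactor A i 0)"
    by (rule laplace_expansion_column[OF A]) simp
  also have "\<dots> = (\<Sum>i<Suc t. M $$ (i, j) * ((-1) ^ i * det (drop_row M i)))"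
  proof (rule sum.cong[OF refl])
    fix i assume i: "i \<in> {..<Suc t}"
    have "mat_delete A i 0 = drop_row M i"
      using M i by (intro eq_matI) (auto simp: mat_delete_def A_def drop_row_def)
    then show "A $$ (i, 0) * cofactor A i 0 = M $$ (i, j) * ((-1) ^ i * det (drop_row M i))"
      using i by (simp add: A_def cofactor_def)
  qed
  finally show ?thesis by (simp add: lessThan_Suc_atMost)
qed

text \<open>In the Leibniz formula a nonzero term would have to avoid the zero block, sending the
  selected rows above \<alpha> injectively to selected columns before \<beta>. At least
  \<open>k - (dim_row A - \<alpha>)\<close> rows are selected there, which is more than
  \<beta>.\<close>

lemma minors_zero_block:
  fixes A :: "'a::comm_ring_1 mat"
  assumes z: "\<And>i j. i < \<alpha> \<Longrightarrow> \<beta> \<le> j \<Longrightarrow> i < dim_row A \<Longrightarrow> j < dim_col A \<Longrightarrow> A $$ (i, j) = 0"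
    and k: "\<alpha> \<le> dim_row A" "dim_row A + \<beta> < k + \<alpha>"
  shows "\<forall>x\<in>minors k A. x = 0"
proof
  fix x assume "x \<in> minors k A"
  then obtain I J where IJ: "I \<subseteq> {..<dim_row A}" "J \<subseteq> {..<dim_col A}" "card I = k" "card J = k"
    and x: "x = det (submatrix A I J)" unfolding minors_def by auto
  have fin: "finite I" "finite J" using IJ finite_subset by auto
  have bI: "bij_betw (pick I) {..<k} I" "bij_betw (pick J) {..<k} J"
    using bij_betw_pick[OF fin(1)] bij_betw_pick[OF fin(2)] IJ by auto
  let ?S = "submatrix A I J"
  have S: "?S = mat k k (\<lambda>(a, b). A $$ (pick I a, pick J b))" using IJ by (simp add: submatrix_subset)
  have "(\<Prod>i = 0..<k. ?S $$ (i, \<pi> i)) = 0" if \<pi>: "\<pi> permutes {0..<k}" for \<pi>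
  proof -
    have \<pi>k: "\<pi> i < k" if "i < k" for i using permutes_in_image[OF \<pi>, of i] that by auto
    have "\<exists>i<k. pick I i < \<alpha> \<and> \<beta> \<le> pick J (\<pi> i)"
    proof (rule ccontr)
      assume c: "\<not> ?thesis"
      have "I \<subseteq> (I \<inter> {..<\<alpha>}) \<union> {\<alpha>..<dim_row A}" using IJ by auto
      then have "card I \<le> card (I \<inter> {..<\<alpha>}) + card {\<alpha>..<dim_row A}"
        by (meson card_Un_le card_mono finite_Int fin finite_UnI finite_atLeastLessThan order_trans)
      moreover have "card (I \<inter> {..<\<alpha>}) \<le> card {..<\<beta>}"
      proof (rule card_inj_on_le)
        let ?g = "\<lambda>x. pick J (\<pi> (inv_into {..<k} (pick I) x))"
        have inv: "inv_into {..<k} (pick I) x \<in> {..<k}" "pick I (inv_into {..<k} (pick I) x) = x" if "x \<in> I" for x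
          using that bI(1) inv_into_into[of x "pick I" "{..<k}"] f_inv_into_f[of x "pick I" "{..<k}"]
          by (simp_all add: bij_betw_def)
        show "inj_on ?g (I \<inter> {..<\<alpha>})"
        proof (rule inj_onI)
          fix x y assume xy: "x \<in> I \<inter> {..<\<alpha>}" "y \<in> I \<inter> {..<\<alpha>}" "?g x = ?g y"
          then have "\<pi> (inv_into {..<k} (pick I) x) = \<pi> (inv_into {..<k} (pick I) y)"
            using bI(2) inv \<pi>k by (auto simp: bij_betw_def inj_on_def)
          then have "inv_into {..<k} (pick I) x = inv_into {..<k} (pick I) y"
            using permutes_inj[OF \<pi>] by (auto simp: inj_def)
          then show "x = y" using inv xy by (metis IntD1)
        qed
        show "?g ` (I \<inter> {..<\<alpha>}) \<subseteq> {..<\<beta>}"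
        proof
          fix z assume "z \<in> ?g ` (I \<inter> {..<\<alpha>})"
          then obtain x where x: "x \<in> I" "x < \<alpha>" "z = ?g x" by auto
          have "inv_into {..<k} (pick I) x < k" using inv(1)[OF x(1)] by simp
          then show "z \<in> {..<\<beta>}" using c inv(2)[OF x(1)] x by (metis lessThan_iff not_le)
        qed
      qed simp
      ultimately have "k \<le> \<beta> + (dim_row A - \<alpha>)" using IJ by simp
      moreover have "k \<le> dim_row A" using IJ card_mono[OF _ IJ(1)] by simp
      ultimately show False using k by linarith
    qed
    then obtain i where i: "i < k" "pick I i < \<alpha>" "\<beta> \<le> pick J (\<pi> i)" by auto
    have "?S $$ (i, \<pi> i) = 0" unfolding S using i \<pi>k[OF i(1)] IJ pick_in_set_le[of i I] pick_in_set_le[of "\<pi> i" J]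
      by (auto intro!: z)
    then show ?thesis using i(1) by (intro prod_zero) auto
  qed
  then show "x = 0" unfolding x by (subst det_def'[of _ k]) (auto simp: S intro!: sum.neutral)
qed

section \<open>Leading monomials and division\<close>

lemma module_mult: "Modules.module ((*) :: 'r::comm_ring_1 \<Rightarrow> 'r \<Rightarrow> 'r)"
  by unfold_locales (auto simp: algebra_simps)

lemma is_ideal_iff:
  "is_ideal J \<longleftrightarrow> 0 \<in> J \<and> (\<forall>a\<in>J. \<forall>b\<in>J. a + b \<in> J) \<and> (\<forall>r. \<forall>a\<in>J. r * a \<in> J)"
  unfolding Modules.module.subspace_def[OF module_mult] by auto

lemma is_ideal_add: "is_ideal J \<Longrightarrow> a \<in> J \<Longrightarrow> b \<in> J \<Longrightarrow> a + b \<in> J"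
  and is_ideal_mult: "is_ideal J \<Longrightarrow> a \<in> J \<Longrightarrow> r * a \<in> J"
  by (auto simp: is_ideal_iff)

lemma is_ideal_uminus: "is_ideal J \<Longrightarrow> a \<in> J \<Longrightarrow> - a \<in> J"
  unfolding is_ideal_iff by (metis mult_minus1)

lemma is_ideal_diff: "is_ideal J \<Longrightarrow> a \<in> J \<Longrightarrow> b \<in> J \<Longrightarrow> a - b \<in> J"
  using is_ideal_uminus[of J b] unfolding is_ideal_iff by (metis diff_conv_add_uminus)

lemma is_ideal_sum: "is_ideal J \<Longrightarrow> (\<And>x. x \<in> A \<Longrightarrow> f x \<in> J) \<Longrightarrow> (\<Sum>x\<in>A. f x) \<in> J"
  by (rule Modules.module.subspace_sum[OF module_mult])

lemma is_ideal_span: "is_ideal (ideal_span S)"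
  by (rule Modules.module.subspace_span[OF module_mult])

lemma ideal_span_base: "a \<in> S \<Longrightarrow> a \<in> ideal_span S"
  by (rule Modules.module.span_base[OF module_mult])

lemma ideal_span_minimal: "S \<subseteq> J \<Longrightarrow> is_ideal J \<Longrightarrow> ideal_span S \<subseteq> J"
  by (rule Modules.module.span_minimal[OF module_mult])

text \<open>The position of a monomial when all monomials are listed in decreasing local order.\<close>

definition loc_rank :: "nat \<times> nat \<Rightarrow> nat" where
  "loc_rank \<mu> = prod_encode (snd \<mu>, fst \<mu>)"

lemma triangle_mono: "a \<le> b \<Longrightarrow> triangle a \<le> triangle b"
  by (induction rule: dec_induct) (auto simp: triangle_Suc)

lemma loc_rank_less_iff:
  "loc_rank \<mu> < loc_rank \<nu> \<longleftrightarrow>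
     fst \<mu> + snd \<mu> < fst \<nu> + snd \<nu> \<or> fst \<mu> + snd \<mu> = fst \<nu> + snd \<nu> \<and> snd \<mu> < snd \<nu>"
proof -
  have *: "loc_rank \<mu> < loc_rank \<nu>" if "fst \<mu> + snd \<mu> < fst \<nu> + snd \<nu>" for \<mu> \<nu>
    using triangle_mono[of "Suc (snd \<mu> + fst \<mu>)" "snd \<nu> + fst \<nu>"] that
    by (auto simp: loc_rank_def prod_encode_def triangle_Suc)
  have **: "loc_rank \<mu> = triangle (fst \<mu> + snd \<mu>) + snd \<mu>" for \<mu>
    by (simp add: loc_rank_def prod_encode_def add.commute)
  consider "fst \<mu> + snd \<mu> < fst \<nu> + snd \<nu>" | "fst \<nu> + snd \<nu> < fst \<mu> + snd \<mu>" | "fst \<mu> + snd \<mu> = fst \<nu> + snd \<nu>"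
    by linarith
  then show ?thesis
  proof cases
    case 1 then show ?thesis using *[of \<mu> \<nu>] by simp
  next
    case 2 then show ?thesis using *[of \<nu> \<mu>] by simp
  next
    case 3 then show ?thesis using **[of \<mu>] **[of \<nu>] by simp
  qed
qed

lemma loc_rank_inj: "loc_rank \<mu> = loc_rank \<nu> \<longleftrightarrow> \<mu> = \<nu>"
  by (auto simp: loc_rank_def prod_eq_iff)

lemma loc_rank_add_less: "loc_rank \<mu> < loc_rank \<nu> \<Longrightarrow> loc_rank (\<mu> + \<kappa>) < loc_rank (\<nu> + \<kappa>)"
  by (auto simp: loc_rank_less_iff)

lemma loc_rank_add_le: "loc_rank \<mu> \<le> loc_rank \<nu> \<Longrightarrow> loc_rank (\<mu> + \<kappa>) \<le> loc_rank (\<nu> + \<kappa>)"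
  using loc_rank_add_less[of \<mu> \<nu> \<kappa>] by (auto simp: le_less loc_rank_inj)

text \<open>Compatibility with multiplication turns x > y into x^l > y^l, which orders every pair of
  distinct monomials of equal degree. From here on the ordering \<open>gt\<close> can be replaced by
  \<open>loc_rank\<close>.\<close>

lemma local_gt_iff:
  assumes gt: "term_ordering gt" "gt (1, 0) (0, 1)"
  shows "local_gt gt \<mu> \<nu> \<longleftrightarrow> loc_rank \<mu> < loc_rank \<nu>"
proof -
  have irr: "\<not> gt \<mu> \<mu>" and tr: "gt \<mu> \<nu> \<Longrightarrow> gt \<nu> \<kappa> \<Longrightarrow> gt \<mu> \<kappa>"
    and add: "gt \<mu> \<nu> \<Longrightarrow> gt (\<mu> + \<kappa>) (\<nu> + \<kappa>)" for \<mu> \<nu> \<kappa>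
    using gt(1) unfolding term_ordering_def by blast+
  have pow: "gt (Suc k, 0) (0, Suc k)" for k
  proof (induction k)
    case (Suc k)
    have "gt (Suc (Suc k), 0) (1, Suc k)" using add[OF Suc, of "(1, 0)"] by simp
    moreover have "gt (1, Suc k) (0, Suc (Suc k))" using add[OF gt(2), of "(0, Suc k)"] by simp
    ultimately show ?case by (rule tr)
  qed (use gt(2) in simp)
  \<comment> \<open>Two such monomials differ, after removal of a common factor, by x^l against
    y^l.\<close>
  have "gt \<mu> \<nu>" if h: "fst \<mu> + snd \<mu> = fst \<nu> + snd \<nu>" "snd \<mu> < snd \<nu>" for \<mu> \<nu>
  proof -
    define k where "k = snd \<nu> - snd \<mu> - 1"
    have "\<mu> = (Suc k, 0) + (fst \<nu>, snd \<mu>)" "\<nu> = (0, Suc k) + (fst \<nu>, snd \<mu>)"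
      using h by (auto simp: k_def prod_eq_iff)
    then show ?thesis using add[OF pow[of k]] by metis
  qed
  moreover have "\<mu> = \<nu>" if "fst \<mu> + snd \<mu> = fst \<nu> + snd \<nu>" "snd \<mu> = snd \<nu>" for \<mu> \<nu> :: "nat \<times> nat"
    using that by (simp add: prod_eq_iff)
  ultimately show ?thesis unfolding local_gt_def loc_rank_less_iff
    by (metis irr tr nat_neq_iff)
qed

lemma series_eqI: "(\<And>\<mu>. mcoeff f \<mu> = mcoeff g \<mu>) \<Longrightarrow> f = g"
  by (intro fps_ext) (metis fst_conv mcoeff_def snd_conv)

lemma mcoeff_zero [simp]: "mcoeff 0 \<mu> = 0"
  by (simp add: mcoeff_def)

lemma mcoeff_add [simp]: "mcoeff (f + g) \<mu> = mcoeff f \<mu> + mcoeff g \<mu>"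
  by (simp add: mcoeff_def)

lemma mcoeff_uminus [simp]: "mcoeff (- f) \<mu> = - mcoeff f \<mu>"
  by (simp add: mcoeff_def)

lemma mcoeff_diff [simp]: "mcoeff (f - g) \<mu> = mcoeff f \<mu> - mcoeff g \<mu>"
  by (simp add: mcoeff_def)

lemma mcoeff_sum: "mcoeff (\<Sum>x\<in>A. f x) \<mu> = (\<Sum>x\<in>A. mcoeff (f x) \<mu>)"
  by (simp add: mcoeff_def fps_sum_nth)

lemma mcoeff_fps_const: "mcoeff (fps_const q) \<mu> = (if fst \<mu> = 0 then fps_nth q (snd \<mu>) else 0)"
  by (simp add: mcoeff_def)

lemma mcoeff_kscale [simp]: "mcoeff (kscale c f) \<mu> = c * mcoeff f \<mu>"
  by (simp add: mcoeff_def kscale_def)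

lemma monomial_nth: "fps_nth (monomial (a, b)) k = (if k = a then fps_X ^ b else 0)"
  by (simp add: monomial_def varx_def vary_def fps_const_power mult.commute[of "fps_X ^ a"]
      fps_X_power_nth)

lemma mcoeff_monomial: "mcoeff (monomial \<mu>) \<nu> = (if \<nu> = \<mu> then 1 else 0)"
  by (cases \<mu>; cases \<nu>) (auto simp: mcoeff_def monomial_nth)

lemma mcoeff_mult:
  "mcoeff (f * g) (a, b) = (\<Sum>i=0..a. \<Sum>j=0..b. mcoeff f (i, j) * mcoeff g (a - i, b - j))"
  by (simp add: mcoeff_def fps_mult_nth fps_sum_nth)

lemma mcoeff_mult_nonzero:
  assumes "mcoeff (f * g) \<mu> \<noteq> 0"
  shows "\<exists>\<alpha> \<beta>. \<mu> = \<alpha> + \<beta> \<and> mcoeff f \<alpha> \<noteq> 0 \<and> mcoeff g \<beta> \<noteq> 0"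
proof -
  obtain a b where \<mu>: "\<mu> = (a, b)" by fastforce
  have "\<exists>i\<in>{0..a}. \<exists>j\<in>{0..b}. mcoeff f (i, j) * mcoeff g (a - i, b - j) \<noteq> 0"
    using assms unfolding \<mu> mcoeff_mult by (metis (no_types, lifting) sum.neutral)
  then obtain i j where "i \<le> a" "j \<le> b" "mcoeff f (i, j) * mcoeff g (a - i, b - j) \<noteq> 0" by auto
  then show ?thesis using \<mu> by (intro exI[of _ "(i, j)"] exI[of _ "(a - i, b - j)"]) auto
qed

text \<open>The local ordering puts low degrees on top, so leading means of least
  \<open>loc_rank\<close>; the leading coefficient may be any nonzero scalar.\<close>

definition is_lead :: "'k::field series \<Rightarrow> nat \<times> nat \<Rightarrow> bool" where
  "is_lead f \<mu> \<longleftrightarrow> mcoeff f \<mu> \<noteq> 0 \<and> (\<forall>\<nu>. mcoeff f \<nu> \<noteq> 0 \<longrightarrow> loc_rank \<mu> \<le> loc_rank \<nu>)"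

lemma is_lead_exists:
  assumes "f \<noteq> 0"
  shows "\<exists>\<mu>. is_lead f \<mu>"
proof -
  have "\<exists>\<mu>. mcoeff f \<mu> \<noteq> 0" using assms series_eqI[of f 0] by auto
  then show ?thesis unfolding is_lead_def
    using ex_has_least_nat[of "\<lambda>\<mu>. mcoeff f \<mu> \<noteq> 0" _ loc_rank] by blast
qed

lemma is_lead_unique: "is_lead f \<mu> \<Longrightarrow> is_lead f \<nu> \<Longrightarrow> \<mu> = \<nu>"
  unfolding is_lead_def by (metis le_antisym loc_rank_inj)

lemma is_lead_nonzero: "is_lead f \<mu> \<Longrightarrow> f \<noteq> 0"
  by (auto simp: is_lead_def)

text \<open>Adding an exponent is strictly monotone for the rank, so exactly one pair of monomials
  contributes at the sum of the leads, and its product is nonzero in a field.\<close>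

lemma is_lead_mult_aux:
  assumes "is_lead f \<alpha>" "is_lead g \<beta>"
  shows "mcoeff (f * g) (\<alpha> + \<beta>) = mcoeff f \<alpha> * mcoeff g \<beta>"
    and "is_lead (f * g) (\<alpha> + \<beta>)"
proof -
  have un: "\<mu> = \<alpha> \<and> \<nu> = \<beta>" if "\<mu> + \<nu> = \<alpha> + \<beta>" "mcoeff f \<mu> * mcoeff g \<nu> \<noteq> 0" for \<mu> \<nu>
  proof -
    have "loc_rank \<alpha> \<le> loc_rank \<mu>" "loc_rank \<beta> \<le> loc_rank \<nu>" using assms that by (auto simp: is_lead_def)
    then show ?thesis using loc_rank_add_less[of \<alpha> \<mu> \<nu>] loc_rank_add_less[of \<beta> \<nu> \<alpha>] 
      loc_rank_add_le[of \<beta> \<nu> \<alpha>] that(1) by (metis add.commute le_less loc_rank_inj less_irrefl order_le_less_trans)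
  qed
  obtain a b where ab: "\<alpha> + \<beta> = (a, b)" by fastforce
  have "mcoeff (f * g) (a, b) = (\<Sum>i=0..a. \<Sum>j=0..b. if (i, j) = \<alpha> then mcoeff f \<alpha> * mcoeff g \<beta> else 0)"
    unfolding mcoeff_mult
  proof (intro sum.cong refl)
    fix i j assume "i \<in> {0..a}" "j \<in> {0..b}"
    then have "(i, j) + (a - i, b - j) = \<alpha> + \<beta>" unfolding ab by auto
    moreover from this have "(i, j) = \<alpha> \<Longrightarrow> (a - i, b - j) = \<beta>" by simp
    ultimately show "mcoeff f (i, j) * mcoeff g (a - i, b - j) = (if (i, j) = \<alpha> then mcoeff f \<alpha> * mcoeff g \<beta> else 0)"
      using un[of "(i, j)" "(a - i, b - j)"] by (cases "(i, j) = \<alpha>") (simp_all, blast)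
  qed
  also have "\<dots> = (\<Sum>(i, j)\<in>{0..a} \<times> {0..b}. if (i, j) = \<alpha> then mcoeff f \<alpha> * mcoeff g \<beta> else 0)"
    by (simp add: sum.cartesian_product)
  also have "\<dots> = (\<Sum>x\<in>{0..a} \<times> {0..b}. if x = \<alpha> then mcoeff f \<alpha> * mcoeff g \<beta> else 0)"
    by (intro sum.cong) auto
  also have "\<dots> = mcoeff f \<alpha> * mcoeff g \<beta>"
    using ab by (subst sum.delta) (auto simp: prod_eq_iff mem_Times_iff)
  finally show eq: "mcoeff (f * g) (\<alpha> + \<beta>) = mcoeff f \<alpha> * mcoeff g \<beta>" by (simp add: ab)
  show "is_lead (f * g) (\<alpha> + \<beta>)"
    unfolding is_lead_def eq
  proof (intro conjI allI impI)
    fix \<mu> assume "mcoeff (f * g) \<mu> \<noteq> 0"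
    from mcoeff_mult_nonzero[OF this] obtain \<alpha>' \<beta>' where m: "\<mu> = \<alpha>' + \<beta>'" "mcoeff f \<alpha>' \<noteq> 0" "mcoeff g \<beta>' \<noteq> 0" by blast
    then have "loc_rank \<alpha> \<le> loc_rank \<alpha>'" "loc_rank \<beta> \<le> loc_rank \<beta>'" using assms by (auto simp: is_lead_def)
    then show "loc_rank (\<alpha> + \<beta>) \<le> loc_rank \<mu>" unfolding m(1)
      using loc_rank_add_le[of \<alpha> \<alpha>' \<beta>] loc_rank_add_le[of \<beta> \<beta>' \<alpha>'] by (simp add: add.commute)
  qed (use assms in \<open>auto simp: is_lead_def\<close>)
qed

lemmas is_lead_mult = is_lead_mult_aux(2)

lemma is_lead_monomial: "is_lead (monomial \<mu> :: 'k::field series) \<mu>"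
  by (auto simp: is_lead_def mcoeff_monomial split: if_splits)

lemma is_lead_fps_const: "q \<noteq> 0 \<Longrightarrow> is_lead (fps_const q) (0, subdegree q)"
  by (auto simp: is_lead_def mcoeff_fps_const loc_rank_less_iff not_less[symmetric] split: if_splits
      dest: subdegree_leI)

text \<open>Distinct leads cannot cancel: at the lead of least rank only its own summand has a
  nonzero coefficient.\<close>

lemma is_lead_sum:
  assumes "finite A" "A \<noteq> {}" "\<And>x. x \<in> A \<Longrightarrow> is_lead (g x) (l x)" "inj_on l A"
  shows "\<exists>x\<in>A. is_lead (\<Sum>x\<in>A. g x) (l x) \<and> (\<forall>y\<in>A. loc_rank (l x) \<le> loc_rank (l y))"
proof -
  obtain x where x: "x \<in> A" "\<And>y. y \<in> A \<Longrightarrow> loc_rank (l x) \<le> loc_rank (l y)"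
    using ex_has_least_nat[of "\<lambda>x. x \<in> A" _ "\<lambda>x. loc_rank (l x)"] assms(2) by blast
  have "mcoeff (g y) (l x) = 0" if "y \<in> A" "y \<noteq> x" for y
    using assms(3)[OF that(1)] x(2)[OF that(1)] inj_onD[OF assms(4) _ that(1) x(1)] that(2)
    by (auto simp: is_lead_def) (metis le_antisym loc_rank_inj)
  then have "mcoeff (\<Sum>x\<in>A. g x) (l x) = mcoeff (g x) (l x)"
    unfolding mcoeff_sum using assms(1) x(1) by (subst sum.remove[of _ x]) auto
  moreover have "mcoeff (\<Sum>x\<in>A. g x) \<nu> \<noteq> 0 \<Longrightarrow> loc_rank (l x) \<le> loc_rank \<nu>" for \<nu>
  proof -
    assume "mcoeff (\<Sum>x\<in>A. g x) \<nu> \<noteq> 0"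
    then obtain y where "y \<in> A" "mcoeff (g y) \<nu> \<noteq> 0" unfolding mcoeff_sum
      by (rule sum.not_neutral_contains_not_neutral)
    then show ?thesis using assms(3)[of y] x(2)[of y] by (auto simp: is_lead_def)
  qed
  ultimately have "is_lead (\<Sum>x\<in>A. g x) (l x)" using assms(3)[OF x(1)] by (simp add: is_lead_def)
  then show ?thesis using x by blast
qed

lemma lead_exp_eq:
  assumes gt: "term_ordering gt" "gt (1, 0) (0, 1)" and l: "is_lead f \<mu>"
  shows "lead_exp gt f = \<mu>"
  unfolding lead_exp_def local_gt_iff[OF gt]
proof (rule the_equality)
  show "mcoeff f \<mu> \<noteq> 0 \<and> (\<forall>\<nu>. mcoeff f \<nu> \<noteq> 0 \<and> \<nu> \<noteq> \<mu> \<longrightarrow> loc_rank \<mu> < loc_rank \<nu>)"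
    using l by (auto simp: is_lead_def le_less loc_rank_inj)
  fix \<kappa> assume "mcoeff f \<kappa> \<noteq> 0 \<and> (\<forall>\<nu>. mcoeff f \<nu> \<noteq> 0 \<and> \<nu> \<noteq> \<kappa> \<longrightarrow> loc_rank \<kappa> < loc_rank \<nu>)"
  then have "is_lead f \<kappa>" by (auto simp: is_lead_def intro: less_imp_le)
  then show "\<kappa> = \<mu>" using l by (rule is_lead_unique)
qed

text \<open>The filtration by rank through which convergence of series is expressed; a series lying
  in every step is 0.\<close>

definition vanish_below :: "nat \<Rightarrow> 'k::field series \<Rightarrow> bool" where
  "vanish_below K g \<longleftrightarrow> (\<forall>\<mu>. loc_rank \<mu> < K \<longrightarrow> mcoeff g \<mu> = 0)"

lemma vanish_below_add: "vanish_below K f \<Longrightarrow> vanish_below K g \<Longrightarrow> vanish_below K (f + g)"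
  and vanish_below_diff: "vanish_below K f \<Longrightarrow> vanish_below K g \<Longrightarrow> vanish_below K (f - g)"
  and vanish_below_mono: "vanish_below K f \<Longrightarrow> K' \<le> K \<Longrightarrow> vanish_below K' f"
  by (auto simp: vanish_below_def)

lemma vanish_below_sum: "(\<And>x. x \<in> A \<Longrightarrow> vanish_below K (f x)) \<Longrightarrow> vanish_below K (\<Sum>x\<in>A. f x)"
  by (auto simp: vanish_below_def mcoeff_sum)

lemma vanish_below_all: "(\<And>K. vanish_below K f) \<Longrightarrow> f = 0"
  by (rule series_eqI) (auto simp: vanish_below_def)

text \<open>The monomials of F other than its lead have larger rank, so replacing the lead by F in a
  product costs only terms at least one step further down the filtration.\<close>

lemma vanish_below_mult_tail:
  assumes "\<And>\<alpha>. mcoeff u \<alpha> \<noteq> 0 \<Longrightarrow> K \<le> loc_rank (\<alpha> + \<kappa>)"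
    and F: "is_lead F \<kappa>" "mcoeff F \<kappa> = 1"
  shows "vanish_below (Suc K) (u * (monomial \<kappa> - F))"
  unfolding vanish_below_def
proof (intro allI impI, rule ccontr)
  fix \<mu> assume h: "loc_rank \<mu> < Suc K" "mcoeff (u * (monomial \<kappa> - F)) \<mu> \<noteq> 0"
  from mcoeff_mult_nonzero[OF h(2)] obtain \<alpha> \<beta> where ab: "\<mu> = \<alpha> + \<beta>" "mcoeff u \<alpha> \<noteq> 0" "mcoeff (monomial \<kappa> - F) \<beta> \<noteq> 0" by blast
  then have "\<beta> \<noteq> \<kappa>" "mcoeff F \<beta> \<noteq> 0" using F by (auto simp: mcoeff_monomial split: if_splits)
  then have "loc_rank \<kappa> < loc_rank \<beta>" using F by (auto simp: is_lead_def le_less loc_rank_inj)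
  then have "loc_rank (\<alpha> + \<kappa>) < loc_rank \<mu>" using loc_rank_add_less[of \<kappa> \<beta> \<alpha>] by (simp add: ab add.commute)
  then show False using assms(1)[OF ab(2)] h(1) by simp
qed

text \<open>Membership of a monomial in the lex-segment ideal, tested only against the generator
  with the same power of x, or against x^t. As m increases, no other generator has to be tried, and
  the complement is an interval for each power of x.\<close>

definition stair :: "nat \<Rightarrow> (nat \<Rightarrow> nat) \<Rightarrow> nat \<times> nat \<Rightarrow> bool" where
  "stair t m \<mu> \<longleftrightarrow> t \<le> fst \<mu> \<or> m (t - fst \<mu>) \<le> snd \<mu>"

definition stair_remainder :: "nat \<Rightarrow> (nat \<Rightarrow> nat) \<Rightarrow> 'k::field series \<Rightarrow> 'k series" where
  "stair_remainder t m g = Abs_fps (\<lambda>a. if a < t then fps_cutoff (m (t - a)) (fps_nth g a) else 0)"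

text \<open>The quotients are read off from \<open>g\<close> as if each \<open>F i\<close> were its
  leading monomial: \<open>F 0\<close> takes everything divisible by x^t, and the other
  \<open>F i\<close> receive only series in y.\<close>

definition stair_combination :: "nat \<Rightarrow> (nat \<Rightarrow> nat) \<Rightarrow> (nat \<Rightarrow> 'k::field series) \<Rightarrow> 'k series \<Rightarrow> 'k series" where
  "stair_combination t m F g = fps_shift t g * F 0 +
     (\<Sum>i=1..t. fps_const (fps_shift (m i) (fps_nth g (t - i))) * F i) + stair_remainder t m g"

lemma mcoeff_stair_remainder: "mcoeff (stair_remainder t m g) \<mu> = (if stair t m \<mu> then 0 else mcoeff g \<mu>)"
  by (auto simp: stair_remainder_def stair_def mcoeff_def)

text \<open>Every monomial is counted once: the power of x selects the generator, and the power of y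
  decides between quotient and remainder.\<close>

lemma stair_combination_monomials:
  assumes "m 0 = 0"
  shows "stair_combination t m (\<lambda>i. monomial (t - i, m i)) g = g"
proof (rule fps_ext)
  fix a
  have sum: "(\<Sum>i=1..t. fps_nth (fps_const (fps_shift (m i) (fps_nth g (t - i))) * monomial (t - i, m i)) a) =
     (if a < t then fps_shift (m (t - a)) (fps_nth g a) * fps_X ^ m (t - a) else 0)"
  proof -
    have "(\<Sum>i=1..t. fps_nth (fps_const (fps_shift (m i) (fps_nth g (t - i))) * monomial (t - i, m i)) a) =
      (\<Sum>i=1..t. if i = t - a then (if a < t then fps_shift (m (t - a)) (fps_nth g a) * fps_X ^ m (t - a) else 0) else 0)"
      by (intro sum.cong) (auto simp: monomial_nth)
    then show ?thesis by auto
  qed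
  have "monomial (t, m 0) = (fps_X ^ t :: 'a fps fps)" using assms by (simp add: monomial_def varx_def vary_def)
  then have first: "fps_nth (fps_shift t g * monomial (t, m 0)) a = (if t \<le> a then fps_nth g a else 0)"
    by (simp add: fps_X_power_mult_right_nth)
  show "fps_nth (stair_combination t m (\<lambda>i. monomial (t - i, m i)) g) a = fps_nth g a"
    unfolding stair_combination_def fps_add_nth fps_sum_nth sum diff_zero first
    by (auto simp: stair_remainder_def fps_shift_cutoff)
qed

lemma stair_combination_diff:
  "stair_combination t m F (g - h) = stair_combination t m F g - stair_combination t m F h"
proof -
  have "stair_remainder t m (g - h) = stair_remainder t m g - stair_remainder t m h"
    by (rule series_eqI) (simp add: mcoeff_stair_remainder)
  then show ?thesis unfolding stair_combination_def
    by (simp add: fps_shift_diff algebra_simps sum_subtractf flip: fps_const_sub)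
qed

lemma vanish_below_stair_combination:
  assumes m: "m 0 = 0"
    and F: "\<And>i. i \<le> t \<Longrightarrow> is_lead (F i) (t - i, m i)" "\<And>i. i \<le> t \<Longrightarrow> mcoeff (F i) (t - i, m i) = 1"
    and g: "vanish_below K g"
  shows "vanish_below (Suc K) (g - stair_combination t m F g)"
proof -
  have eq: "g - stair_combination t m F g = fps_shift t g * (monomial (t - 0, m 0) - F 0) +
      (\<Sum>i=1..t. fps_const (fps_shift (m i) (fps_nth g (t - i))) * (monomial (t - i, m i) - F i))"
    by (subst stair_combination_monomials[where t = t and m = m and g = g, symmetric, OF m])
      (simp add: stair_combination_def algebra_simps sum_subtractf)
  have g': "K \<le> loc_rank \<mu>" if "mcoeff g \<mu> \<noteq> 0" for \<mu> using g that by (auto simp: vanish_below_def not_le[symmetric])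
  show ?thesis unfolding eq
  proof (intro vanish_below_add vanish_below_sum vanish_below_mult_tail F)
    fix \<alpha> assume "mcoeff (fps_shift t g) \<alpha> \<noteq> 0"
    then show "K \<le> loc_rank (\<alpha> + (t - 0, m 0))" using m by (intro g') (cases \<alpha>, auto simp: mcoeff_def)
  next
    fix i \<alpha> assume "i \<in> {1..t}" "mcoeff (fps_const (fps_shift (m i) (fps_nth g (t - i)))) \<alpha> \<noteq> 0"
    then show "K \<le> loc_rank (\<alpha> + (t - i, m i))"
      by (intro g') (cases \<alpha>, auto simp: mcoeff_def split: if_splits)
  qed auto
qed

text \<open>
  The map \<open>stair_combination\<close> differs from the identity by an operator that strictly lowers
  leading monomials, so it is inverted by a geometric series.
\<close>

lemma stair_combination_surj:
  assumes m: "m 0 = 0"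
    and F: "\<And>i. i \<le> t \<Longrightarrow> is_lead (F i) (t - i, m i)" "\<And>i. i \<le> t \<Longrightarrow> mcoeff (F i) (t - i, m i) = 1"
  shows "\<exists>g. stair_combination t m F g = f"
proof -
  let ?S = "stair_combination t m F"
  define it where "it n = ((\<lambda>g. g - ?S g) ^^ n) f" for n
  have it: "it 0 = f" "it (Suc n) = it n - ?S (it n)" for n by (simp_all add: it_def)
  have low: "vanish_below n (it n)" for n
  proof (induction n)
    case (Suc n)
    then show ?case using vanish_below_stair_combination[where F = F, OF m F] by (simp add: it)
  qed (simp add: vanish_below_def)
  define h where "h n = (\<Sum>k<n. it k)" for n
  have S0: "?S 0 = 0" using stair_combination_diff[of t m F 0 0] by simp
  have Sadd: "?S (a + b) = ?S a + ?S b" for a b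
    using stair_combination_diff[of t m F a "- b"] stair_combination_diff[of t m F 0 b] S0 by simp
  have Sh: "?S (h n) = f - it n" for n
    by (induction n) (auto simp: h_def S0 Sadd it)
  \<comment> \<open>The infinite sum of the \<open>it k\<close>, formed coefficientwise:
    \<open>it k\<close> vanishes below rank k, so a coefficient of rank r is final after r + 1
    terms.\<close>
  define g where "g = Abs_fps (\<lambda>a. Abs_fps (\<lambda>b. mcoeff (h (Suc (loc_rank (a, b)))) (a, b)))"
  have g: "mcoeff g \<mu> = mcoeff (h n) \<mu>" if "loc_rank \<mu> < n" for \<mu> n
  proof -
    have "mcoeff (h n) \<mu> = mcoeff (h (Suc (loc_rank \<mu>))) \<mu>"
      unfolding h_def mcoeff_sum using that low
      by (intro sum.mono_neutral_right) (auto simp: vanish_below_def)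
    then show ?thesis by (simp add: g_def mcoeff_def[of "Abs_fps _"])
  qed
  have "vanish_below n (?S g - f)" for n
  proof -
    have gh: "vanish_below n (g - h n)" using g by (auto simp: vanish_below_def)
    have "vanish_below n ((g - h n) - ((g - h n) - ?S (g - h n)))"
      by (rule vanish_below_diff[OF gh vanish_below_mono[OF vanish_below_stair_combination[where F = F, OF m F gh]]]) auto
    then have "vanish_below n (?S g - ?S (h n))" by (simp add: stair_combination_diff)
    then have "vanish_below n (?S g - ?S (h n) - it n)" using low by (rule vanish_below_diff)
    then show ?thesis by (simp add: Sh)
  qed
  then have "?S g - f = 0" by (rule vanish_below_all)
  then show ?thesis by auto
qed

text \<open>The exponents are only required to start with \<open>m 0 = 0\<close>. Taking them all 0
  gives Weierstrass division by a series with leading monomial x^t.\<close>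

lemma lex_division:
  assumes m: "m 0 = 0"
    and F: "\<And>i. i \<le> t \<Longrightarrow> is_lead (F i) (t - i, m i)" "\<And>i. i \<le> t \<Longrightarrow> mcoeff (F i) (t - i, m i) = 1"
  obtains q0 q r where "f = q0 * F 0 + (\<Sum>i=1..t. fps_const (q i) * F i) + r"
    "\<And>\<mu>. stair t m \<mu> \<Longrightarrow> mcoeff r \<mu> = 0"
proof -
  obtain g where "stair_combination t m F g = f" using stair_combination_surj[where F = F, OF m F] by blast
  then show ?thesis using that[of "fps_shift t g" "\<lambda>i. fps_shift (m i) (fps_nth g (t - i))" "stair_remainder t m g"]
    by (auto simp: stair_combination_def mcoeff_stair_remainder)
qed

lemma lex_exponents_mono:
  assumes "lex_exponents t m" "i \<le> j" "j \<le> t"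
  shows "m i \<le> m j"
  using assms(2,3)
proof (induction rule: dec_induct)
  case (step n)
  then show ?case using assms(1) unfolding lex_exponents_def
    by (metis Suc_le_lessD Suc_leD less_imp_le order_trans)
qed simp

lemma stair_mono:
  assumes "lex_exponents t m" "stair t m \<mu>" "fst \<mu> \<le> fst \<nu>" "snd \<mu> \<le> snd \<nu>"
  shows "stair t m \<nu>"
  using assms lex_exponents_mono[of t m "t - fst \<nu>" "t - fst \<mu>"]
  by (fastforce simp: stair_def)

lemma lex_ideal_iff:
  assumes lex: "lex_exponents t m"
  shows "f \<in> lex_ideal t m \<longleftrightarrow> (\<forall>\<mu>. mcoeff f \<mu> \<noteq> 0 \<longrightarrow> stair t m \<mu>)"
proof
  let ?J = "{f :: 'a series. \<forall>\<mu>. mcoeff f \<mu> \<noteq> 0 \<longrightarrow> stair t m \<mu>}"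
  have "is_ideal ?J" unfolding is_ideal_iff
  proof (intro conjI ballI allI)
    fix a b assume "a \<in> ?J" "b \<in> ?J"
    then show "a + b \<in> ?J" by (auto simp: add_nonneg_eq_0_iff) (metis add_0_left)
  next
    fix r a assume a: "a \<in> ?J"
    show "r * a \<in> ?J"
    proof (intro CollectI allI impI)
      fix \<mu> assume "mcoeff (r * a) \<mu> \<noteq> 0"
      from mcoeff_mult_nonzero[OF this] obtain \<alpha> \<beta> where "\<mu> = \<alpha> + \<beta>" "mcoeff a \<beta> \<noteq> 0" by blast
      then show "stair t m \<mu>" using a by (auto intro: stair_mono[OF lex, of \<beta>])
    qed
  qed auto
  moreover have "{monomial (t - i, m i) | i. i \<le> t} \<subseteq> ?J"
    by (auto simp: mcoeff_monomial stair_def split: if_splits)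
  ultimately have "lex_ideal t m \<subseteq> ?J" unfolding lex_ideal_def by (rule ideal_span_minimal[rotated])
  then show "f \<in> lex_ideal t m \<Longrightarrow> \<forall>\<mu>. mcoeff f \<mu> \<noteq> 0 \<longrightarrow> stair t m \<mu>" by auto
next
  assume f: "\<forall>\<mu>. mcoeff f \<mu> \<noteq> 0 \<longrightarrow> stair t m \<mu>"
  have "f = stair_combination t m (\<lambda>i. monomial (t - i, m i)) f"
    using lex by (intro stair_combination_monomials[symmetric]) (simp add: lex_exponents_def)
  note f' = this[unfolded stair_combination_def]
  have "stair_remainder t m f = 0" using f by (intro series_eqI) (auto simp: mcoeff_stair_remainder)
  moreover have "monomial (t - i, m i) \<in> lex_ideal t m" if "i \<le> t" for i
    unfolding lex_ideal_def using that by (intro ideal_span_base) auto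
  moreover from this[of 0] have "monomial (t, m 0) \<in> lex_ideal t m" by simp
  moreover have "is_ideal (lex_ideal t m :: 'a series set)" unfolding lex_ideal_def by (rule is_ideal_span)
  ultimately show "f \<in> lex_ideal t m"
    by (subst f') (auto intro!: is_ideal_add is_ideal_mult is_ideal_sum simp del: fps_const_mult)
qed

section \<open>Generators adapted to the powers of x\<close>

lemma lex_exponents_diff_mono:
  assumes "lex_exponents t m" "i \<le> j" "j \<le> t"
  shows "m i + j \<le> m j + i"
  using assms(2,3)
proof (induction rule: dec_induct)
  case (step n)
  then have "m n < m (Suc n)" using assms(1) by (simp add: lex_exponents_def)
  then show ?case using step by simp
qed simp

definition deg_ge :: "nat \<Rightarrow> 'k::field series \<Rightarrow> bool" where
  "deg_ge d g \<longleftrightarrow> (\<forall>\<mu>. mcoeff g \<mu> \<noteq> 0 \<longrightarrow> d \<le> fst \<mu> + snd \<mu>)"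

lemma deg_ge_iff: "deg_ge d g \<longleftrightarrow> (\<forall>\<mu>. fst \<mu> + snd \<mu> < d \<longrightarrow> mcoeff g \<mu> = 0)"
  unfolding deg_ge_def by (meson not_le)

lemma deg_ge_diff: "deg_ge d f \<Longrightarrow> deg_ge d g \<Longrightarrow> deg_ge d (f - g)"
  and deg_ge_mono: "deg_ge d f \<Longrightarrow> d' \<le> d \<Longrightarrow> deg_ge d' f"
  by (simp_all add: deg_ge_iff)

lemma deg_ge_sum: "(\<And>x. x \<in> A \<Longrightarrow> deg_ge d (f x)) \<Longrightarrow> deg_ge d (\<Sum>x\<in>A. f x)"
  by (simp add: deg_ge_iff mcoeff_sum)

lemma deg_ge_const_mult:
  assumes "deg_ge d' f" "\<And>k. fps_nth q k \<noteq> 0 \<Longrightarrow> d \<le> d' + k"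
  shows "deg_ge d (fps_const q * f)"
  unfolding deg_ge_def
proof (intro allI impI)
  fix \<mu> assume "mcoeff (fps_const q * f) \<mu> \<noteq> 0"
  from mcoeff_mult_nonzero[OF this] obtain \<alpha> \<beta> where
    "\<mu> = \<alpha> + \<beta>" "mcoeff (fps_const q) \<alpha> \<noteq> 0" "mcoeff f \<beta> \<noteq> 0" by blast
  then have "d' \<le> fst \<beta> + snd \<beta>" "fps_nth q (snd \<alpha>) \<noteq> 0"
    using assms(1) by (auto simp: deg_ge_def mcoeff_fps_const split: if_splits)
  then show "d \<le> fst \<mu> + snd \<mu>" using assms(2)[of "snd \<alpha>"] \<open>\<mu> = _\<close> by simp
qed

lemma deg_ge_X_mult:
  assumes "deg_ge d f"
  shows "deg_ge (Suc d) (fps_X * f)"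
  unfolding deg_ge_def
proof (intro allI impI)
  fix \<mu> assume "mcoeff (fps_X * f) \<mu> \<noteq> 0"
  then have "fst \<mu> \<noteq> 0" "mcoeff f (fst \<mu> - 1, snd \<mu>) \<noteq> 0" by (auto simp: mcoeff_def split: if_splits)
  then show "Suc d \<le> fst \<mu> + snd \<mu>" using assms by (force simp: deg_ge_def)
qed

lemma deg_ge_cancel_yX:
  assumes "deg_ge (d + k) (fps_const (fps_X ^ k) * f)"
  shows "deg_ge d f"
  unfolding deg_ge_def
proof (intro allI impI)
  fix \<mu> assume "mcoeff f \<mu> \<noteq> 0"
  then have "mcoeff (fps_const (fps_X ^ k) * f) (fst \<mu>, snd \<mu> + k) \<noteq> 0"
    by (simp add: mcoeff_def fps_X_power_mult_nth)
  then show "d \<le> fst \<mu> + snd \<mu>" using assms by (force simp: deg_ge_def)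
qed

text \<open>The x-degree and the order together force the leading monomial x^(t-i) y^(m i), which
  has the highest power of x in the lowest degree. In addition the top coefficient is exactly y^(m
  i), so that top terms cancel precisely when a relation is formed.\<close>

definition lex_system :: "nat \<Rightarrow> (nat \<Rightarrow> nat) \<Rightarrow> (nat \<Rightarrow> 'k::field series) \<Rightarrow> bool" where
  "lex_system t m f \<longleftrightarrow> (\<forall>i\<le>t. fps_nth (f i) (t - i) = fps_X ^ m i \<and>
     (\<forall>a>t - i. fps_nth (f i) a = 0) \<and> deg_ge (t - i + m i) (f i))"

lemma lex_system_lead:
  assumes "lex_system t m f" "i \<le> t"
  shows "is_lead (f i) (t - i, m i)" "mcoeff (f i) (t - i, m i) = 1"
proof -
  show 1: "mcoeff (f i) (t - i, m i) = 1" using assms by (simp add: lex_system_def mcoeff_def)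
  show "is_lead (f i) (t - i, m i)"
    unfolding is_lead_def
  proof (intro conjI allI impI)
    fix \<nu> assume nz: "mcoeff (f i) \<nu> \<noteq> 0"
    then have "fst \<nu> \<le> t - i" using assms by (auto simp: lex_system_def mcoeff_def not_less[symmetric])
    moreover have "t - i + m i \<le> fst \<nu> + snd \<nu>" using assms nz by (auto simp: lex_system_def deg_ge_def)
    ultimately show "loc_rank (t - i, m i) \<le> loc_rank \<nu>"
      by (auto simp: loc_rank_less_iff not_less[symmetric])
  qed (simp add: 1)
qed

text \<open>The summands have leads with different powers of x: t - i for i \<ge> 1, and at least t
  for the multiple of \<open>f 0\<close>. Hence nothing cancels, and the lead of the sum bounds the
  lead of every summand.\<close>

lemma combination_lead_term:
  assumes F: "\<And>i. i \<le> t \<Longrightarrow> is_lead (f i) (t - i, m i)"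
    and g: "g = q0 * f 0 + (\<Sum>i=1..t. fps_const (q i) * f i)"
    and nz: "q0 \<noteq> 0 \<or> (\<exists>i\<in>{1..t}. q i \<noteq> 0)"
  shows "\<exists>\<mu>. is_lead g \<mu> \<and> stair t m \<mu> \<and>
    (\<forall>i\<in>{1..t}. q i \<noteq> 0 \<longrightarrow> loc_rank \<mu> \<le> loc_rank (t - i, m i + subdegree (q i)))"
proof -
  obtain \<kappa> where l0: "q0 \<noteq> 0 \<Longrightarrow> is_lead q0 \<kappa>" using is_lead_exists by blast
  define T where "T i = (if i = 0 then q0 * f 0 else fps_const (q i) * f i)" for i
  define l where "l i = (if i = 0 then \<kappa> + (t, m 0) else (t - i, m i + subdegree (q i)))" for i
  define A where "A = {i\<in>{0..t}. if i = 0 then q0 \<noteq> 0 else q i \<noteq> 0}"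
  have gA: "g = (\<Sum>i\<in>A. T i)"
  proof -
    have "g = (\<Sum>i=0..t. T i)"
      unfolding g by (subst sum.atLeast_Suc_atMost) (auto simp: T_def intro!: sum.cong)
    also have "\<dots> = (\<Sum>i\<in>A. T i)" by (intro sum.mono_neutral_right) (auto simp: A_def T_def)
    finally show ?thesis .
  qed
  have lead: "is_lead (T i) (l i)" if i: "i \<in> A" for i
  proof (cases "i = 0")
    case True
    then show ?thesis using is_lead_mult[OF l0 F[of 0]] i by (simp add: A_def T_def l_def)
  next
    case False
    then have "is_lead (fps_const (q i) * f i) ((0, subdegree (q i)) + (t - i, m i))"
      using i by (intro is_lead_mult is_lead_fps_const F) (auto simp: A_def)
    then show ?thesis using False by (simp add: T_def l_def add.commute)
  qed
  have fst: "fst (l i) \<ge> t" if "i = 0" for i using that by (simp add: l_def)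
  have inj: "inj_on l A"
  proof (rule inj_onI)
    fix i j assume "i \<in> A" "j \<in> A" "l i = l j"
    then have "fst (l i) = fst (l j)" "i \<le> t" "j \<le> t" by (auto simp: A_def)
    then show "i = j" by (auto simp: l_def split: if_splits)
  qed
  have "A \<noteq> {}" using nz by (fastforce simp: A_def)
  then obtain x where x: "x \<in> A" "is_lead g (l x)" "\<And>y. y \<in> A \<Longrightarrow> loc_rank (l x) \<le> loc_rank (l y)"
    using is_lead_sum[of A T l, OF _ _ lead inj] unfolding gA by (auto simp: A_def)
  have "stair t m (l x)" using x(1) by (auto simp: stair_def l_def A_def)
  moreover have "loc_rank (l x) \<le> loc_rank (t - i, m i + subdegree (q i))" if "i \<in> {1..t}" "q i \<noteq> 0" for i
    using x(3)[of i] that by (auto simp: A_def l_def)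
  ultimately show ?thesis using x(2) by blast
qed

lemma combination_eq_0:
  assumes F: "\<And>i. i \<le> t \<Longrightarrow> is_lead (f i) (t - i, m i)"
    and g: "q0 * f 0 + (\<Sum>i=1..t. fps_const (q i) * f i) = 0"
  shows "q0 = 0" "\<And>i. i \<in> {1..t} \<Longrightarrow> q i = 0"
  using combination_lead_term[where f = f, OF F refl, of q0 q] is_lead_nonzero unfolding g by blast+

lemma combination_unique:
  assumes F: "\<And>i. i \<le> t \<Longrightarrow> is_lead (f i) (t - i, m i)"
    and g: "q0 * f 0 + (\<Sum>i=1..t. fps_const (q i) * f i) = p0 * f 0 + (\<Sum>i=1..t. fps_const (p i) * f i)"
  shows "q0 = p0" "\<And>i. i \<in> {1..t} \<Longrightarrow> q i = p i"
proof -
  have "(q0 - p0) * f 0 + (\<Sum>i=1..t. fps_const (q i - p i) * f i) = 0"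
    using g by (simp add: algebra_simps sum_subtractf flip: fps_const_sub)
  from combination_eq_0[where f = f and m = m, OF F this] show "q0 = p0" "\<And>i. i \<in> {1..t} \<Longrightarrow> q i = p i" by auto
qed

definition stair_leads :: "nat \<Rightarrow> (nat \<Rightarrow> nat) \<Rightarrow> 'k::field series set \<Rightarrow> bool" where
  "stair_leads t m J \<longleftrightarrow> (\<forall>g\<in>J. \<forall>\<mu>. is_lead g \<mu> \<longrightarrow> stair t m \<mu>)"

text \<open>The remainder of the division lies in J but has no monomial in the staircase; a leading
  monomial would contradict this, so it is 0.\<close>

lemma combination_exists:
  assumes m: "m 0 = 0" and J: "is_ideal J" "stair_leads t m J"
    and F: "\<And>i. i \<le> t \<Longrightarrow> is_lead (f i) (t - i, m i)" "\<And>i. i \<le> t \<Longrightarrow> mcoeff (f i) (t - i, m i) = 1"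
      "\<And>i. i \<le> t \<Longrightarrow> f i \<in> J"
    and g: "g \<in> J"
  shows "\<exists>q0 q. g = q0 * f 0 + (\<Sum>i=1..t. fps_const (q i) * f i)"
proof -
  obtain q0 q r where g': "g = q0 * f 0 + (\<Sum>i=1..t. fps_const (q i) * f i) + r"
    and r: "\<And>\<mu>. stair t m \<mu> \<Longrightarrow> mcoeff r \<mu> = 0"
    using lex_division[where F = f and f = g, OF m F(1,2)] by blast
  have "r = g - (q0 * f 0 + (\<Sum>i=1..t. fps_const (q i) * f i))" using g' by simp
  also have "\<dots> \<in> J" using F(3) by (intro is_ideal_diff is_ideal_add is_ideal_sum is_ideal_mult J g) auto
  finally have "r \<in> J" .
  have "r = 0"
  proof (rule ccontr)
    assume "r \<noteq> 0"
    then obtain \<mu> where "is_lead r \<mu>" using is_lead_exists by blast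
    then show False using J(2) \<open>r \<in> J\<close> r[of \<mu>] by (auto simp: stair_leads_def is_lead_def)
  qed
  then show ?thesis using g' by auto
qed

text \<open>Leading monomials alone say little about the x-degree of the summands; here the exact
  top coefficients y^(m i) of a \<open>lex_system\<close> are used to discard the generators of too
  high an x-degree.\<close>

lemma combination_exists_xdeg:
  assumes m: "m 0 = 0" and J: "is_ideal J" "stair_leads t m J"
    and f: "lex_system t m f" "\<And>i. i \<le> t \<Longrightarrow> f i \<in> J"
    and g: "g \<in> J" "\<And>a. t - j < a \<Longrightarrow> fps_nth g a = 0" and j: "j \<le> t"
  shows "\<exists>q. g = (\<Sum>i=j..t. fps_const (q i) * f i)"
proof -
  note F = lex_system_lead[OF f(1)]
  obtain q0 q where q: "g = q0 * f 0 + (\<Sum>i=1..t. fps_const (q i) * f i)"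
    using combination_exists[where f = f, OF m J F f(2) g(1)] by blast
  have xdeg: "fps_nth (f i) a = 0" if "i \<le> t" "t - i < a" for i a using f(1) that by (auto simp: lex_system_def)
  define c where "c = fps_nth q0 0"
  define q' where "q' = fps_shift 1 q0"
  have q0: "q0 = fps_const c + fps_X * q'"
    by (rule fps_ext) (auto simp: c_def q'_def)
  \<comment> \<open>Otherwise x \<open>q'\<close> times \<open>f 0\<close> would contain a monomial
    with x-exponent above t, where every other term of the equation vanishes.\<close>
  have "q' = 0"
  proof (rule ccontr)
    assume "q' \<noteq> 0"
    then obtain \<mu> where "is_lead q' \<mu>" using is_lead_exists by blast
    then have "is_lead (monomial (1, 0) * (q' * f 0)) ((1, 0) + (\<mu> + (t - 0, m 0)))"
      by (intro is_lead_mult is_lead_monomial F) auto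
    moreover have "monomial (1, 0) * (q' * f 0) = fps_X * q' * f 0"
      by (simp add: monomial_def varx_def mult.assoc)
    ultimately have "mcoeff (fps_X * q' * f 0) ((1, 0) + (\<mu> + (t - 0, m 0))) \<noteq> 0"
      unfolding is_lead_def by metis
    then have nz: "fps_nth (fps_X * q' * f 0) (1 + (fst \<mu> + t)) \<noteq> 0" by (auto simp: mcoeff_def)
    have "fps_X * q' * f 0 = g - (fps_const c * f 0 + (\<Sum>i=1..t. fps_const (q i) * f i))"
      unfolding q q0 by (simp add: algebra_simps)
    also have "fps_nth \<dots> (1 + (fst \<mu> + t)) = 0"
      using xdeg g(2) by (simp add: fps_sum_nth)
    finally show False using nz by simp
  qed
  define p where "p i = (if i = 0 then c else q i)" for i
  have gp: "g = (\<Sum>i=0..t. fps_const (p i) * f i)"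
    unfolding q q0 \<open>q' = 0\<close> by (subst sum.atLeast_Suc_atMost) (auto simp: p_def intro!: sum.cong)
  \<comment> \<open>In the coefficient of x^(t-i), earlier generators drop out by induction and
    later ones have too small an x-degree, so \<open>p i\<close> times y^(m i) must vanish.\<close>
  have p0: "p i = 0" if "i < j" for i
    using that
  proof (induction i rule: less_induct)
    case (less i)
    have "0 = fps_nth g (t - i)" using g(2) less.prems j by simp
    also have "\<dots> = (\<Sum>k=0..t. p k * fps_nth (f k) (t - i))" unfolding gp by (simp add: fps_sum_nth)
    also have "\<dots> = (\<Sum>k\<in>{i}. p k * fps_nth (f k) (t - i))"
    proof (rule sum.mono_neutral_right)
      show "\<forall>k\<in>{0..t} - {i}. p k * fps_nth (f k) (t - i) = 0"
      proof
        fix k assume k: "k \<in> {0..t} - {i}"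
        show "p k * fps_nth (f k) (t - i) = 0"
        proof (cases "k < i")
          case True
          then show ?thesis using less by simp
        next
          case False
          then have "i < k" "k \<le> t" using k by auto
          then show ?thesis using xdeg[of k "t - i"] by (simp add: diff_less_mono2)
        qed
      qed
    qed (use less.prems j in auto)
    also have "\<dots> = p i * fps_X ^ m i" using f(1) less.prems j by (simp add: lex_system_def)
    finally show ?case by simp
  qed
  have "g = (\<Sum>i=j..t. fps_const (p i) * f i)"
    unfolding gp using p0 by (intro sum.mono_neutral_right) auto
  then show ?thesis by blast
qed

lemma sum_lower_combination:
  fixes j t :: nat
  assumes "1 \<le> j" "j \<le> t"
  shows "(\<Sum>i=j..t. fps_const (q i) * f i) =
    0 * f 0 + (\<Sum>i=1..t. fps_const (if i < j then 0 else q i) * (f i :: 'k::field series))"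
  unfolding mult_zero_left add_0_left
  by (rule sum.mono_neutral_cong_left) (use assms in auto)

lemma lower_combination_eq_0:
  assumes f: "lex_system t m f" and j: "1 \<le> j" "j \<le> t"
    and z: "(\<Sum>i=j..t. fps_const (q i) * f i) = 0" and i: "i \<in> {j..t}"
  shows "q i = 0"
  using combination_eq_0(2)[where f = f and m = m, OF lex_system_lead(1)[OF f] z[unfolded sum_lower_combination[OF j]], of i] i j
  by simp

text \<open>Since leads do not cancel, the order of the sum bounds the order of each summand from
  below. This is what produces the order conditions on the entries of N.\<close>

lemma lower_combination_deg:
  assumes f: "lex_system t m f" and j: "1 \<le> j" "j \<le> t"
    and d: "deg_ge d (\<Sum>i=j..t. fps_const (q i) * f i)" and i: "i \<in> {j..t}" "fps_nth (q i) k \<noteq> 0"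
  shows "d \<le> t - i + m i + k"
proof -
  let ?q = "\<lambda>i. if i < j then 0 else q i"
  have qi: "q i \<noteq> 0" using i(2) by auto
  have "\<exists>i\<in>{1..t}. ?q i \<noteq> 0" using i j qi by (intro bexI[of _ i]) auto
  then obtain \<mu> where \<mu>: "is_lead (\<Sum>i=j..t. fps_const (q i) * f i) \<mu>"
    "\<forall>i\<in>{1..t}. ?q i \<noteq> 0 \<longrightarrow> loc_rank \<mu> \<le> loc_rank (t - i, m i + subdegree (?q i))"
    using combination_lead_term[where f = f and m = m and q = ?q, OF lex_system_lead(1)[OF f] sum_lower_combination[OF j, of q f]] by blast
  have "loc_rank \<mu> \<le> loc_rank (t - i, m i + subdegree (q i))" using \<mu>(2)[rule_format, of i] i j qi by auto
  then have "fst \<mu> + snd \<mu> \<le> t - i + (m i + subdegree (q i))"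
    using loc_rank_less_iff[of "(t - i, m i + subdegree (q i))" \<mu>] by (auto simp: not_less)
  moreover have "d \<le> fst \<mu> + snd \<mu>" using \<mu>(1) d by (auto simp: is_lead_def deg_ge_def)
  ultimately show ?thesis using subdegree_leI[OF i(2)] by simp
qed

text \<open>Order and degree of an entry bound the exponents of its nonzero coefficients, so the
  parameter space is simply the space of matrices with coefficients supported on
  \<open>coords\<close>.\<close>

lemma HB_params_iff:
  fixes N :: "'k::field poly mat"
  shows "N \<in> HB_params t m \<longleftrightarrow> N \<in> carrier_mat (t + 1) t \<and>
     (\<forall>i<t+1. \<forall>j<t. \<forall>k. coeff (N $$ (i, j)) k \<noteq> 0 \<longrightarrow> (i, j, k) \<in> coords t m)"
proof -
  have ord: "(u \<le> int (Polynomial.order 0 p) \<and> Polynomial.degree p < d) \<longleftrightarrow>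
      (\<forall>k. coeff p k \<noteq> 0 \<longrightarrow> u \<le> int k \<and> k < d)" if p: "p \<noteq> 0" for p :: "'k poly" and u d
  proof -
    have low: "coeff p k = 0" if "k < Polynomial.order 0 p" for k
    proof -
      have "[:- 0, 1:] ^ Polynomial.order 0 p dvd p" by (rule order_1)
      then have "Polynomial.monom 1 (Polynomial.order 0 p) dvd p" by (simp add: monom_altdef)
      then show ?thesis using that by (simp add: monom_1_dvd_iff')
    qed
    have "\<not> [:- 0, 1:] ^ Suc (Polynomial.order 0 p) dvd p" by (rule order_2[OF p])
    then have "\<not> Polynomial.monom 1 (Suc (Polynomial.order 0 p)) dvd p" by (simp add: monom_altdef)
    then have ex: "coeff p (Polynomial.order 0 p) \<noteq> 0" using low by (auto simp: monom_1_dvd_iff' less_Suc_eq)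
    show ?thesis
    proof
      assume "u \<le> int (Polynomial.order 0 p) \<and> Polynomial.degree p < d"
      then show "\<forall>k. coeff p k \<noteq> 0 \<longrightarrow> u \<le> int k \<and> k < d"
        using low le_degree[of p] by (metis int_ops(1) le_less_trans not_le of_nat_le_iff order_trans)
    next
      assume "\<forall>k. coeff p k \<noteq> 0 \<longrightarrow> u \<le> int k \<and> k < d"
      then show "u \<le> int (Polynomial.order 0 p) \<and> Polynomial.degree p < d" using ex p by simp
    qed
  qed
  have entry: "((i \<le> j \<longrightarrow> p = 0) \<and> (j < i \<longrightarrow> p \<noteq> 0 \<longrightarrow> udeg m (Suc i) (Suc j) \<le> int (Polynomial.order 0 p) \<and>
        Polynomial.degree p < ddiff m (Suc j))) \<longleftrightarrow> (\<forall>k. coeff p k \<noteq> 0 \<longrightarrow> (i, j, k) \<in> coords t m)"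
    if "i < t + 1" for i j and p :: "'k poly"
  proof (cases "p = 0")
    case False
    then obtain k0 where "coeff p k0 \<noteq> 0" using leading_coeff_0_iff by blast
    then show ?thesis using ord[OF False, of "udeg m (Suc i) (Suc j)" "ddiff m (Suc j)"] False that
      by (auto simp: coords_def not_le)
  qed simp
  show ?thesis unfolding HB_params_def using entry by simp
qed

text \<open>The statement that column j of H + N annihilates the vector \<open>f\<close>, solved for
  the diagonal term. Entries are a function \<open>n\<close> instead of a matrix because they are
  constructed column by column.\<close>

definition column_relation :: "nat \<Rightarrow> (nat \<Rightarrow> nat) \<Rightarrow> (nat \<Rightarrow> nat \<Rightarrow> 'k::field poly) \<Rightarrow> (nat \<Rightarrow> 'k series) \<Rightarrow> nat \<Rightarrow> bool" where
  "column_relation t m n f j \<longleftrightarrow> fps_const (fps_X ^ ddiff m (Suc j)) * f j =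
     fps_X * f (Suc j) - (\<Sum>i=Suc j..t. fps_const (fps_of_poly (n i j)) * f i)"

definition admissible :: "nat \<Rightarrow> (nat \<Rightarrow> nat) \<Rightarrow> (nat \<Rightarrow> nat \<Rightarrow> 'k::field poly) \<Rightarrow> nat \<Rightarrow> bool" where
  "admissible t m n j \<longleftrightarrow> (\<forall>i\<in>{Suc j..t}. \<forall>k. coeff (n i j) k \<noteq> 0 \<longrightarrow> (i, j, k) \<in> coords t m)"

lemma ddiff_Suc: "lex_exponents t m \<Longrightarrow> j < t \<Longrightarrow> m (Suc j) = m j + ddiff m (Suc j) \<and> 0 < ddiff m (Suc j)"
  by (auto simp: ddiff_def lex_exponents_def)

lemma coords_deg:
  assumes "(i, j, k) \<in> coords t m"
  shows "j < i" "i \<le> t" "k < ddiff m (Suc j)" "m (Suc j) + i \<le> m i + j + k"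
  using assms by (auto simp: coords_def udeg_def)

text \<open>Descending from t, each relation determines y^d f j from the later generators, and y^d
  can be cancelled.\<close>

lemma relations_unique:
  fixes f f' :: "nat \<Rightarrow> 'k::field series"
  assumes "\<And>j. j < t \<Longrightarrow> column_relation t m n f j" "\<And>j. j < t \<Longrightarrow> column_relation t m n f' j" "f t = f' t"
  shows "i \<le> t \<Longrightarrow> f i = f' i"
proof (induction "t - i" arbitrary: i rule: less_induct)
  case less
  show ?case
  proof (cases "i = t")
    case False
    then have i: "i < t" using less.prems by simp
    have "f k = f' k" if "k \<in> {Suc i..t}" for k using that i by (intro less.hyps) auto
    then have "f (Suc i) = f' (Suc i)"
      "(\<Sum>k=Suc i..t. fps_const (fps_of_poly (n k i)) * f k) = (\<Sum>k=Suc i..t. fps_const (fps_of_poly (n k i)) * f' k)"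
      using i by (auto intro!: sum.cong)
    then have "fps_const (fps_X ^ ddiff m (Suc i)) * f i = fps_const (fps_X ^ ddiff m (Suc i)) * f' i"
      using assms(1,2)[OF i] unfolding column_relation_def by metis
    then show ?thesis by simp
  qed (use assms(3) in simp)
qed

text \<open>Descending induction: each property passes from the right-hand side of the relation to
  y^d f i, and from there to f i.\<close>

lemma lex_system_of_relations:
  fixes f :: "nat \<Rightarrow> 'k::field series"
  assumes lex: "lex_exponents t m" and n: "\<And>j. j < t \<Longrightarrow> admissible t m n j"
    and rel: "\<And>j. j < t \<Longrightarrow> column_relation t m n f j" and ft: "f t = fps_const (fps_X ^ m t)"
  shows "lex_system t m f"
proof -
  have "fps_nth (f i) (t - i) = fps_X ^ m i \<and> (\<forall>a>t - i. fps_nth (f i) a = 0) \<and> deg_ge (t - i + m i) (f i)"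
    if "i \<le> t" for i
    using that
  proof (induction "t - i" arbitrary: i rule: less_induct)
    case less
    show ?case
    proof (cases "i = t")
      case True
      have "deg_ge (m t) (fps_const (fps_X ^ m t))"
        by (auto simp: deg_ge_def mcoeff_fps_const fps_X_power_nth split: if_splits)
      then show ?thesis using True ft by simp
    next
      case False
      then have i: "i < t" using less.prems by simp
      have IH: "fps_nth (f k) (t - k) = fps_X ^ m k" "\<And>a. t - k < a \<Longrightarrow> fps_nth (f k) a = 0" "deg_ge (t - k + m k) (f k)"
        if "k \<in> {Suc i..t}" for k using less.hyps[of k] that i by auto
      let ?d = "ddiff m (Suc i)"
      note d = ddiff_Suc[OF lex i]
      let ?S = "\<Sum>k=Suc i..t. fps_const (fps_of_poly (n k i)) * f k"
      have R: "fps_const (fps_X ^ ?d) * f i = fps_X * f (Suc i) - ?S"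
        using rel[OF i] by (simp add: column_relation_def)
      have S0: "fps_nth ?S a = 0" if "t - Suc i < a" for a
        unfolding fps_sum_nth using that i by (intro sum.neutral) (auto intro!: IH)
      have nth: "fps_X ^ ?d * fps_nth (f i) a = fps_nth (fps_X * f (Suc i) - ?S) a" for a
        by (metis R fps_mult_left_const_nth)
      have "fps_X ^ ?d * fps_nth (f i) (t - i) = fps_X ^ m (Suc i)"
        unfolding nth using S0[of "t - i"] IH(1)[of "Suc i"] i by simp
      then have A: "fps_nth (f i) (t - i) = fps_X ^ m i"
        using d by (simp add: power_add mult.commute)
      have B: "fps_nth (f i) a = 0" if "t - i < a" for a
      proof -
        have "fps_X ^ ?d * fps_nth (f i) a = 0"
          unfolding nth using S0[of a] IH(2)[of "Suc i" "a - 1"] i that by simp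
        then show ?thesis by simp
      qed
      \<comment> \<open>The lower bound on the exponents in column i is exactly what gives every
        summand at least the order of x f(i+1).\<close>
      have "deg_ge (Suc (t - Suc i + m (Suc i))) (fps_X * f (Suc i) - ?S)"
      proof (intro deg_ge_diff deg_ge_X_mult deg_ge_sum)
        fix k assume k: "k \<in> {Suc i..t}"
        show "deg_ge (Suc (t - Suc i + m (Suc i))) (fps_const (fps_of_poly (n k i)) * f k)"
        proof (rule deg_ge_const_mult[OF IH(3)[OF k]])
          fix c assume "fps_nth (fps_of_poly (n k i)) c \<noteq> 0"
          then have "(k, i, c) \<in> coords t m" using n[OF i] k by (auto simp: admissible_def)
          from coords_deg[OF this] show "Suc (t - Suc i + m (Suc i)) \<le> t - k + m k + c" using i by simp
        qed
      qed (use IH(3)[of "Suc i"] i in auto)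
      then have "deg_ge (t - i + m i + ?d) (fps_const (fps_X ^ ?d) * f i)" unfolding R
        by (rule deg_ge_mono) (use d i in auto)
      then show ?thesis using A B deg_ge_cancel_yX by blast
    qed
  qed
  then show ?thesis by (simp add: lex_system_def)
qed

section \<open>Parametrization of the Groebner cell\<close>

definition combinations :: "nat \<Rightarrow> (nat \<Rightarrow> 'k::field series) \<Rightarrow> 'k series set" where
  "combinations t f = {q0 * f 0 + (\<Sum>i=1..t. fps_const (q i) * f i) | q0 q. True}"

lemma combinations_add: "a \<in> combinations t f \<Longrightarrow> b \<in> combinations t f \<Longrightarrow> a + b \<in> combinations t f"
proof -
  assume "a \<in> combinations t f" "b \<in> combinations t f"
  then obtain q0 q p0 p where "a = q0 * f 0 + (\<Sum>i=1..t. fps_const (q i) * f i)"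
    "b = p0 * f 0 + (\<Sum>i=1..t. fps_const (p i) * f i)" unfolding combinations_def by auto
  then have "a + b = (q0 + p0) * f 0 + (\<Sum>i=1..t. fps_const (q i + p i) * f i)"
    by (simp add: algebra_simps sum.distrib flip: fps_const_add)
  then show ?thesis unfolding combinations_def by (intro CollectI exI[of _ "q0 + p0"] exI[of _ "\<lambda>i. q i + p i"]) simp
qed

lemma combinations_const_mult: "a \<in> combinations t f \<Longrightarrow> fps_const c * a \<in> combinations t f"
proof -
  assume "a \<in> combinations t f"
  then obtain q0 q where "a = q0 * f 0 + (\<Sum>i=1..t. fps_const (q i) * f i)" unfolding combinations_def by auto
  then have "fps_const c * a = (fps_const c * q0) * f 0 + (\<Sum>i=1..t. fps_const (c * q i) * f i)"
    by (simp add: algebra_simps sum_distrib_left flip: fps_const_mult)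
  then show ?thesis unfolding combinations_def by (intro CollectI exI[of _ "fps_const c * q0"] exI[of _ "\<lambda>i. c * q i"]) simp
qed

lemma combinations_0: "r * f 0 \<in> combinations t f"
  unfolding combinations_def by (intro CollectI exI[of _ r] exI[of _ "\<lambda>_. 0"]) simp

lemma combinations_sum: "(\<And>x. x \<in> A \<Longrightarrow> g x \<in> combinations t f) \<Longrightarrow> (\<Sum>x\<in>A. g x) \<in> combinations t f"
  using combinations_0[of 0 f t] by (induction A rule: infinite_finite_induct) (auto intro: combinations_add)

lemma combinations_base: "i \<le> t \<Longrightarrow> f i \<in> combinations t f"
proof (cases "i = 0")
  case True
  then show ?thesis using combinations_0[of 1 f t] by simp
next
  case False
  assume "i \<le> t"
  then have "f i = 0 * f 0 + (\<Sum>k=1..t. fps_const (if k = i then 1 else 0) * f k)"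
    using False by (simp add: if_distrib if_distribR sum.delta cong: if_cong)
  then show ?thesis unfolding combinations_def
    by (intro CollectI exI[of _ 0] exI[of _ "\<lambda>k. if k = i then 1 else 0"] conjI TrueI)
qed

text \<open>Only \<open>f 0\<close> is multiplied by arbitrary series, so closure under x has to be
  shown for the other generators; there the column relation rewrites x f(j+1). Series in x with
  infinitely many terms need a separate argument.\<close>

lemma combinations_ideal:
  assumes f: "lex_system t m f" and rel: "\<And>j. j < t \<Longrightarrow> column_relation t m n f j" and m: "m 0 = 0"
  shows "is_ideal (combinations t f)"
proof -
  let ?T = "combinations t f"
  have Xf: "fps_X * f i \<in> ?T" if "i \<in> {1..t}" for i
  proof -
    obtain j where j: "i = Suc j" "j < t" using \<open>i \<in> _\<close> by (cases i) auto
    have "fps_X * f i = fps_const (fps_X ^ ddiff m (Suc j)) * f j + (\<Sum>i=Suc j..t. fps_const (fps_of_poly (n i j)) * f i)"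
      using rel[OF j(2)] j(1) by (simp add: column_relation_def)
    also have "\<dots> \<in> ?T" using j
      by (intro combinations_add combinations_sum combinations_const_mult combinations_base) auto
    finally show ?thesis .
  qed
  have X: "fps_X * a \<in> ?T" if a: "a \<in> ?T" for a
  proof -
    obtain q0 q where "a = q0 * f 0 + (\<Sum>i=1..t. fps_const (q i) * f i)" using a unfolding combinations_def by auto
    then have "fps_X * a = (fps_X * q0) * f 0 + (\<Sum>i=1..t. fps_const (q i) * (fps_X * f i))"
      by (simp add: algebra_simps sum_distrib_left)
    then show ?thesis using Xf
      by (auto intro!: combinations_add combinations_0 combinations_sum combinations_const_mult)
  qed
  have Xn: "fps_X ^ k * a \<in> ?T" if "a \<in> ?T" for a k
    using that by (induction k) (auto simp: mult.assoc intro: X)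
  \<comment> \<open>Weierstrass division by \<open>f 0\<close> leaves only finitely many powers of \<open>x\<close>.\<close>
  have R: "r * f i \<in> ?T" if i: "i \<le> t" for r i
  proof -
    \<comment> \<open>\<open>f 0\<close> has lead x^t because m 0 = 0. With all exponents 0 every
      monomial lies in the staircase, so the remainder \<open>w\<close> is 0.\<close>
    let ?F = "\<lambda>k. if k = 0 then f 0 else monomial (t - k, 0)"
    obtain q0 q w where r: "r = q0 * ?F 0 + (\<Sum>k=1..t. fps_const (q k) * ?F k) + w"
      and w: "\<And>\<mu>. stair t (\<lambda>_. 0) \<mu> \<Longrightarrow> mcoeff w \<mu> = 0"
    proof (rule lex_division[of "\<lambda>_. 0" t ?F r])
      show "is_lead (?F k) (t - k, 0)" "mcoeff (?F k) (t - k, 0) = 1" if "k \<le> t" for k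
        using lex_system_lead[OF f, of 0] m by (auto simp: is_lead_monomial mcoeff_monomial)
    qed auto
    have "w = 0" using w by (intro series_eqI) (simp add: stair_def)
    then have "r * f i = (q0 * f i) * f 0 + (\<Sum>k=1..t. fps_const (q k) * (fps_X ^ (t - k) * f i))"
      unfolding r by (simp add: algebra_simps sum_distrib_left sum_distrib_right monomial_def varx_def)
    then show ?thesis using i
      by (auto intro!: combinations_add combinations_0 combinations_sum combinations_const_mult Xn combinations_base)
  qed
  show ?thesis unfolding is_ideal_iff
  proof (intro conjI ballI allI)
    show "0 \<in> ?T" using combinations_0[of 0 f t] by simp
    fix r a assume "a \<in> ?T"
    then obtain q0 q where "a = q0 * f 0 + (\<Sum>i=1..t. fps_const (q i) * f i)" unfolding combinations_def by auto
    then have "r * a = (r * q0) * f 0 + (\<Sum>i=1..t. (r * fps_const (q i)) * f i)"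
      by (simp add: algebra_simps sum_distrib_left)
    then show "r * a \<in> ?T" by (auto intro!: combinations_add combinations_0 combinations_sum R)
  qed (rule combinations_add)
qed

lemma span_eq_combinations:
  assumes f: "lex_system t m f" and rel: "\<And>j. j < t \<Longrightarrow> column_relation t m n f j" and m: "m 0 = 0"
  shows "ideal_span (f ` {..t}) = combinations t f"
proof
  show "ideal_span (f ` {..t}) \<subseteq> combinations t f"
    using combinations_ideal[OF assms] by (intro ideal_span_minimal) (auto intro: combinations_base)
  have "f i \<in> ideal_span (f ` {..t})" if "i \<le> t" for i using that by (intro ideal_span_base) auto
  then show "combinations t f \<subseteq> ideal_span (f ` {..t})"
    unfolding combinations_def by (auto intro!: is_ideal_add is_ideal_mult is_ideal_sum is_ideal_span)
qed

lemma combinations_stair_leads: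
  assumes "lex_system t m f"
  shows "stair_leads t m (combinations t f)"
  unfolding stair_leads_def
proof (intro ballI allI impI)
  fix g \<mu> assume g: "g \<in> combinations t f" and l: "is_lead g \<mu>"
  then obtain q0 q where q: "g = q0 * f 0 + (\<Sum>i=1..t. fps_const (q i) * f i)" unfolding combinations_def by auto
  have "q0 \<noteq> 0 \<or> (\<exists>i\<in>{1..t}. q i \<noteq> 0)"
  proof (rule ccontr)
    assume "\<not> ?thesis"
    then have "g = 0" unfolding q by simp
    then show False using is_lead_nonzero[OF l] by simp
  qed
  from combination_lead_term[where f = f, OF lex_system_lead(1)[OF assms] q this]
  show "stair t m \<mu>" using is_lead_unique[OF l] by blast
qed

section \<open>Leading ideals and reduced elements of an ideal in the cell\<close>

lemma lead_ideal_of_system: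
  assumes gt: "term_ordering gt" "gt (1, 0) (0, 1)" and lex: "lex_exponents t m"
    and J: "stair_leads t m J" and f: "lex_system t m f" "\<And>i. i \<le> t \<Longrightarrow> f i \<in> J"
  shows "lead_ideal gt J = lex_ideal t m"
proof
  have "monomial (lead_exp gt g) \<in> lex_ideal t m" if g: "g \<in> J" "g \<noteq> 0" for g
  proof -
    obtain \<mu> where \<mu>: "is_lead g \<mu>" using is_lead_exists[OF g(2)] by blast
    then show ?thesis using J g lead_exp_eq[OF gt \<mu>]
      by (auto simp: lex_ideal_iff[OF lex] mcoeff_monomial stair_leads_def split: if_splits)
  qed
  then show "lead_ideal gt J \<subseteq> lex_ideal t m"
    unfolding lead_ideal_def by (intro ideal_span_minimal) (auto simp: lex_ideal_def is_ideal_span)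
  show "lex_ideal t m \<subseteq> lead_ideal gt J"
    unfolding lex_ideal_def
  proof (rule ideal_span_minimal)
    show "is_ideal (lead_ideal gt J)" unfolding lead_ideal_def by (rule is_ideal_span)
    have "monomial (t - i, m i) \<in> lead_ideal gt J" if i: "i \<le> t" for i
      unfolding lead_ideal_def using lead_exp_eq[OF gt lex_system_lead(1)[OF f(1) i]] f(2)[OF i]
        is_lead_nonzero[OF lex_system_lead(1)[OF f(1) i]]
      by (intro ideal_span_base) (metis (mono_tags, lifting) mem_Collect_eq)
    then show "{monomial (t - i, m i) |i. i \<le> t} \<subseteq> lead_ideal gt J" by auto
  qed
qed

lemma cell_stair_leads:
  assumes gt: "term_ordering gt" "gt (1, 0) (0, 1)" and lex: "lex_exponents t m"
    and J: "J \<in> cell gt (lex_ideal t m)"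
  shows "stair_leads t m J"
  unfolding stair_leads_def
proof (intro ballI allI impI)
  fix g \<mu> assume g: "g \<in> J" "is_lead g \<mu>"
  have "monomial (lead_exp gt g) \<in> lead_ideal gt J" unfolding lead_ideal_def
    using g is_lead_nonzero[OF g(2)] by (intro ideal_span_base) auto
  then have "(monomial \<mu> :: 'a series) \<in> lex_ideal t m" using J lead_exp_eq[OF gt g(2)] by (simp add: cell_def)
  then show "stair t m \<mu>" using lex_ideal_iff[OF lex, of "monomial \<mu> :: 'a series"] by (auto simp: mcoeff_monomial)
qed

text \<open>The series all of whose monomials are divisible by a leading monomial of J form an ideal
  containing the leading ideal. So each generator of the lex-segment ideal is divisible by the lead
  of some element of J, which is then multiplied up and rescaled.\<close>

lemma cell_leads_exist:
  fixes J :: "'k::field series set"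
  assumes gt: "term_ordering gt" "gt (1, 0) (0, 1)"
    and J: "J \<in> cell gt (lex_ideal t m)" and i: "i \<le> t"
  shows "\<exists>F\<in>J. is_lead F (t - i, m i) \<and> mcoeff F (t - i, m i) = 1"
proof -
  have id: "is_ideal J" using J by (simp add: cell_def)
  let ?K = "{g :: 'k series. \<forall>\<mu>. mcoeff g \<mu> \<noteq> 0 \<longrightarrow> (\<exists>f\<in>J. \<exists>\<nu>. is_lead f \<nu> \<and> fst \<nu> \<le> fst \<mu> \<and> snd \<nu> \<le> snd \<mu>)}"
  have "is_ideal ?K" unfolding is_ideal_iff
  proof (intro conjI ballI allI)
    fix a b assume ab: "a \<in> ?K" "b \<in> ?K"
    show "a + b \<in> ?K"
    proof (intro CollectI allI impI)
      fix \<mu> assume "mcoeff (a + b) \<mu> \<noteq> 0"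
      then have "mcoeff a \<mu> \<noteq> 0 \<or> mcoeff b \<mu> \<noteq> 0" by auto
      then show "\<exists>f\<in>J. \<exists>\<nu>. is_lead f \<nu> \<and> fst \<nu> \<le> fst \<mu> \<and> snd \<nu> \<le> snd \<mu>" using ab by auto
    qed
  next
    fix r a assume a: "a \<in> ?K"
    show "r * a \<in> ?K"
    proof (intro CollectI allI impI)
      fix \<mu> assume "mcoeff (r * a) \<mu> \<noteq> 0"
      from mcoeff_mult_nonzero[OF this] obtain \<alpha> \<beta> where ab: "\<mu> = \<alpha> + \<beta>" "mcoeff a \<beta> \<noteq> 0" by blast
      then obtain f \<nu> where "f \<in> J" "is_lead f \<nu>" "fst \<nu> \<le> fst \<beta>" "snd \<nu> \<le> snd \<beta>" using a by blast
      then show "\<exists>f\<in>J. \<exists>\<nu>. is_lead f \<nu> \<and> fst \<nu> \<le> fst \<mu> \<and> snd \<nu> \<le> snd \<mu>" unfolding ab(1)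
        by (intro bexI[of _ f] exI[of _ \<nu>]) auto
    qed
  qed auto
  moreover have "{monomial (lead_exp gt f) | f. f \<in> J \<and> f \<noteq> 0} \<subseteq> ?K"
  proof safe
    fix f \<mu> assume f: "f \<in> J" "f \<noteq> 0" "mcoeff (monomial (lead_exp gt f) :: 'k series) \<mu> \<noteq> 0"
    obtain \<nu> where "is_lead f \<nu>" using is_lead_exists[OF f(2)] by blast
    then show "\<exists>f\<in>J. \<exists>\<nu>. is_lead f \<nu> \<and> fst \<nu> \<le> fst \<mu> \<and> snd \<nu> \<le> snd \<mu>"
      using f lead_exp_eq[OF gt, of f \<nu>] by (auto simp: mcoeff_monomial split: if_splits)
  qed
  ultimately have "lead_ideal gt J \<subseteq> ?K" unfolding lead_ideal_def by (rule ideal_span_minimal[rotated])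
  moreover have "monomial (t - i, m i) \<in> lead_ideal gt J"
    using J i unfolding cell_def lex_ideal_def by (auto intro!: ideal_span_base)
  ultimately have "monomial (t - i, m i) \<in> ?K" by blast
  then have "mcoeff (monomial (t - i, m i) :: 'k series) (t - i, m i) \<noteq> 0 \<longrightarrow>
      (\<exists>f\<in>J. \<exists>\<nu>. is_lead f \<nu> \<and> fst \<nu> \<le> fst (t - i, m i) \<and> snd \<nu> \<le> snd (t - i, m i))" by blast
  then obtain f \<nu> where f: "f \<in> J" "is_lead f \<nu>" "fst \<nu> \<le> t - i" "snd \<nu> \<le> m i"
    by (auto simp: mcoeff_monomial)
  let ?\<kappa> = "(t - i - fst \<nu>, m i - snd \<nu>)"
  define F where "F = fps_const (fps_const (inverse (mcoeff f \<nu>))) * (monomial ?\<kappa> * f)"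
  have \<kappa>: "?\<kappa> + \<nu> = (t - i, m i)" using f by (simp add: prod_eq_iff)
  have c: "mcoeff f \<nu> \<noteq> 0" using f by (simp add: is_lead_def)
  have Fc: "mcoeff F \<mu> = inverse (mcoeff f \<nu>) * mcoeff (monomial ?\<kappa> * f) \<mu>" for \<mu>
    unfolding F_def kscale_def[symmetric] by simp
  have l: "is_lead (monomial ?\<kappa> * f) (t - i, m i)" "mcoeff (monomial ?\<kappa> * f) (t - i, m i) = mcoeff f \<nu>"
    using is_lead_mult_aux[OF is_lead_monomial[of ?\<kappa>] f(2)] unfolding \<kappa> by (auto simp: mcoeff_monomial)
  have "is_lead F (t - i, m i)" "mcoeff F (t - i, m i) = 1" using l c by (auto simp: is_lead_def Fc)
  moreover have "F \<in> J" unfolding F_def using f(1) id by (intro is_ideal_mult) auto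
  ultimately show ?thesis by blast
qed

text \<open>
  Completely reduced elements have \<open>x\<close>-degree \<open>t - i\<close>: outside the staircase, a monomial with
  at least this power of \<open>x\<close> has too small a degree.
\<close>

lemma reduced_system_exists:
  assumes lex: "lex_exponents t m" and J: "is_ideal J" "stair_leads t m J"
    and ex: "\<And>i. i \<le> t \<Longrightarrow> \<exists>F\<in>J. is_lead F (t - i, m i) \<and> mcoeff F (t - i, m i) = 1"
  shows "\<exists>f. lex_system t m f \<and> (\<forall>i\<le>t. f i \<in> J)"
proof -
  have m0: "m 0 = 0" using lex by (simp add: lex_exponents_def)
  obtain F where F: "\<And>i. i \<le> t \<Longrightarrow> F i \<in> J" "\<And>i. i \<le> t \<Longrightarrow> is_lead (F i) (t - i, m i)"
    "\<And>i. i \<le> t \<Longrightarrow> mcoeff (F i) (t - i, m i) = 1" using ex by metis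
  have "\<exists>f\<in>J. fps_nth f (t - i) = fps_X ^ m i \<and> (\<forall>a>t - i. fps_nth f a = 0) \<and> deg_ge (t - i + m i) f"
    if i: "i \<le> t" for i
  proof -
    \<comment> \<open>Complete reduction: the leading monomial is divided by the \<open>F i\<close>,
      and subtracting the remainder leaves an element of J.\<close>
    obtain q0 q r where r: "monomial (t - i, m i) = q0 * F 0 + (\<Sum>i=1..t. fps_const (q i) * F i) + r"
      "\<And>\<mu>. stair t m \<mu> \<Longrightarrow> mcoeff r \<mu> = 0"
      using lex_division[where F = F and f = "monomial (t - i, m i)", OF m0 F(2,3)] by blast
    define f where "f = monomial (t - i, m i) - r"
    have "f = q0 * F 0 + (\<Sum>i=1..t. fps_const (q i) * F i)" using r(1) by (simp add: f_def)
    then have fJ: "f \<in> J" using F(1) by (auto intro!: is_ideal_add is_ideal_mult is_ideal_sum J)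
    have st: "stair t m (t - i, m i)" using i by (auto simp: stair_def)
    have fc: "mcoeff f (t - i, m i) = 1" using r(2)[OF st] by (simp add: f_def mcoeff_monomial)
    then obtain \<mu> where \<mu>: "is_lead f \<mu>" using is_lead_exists[of f] by fastforce
    \<comment> \<open>The lead of \<open>f\<close> lies in the staircase while the remainder has no
      monomial there, so the lead is the monomial itself.\<close>
    have "stair t m \<mu>" using J(2) fJ \<mu> by (auto simp: stair_leads_def)
    then have "\<mu> = (t - i, m i)" using \<mu> r(2)[of \<mu>] by (auto simp: f_def is_lead_def mcoeff_monomial split: if_splits)
    then have low: "loc_rank (t - i, m i) \<le> loc_rank \<nu>" if "mcoeff f \<nu> \<noteq> 0" for \<nu>
      using \<mu> that by (auto simp: is_lead_def)
    have dg: "t - i + m i \<le> fst \<nu> + snd \<nu>" if "mcoeff f \<nu> \<noteq> 0" for \<nu>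
      using low[OF that] loc_rank_less_iff[of \<nu> "(t - i, m i)"] by auto
    have xd: "fst \<nu> < t - i" if "mcoeff f \<nu> \<noteq> 0" "\<nu> \<noteq> (t - i, m i)" for \<nu>
    proof (rule ccontr)
      assume h: "\<not> fst \<nu> < t - i"
      have "\<not> stair t m \<nu>" using that r(2)[of \<nu>] by (auto simp: f_def mcoeff_monomial)
      then have "fst \<nu> < t" "snd \<nu> < m (t - fst \<nu>)" by (auto simp: stair_def)
      moreover have "m (t - fst \<nu>) + i \<le> m i + (t - fst \<nu>)"
        using h i by (intro lex_exponents_diff_mono[OF lex]) auto
      ultimately show False using dg[OF that(1)] h i by linarith
    qed
    have "fps_nth f (t - i) = fps_X ^ m i"
    proof (rule fps_ext)
      fix b
      show "fps_nth (fps_nth f (t - i)) b = fps_nth (fps_X ^ m i) b"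
        using xd[of "(t - i, b)"] fc by (auto simp: mcoeff_def fps_X_power_nth)
    qed
    moreover have "fps_nth f a = 0" if a: "t - i < a" for a
    proof (rule fps_ext)
      fix b
      show "fps_nth (fps_nth f a) b = fps_nth 0 b" using xd[of "(a, b)"] a by (auto simp: mcoeff_def)
    qed
    moreover have "deg_ge (t - i + m i) f" using dg by (auto simp: deg_ge_def)
    ultimately show ?thesis using fJ by blast
  qed
  then show ?thesis unfolding lex_system_def by metis
qed

lemma lex_system_last: "lex_system t m f \<Longrightarrow> f t = fps_const (fps_X ^ m t)"
  by (rule fps_ext) (auto simp: lex_system_def)

definition cut_poly :: "nat \<Rightarrow> 'k::field fps \<Rightarrow> 'k poly" where
  "cut_poly d q = (\<Sum>k<d. Polynomial.monom (fps_nth q k) k)"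

lemma coeff_cut_poly: "coeff (cut_poly d q) k = (if k < d then fps_nth q k else 0)"
  by (simp add: cut_poly_def Polynomial.coeff_sum sum.delta)

lemma cut_poly_decomp: "q = fps_X ^ d * fps_shift d q + fps_of_poly (cut_poly d q)"
  by (rule fps_ext) (auto simp: coeff_cut_poly fps_X_power_mult_nth)

text \<open>Induction on the number \<open>l\<close> of columns already treated, counted from the
  last. Only \<open>f j\<close> is changed at each stage, so the later columns keep their
  relations.\<close>

lemma relations_exist:
  fixes J :: "'k::field series set"
  assumes lex: "lex_exponents t m" and J: "is_ideal J" "stair_leads t m J"
    and ex: "\<exists>f. lex_system t m f \<and> (\<forall>i\<le>t. f i \<in> J)" and l: "l \<le> t"
  shows "\<exists>f n. lex_system t m f \<and> (\<forall>i\<le>t. f i \<in> J) \<and>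
     (\<forall>c. t - l \<le> c \<and> c < t \<longrightarrow> admissible t m n c \<and> column_relation t m n f c)"
  using l
proof (induction l)
  case 0
  then show ?case using ex by (metis diff_zero not_le)
next
  case (Suc l)
  define j where "j = t - Suc l"
  have j: "j < t" "t - l = Suc j" using Suc.prems by (auto simp: j_def)
  from Suc obtain f n where f: "lex_system t m f" "\<And>i. i \<le> t \<Longrightarrow> f i \<in> J"
    and rel: "\<And>c. Suc j \<le> c \<Longrightarrow> c < t \<Longrightarrow> admissible t m n c \<and> column_relation t m n f c"
    unfolding j(2) by auto
  have m0: "m 0 = 0" using lex by (simp add: lex_exponents_def)
  define d where "d = ddiff m (Suc j)"
  have d: "m (Suc j) = m j + d" "0 < d" using ddiff_Suc[OF lex j(1)] by (auto simp: d_def)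
  have fi: "fps_nth (f i) (t - i) = fps_X ^ m i" "\<And>a. t - i < a \<Longrightarrow> fps_nth (f i) a = 0" "deg_ge (t - i + m i) (f i)"
    if "i \<le> t" for i using f(1) that by (auto simp: lex_system_def)
  \<comment> \<open>The top terms of the two products cancel, so the x-degree drops and
    \<open>g\<close> involves only the generators after j.\<close>
  define g where "g = fps_const (fps_X ^ d) * f j - fps_X * f (Suc j)"
  have "g \<in> J" unfolding g_def using f(2) j by (intro is_ideal_diff is_ideal_mult J) auto
  moreover have "fps_nth g a = 0" if "t - Suc j < a" for a
  proof (cases "a = t - j")
    case True
    then have "a - 1 = t - Suc j" "a \<noteq> 0" using that by auto
    then show ?thesis using True fi(1)[of j] fi(1)[of "Suc j"] j d by (simp add: g_def power_add mult.commute)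
  next
    case False
    then have "t - j < a" "t - Suc j < a - 1" using that j by linarith+
    then show ?thesis using fi(2)[of j a] fi(2)[of "Suc j" "a - 1"] j by (simp add: g_def)
  qed
  ultimately obtain q where q: "g = (\<Sum>i=Suc j..t. fps_const (q i) * f i)"
    using combination_exists_xdeg[where f = f and j = "Suc j" and g = g, OF m0 J f] j by auto
  have "deg_ge (Suc (t - Suc j + m (Suc j))) g" unfolding g_def
  proof (intro deg_ge_diff deg_ge_X_mult fi)
    show "deg_ge (Suc (t - Suc j + m (Suc j))) (fps_const (fps_X ^ d) * f j)"
      using j d by (intro deg_ge_const_mult[OF fi(3)]) (auto simp: fps_X_power_nth split: if_splits)
  qed (use j in auto)
  \<comment> \<open>The order of x f(j+1) is transferred to every quotient \<open>q i\<close>; for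
    exponents below d it is the defining bound of \<open>coords\<close>.\<close>
  then have deg: "Suc (t - Suc j + m (Suc j)) \<le> t - i + m i + k" if "i \<in> {Suc j..t}" "fps_nth (q i) k \<noteq> 0" for i k
    using lower_combination_deg[OF f(1), of "Suc j" _ q i k] that j q by auto
  \<comment> \<open>Each quotient is split at y^d: the multiple of y^d is absorbed into
    \<open>f j\<close>, and the polynomial part of degree below d becomes, up to sign, an entry of
    the new column.\<close>
  define s where "s i = fps_shift d (q i)" for i
  define \<nu> where "\<nu> i = cut_poly d (q i)" for i
  have qi: "q i = fps_X ^ d * s i + fps_of_poly (\<nu> i)" for i unfolding s_def \<nu>_def by (rule cut_poly_decomp)
  define f' where "f' = f(j := f j - (\<Sum>i=Suc j..t. fps_const (s i) * f i))"
  define n' where "n' i c = (if c = j then - \<nu> i else n i c)" for i c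
  have f'_other: "f' i = f i" if "i \<noteq> j" for i using that by (simp add: f'_def)
  have f'J: "f' i \<in> J" if "i \<le> t" for i
    unfolding f'_def using f(2) that j J(1) by (auto intro!: is_ideal_diff is_ideal_sum is_ideal_mult)
  have S0: "fps_nth (\<Sum>i=Suc j..t. fps_const (s i) * f i) a = 0" if "t - Suc j < a" for a
    unfolding fps_sum_nth using that j by (intro sum.neutral) (auto intro!: fi(2))
  \<comment> \<open>Dividing by y^d lowers the order of \<open>g\<close> by d, which leaves exactly
    the order required of the new \<open>f j\<close>.\<close>
  have "deg_ge (t - j + m j) (\<Sum>i=Suc j..t. fps_const (s i) * f i)"
  proof (rule deg_ge_sum)
    fix i assume i: "i \<in> {Suc j..t}"
    show "deg_ge (t - j + m j) (fps_const (s i) * f i)"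
    proof (rule deg_ge_const_mult)
      show "deg_ge (t - i + m i) (f i)" using i by (intro fi) auto
      fix k assume "fps_nth (s i) k \<noteq> 0"
      then have "fps_nth (q i) (k + d) \<noteq> 0" by (simp add: s_def)
      from deg[OF i this] show "t - j + m j \<le> t - i + m i + k" using d j by linarith
    qed
  qed
  then have "fps_nth (f' j) (t - j) = fps_X ^ m j \<and> (\<forall>a>t - j. fps_nth (f' j) a = 0) \<and> deg_ge (t - j + m j) (f' j)"
    using fi[of j] S0 j by (auto simp: f'_def intro!: deg_ge_diff)
  then have f'sys: "lex_system t m f'" using fi f'_other unfolding lex_system_def by metis
  have adm: "admissible t m n' j"
    unfolding admissible_def
  proof (intro ballI allI impI)
    fix i k assume i: "i \<in> {Suc j..t}" and "coeff (n' i j) k \<noteq> 0"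
    then have k: "k < d" "fps_nth (q i) k \<noteq> 0" by (auto simp: n'_def \<nu>_def coeff_cut_poly split: if_splits)
    from deg[OF i k(2)] show "(i, j, k) \<in> coords t m" using i k(1) j by (auto simp: coords_def d_def udeg_def)
  qed
  have "fps_const (fps_X ^ d) * f' j = fps_X * f (Suc j) + (g - (\<Sum>i=Suc j..t. fps_const (fps_X ^ d * s i) * f i))"
    by (simp add: f'_def g_def algebra_simps sum_distrib_left flip: fps_const_mult)
  also have "g - (\<Sum>i=Suc j..t. fps_const (fps_X ^ d * s i) * f i) = (\<Sum>i=Suc j..t. fps_const (fps_of_poly (\<nu> i)) * f i)"
    unfolding q sum_subtractf[symmetric]
    by (intro sum.cong refl) (simp add: qi[of i for i] left_diff_distrib[symmetric] flip: fps_const_sub)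
  finally have "fps_const (fps_X ^ d) * f' j = fps_X * f (Suc j) + (\<Sum>i=Suc j..t. fps_const (fps_of_poly (\<nu> i)) * f i)" .
  moreover have "(\<Sum>i=Suc j..t. fps_const (fps_of_poly (n' i j)) * f' i) = - (\<Sum>i=Suc j..t. fps_const (fps_of_poly (\<nu> i)) * f i)"
    unfolding sum_negf[symmetric]
  proof (intro sum.cong refl)
    fix i assume "i \<in> {Suc j..t}"
    then have "f' i = f i" by (intro f'_other) auto
    moreover have "fps_const (fps_of_poly (n' i j)) = - fps_const (fps_of_poly (\<nu> i))"
      by (simp add: n'_def fps_of_poly_uminus)
    ultimately show "fps_const (fps_of_poly (n' i j)) * f' i = - (fps_const (fps_of_poly (\<nu> i)) * f i)"
      by (metis mult_minus_left)
  qed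
  moreover have "f' (Suc j) = f (Suc j)" by (rule f'_other) simp
  ultimately have relj: "column_relation t m n' f' j"
    unfolding column_relation_def d_def[symmetric] by simp
  have "admissible t m n' c \<and> column_relation t m n' f' c" if c: "Suc j \<le> c" "c < t" for c
  proof -
    have "(\<Sum>i=Suc c..t. fps_const (fps_of_poly (n' i c)) * f' i) = (\<Sum>i=Suc c..t. fps_const (fps_of_poly (n i c)) * f i)"
      using c by (intro sum.cong) (auto simp: n'_def f'_other)
    then show ?thesis using rel[OF c] c by (auto simp: admissible_def column_relation_def n'_def f'_other)
  qed
  then have "admissible t m n' c \<and> column_relation t m n' f' c" if "j \<le> c" "c < t" for c
    using that adm relj by (cases "c = j") auto
  then show ?case using f'sys f'J unfolding j_def[symmetric] by blast
qed

text \<open>The difference of two candidates for \<open>f j\<close> is a combination of later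
  generators. Multiplied by y^d, its coefficients are divisible by y^d and also differences of
  polynomials of degree below d, hence 0; so both \<open>f j\<close> and the column agree.\<close>

lemma relations_determined:
  fixes J :: "'k::field series set"
  assumes lex: "lex_exponents t m" and J: "is_ideal J" "stair_leads t m J"
    and f: "lex_system t m f" "\<And>i. i \<le> t \<Longrightarrow> f i \<in> J" "\<And>c. c < t \<Longrightarrow> admissible t m n c \<and> column_relation t m n f c"
    and f': "lex_system t m f'" "\<And>i. i \<le> t \<Longrightarrow> f' i \<in> J" "\<And>c. c < t \<Longrightarrow> admissible t m n' c \<and> column_relation t m n' f' c"
  shows "j \<le> t \<Longrightarrow> f j = f' j \<and> (j < t \<longrightarrow> (\<forall>i\<in>{Suc j..t}. n i j = n' i j))"
proof (induction "t - j" arbitrary: j rule: less_induct)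
  case less
  show ?case
  proof (cases "j = t")
    case True
    then show ?thesis using lex_system_last[OF f(1)] lex_system_last[OF f'(1)] by simp
  next
    case False
    then have j: "j < t" using less.prems by simp
    have m0: "m 0 = 0" using lex by (simp add: lex_exponents_def)
    have eq: "f' i = f i" if "i \<in> {Suc j..t}" for i using that j by (intro less.hyps[THEN conjunct1, symmetric]) auto
    define d where "d = ddiff m (Suc j)"
    define h where "h = f j - f' j"
    have "h \<in> J" unfolding h_def using f(2) f'(2) j by (intro is_ideal_diff J) auto
    moreover have "fps_nth h a = 0" if "t - Suc j < a" for a
      using f(1) f'(1) that j by (cases "a = t - j") (auto simp: h_def lex_system_def)
    ultimately obtain s where s: "h = (\<Sum>i=Suc j..t. fps_const (s i) * f i)"
      using combination_exists_xdeg[where f = f and j = "Suc j" and g = h, OF m0 J f(1,2)] j by auto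
    have "(\<Sum>i=Suc j..t. fps_const (fps_of_poly (n' i j)) * f' i) = (\<Sum>i=Suc j..t. fps_const (fps_of_poly (n' i j)) * f i)"
      by (intro sum.cong) (auto simp: eq)
    then have "fps_const (fps_X ^ d) * h = (\<Sum>i=Suc j..t. fps_const (fps_of_poly (n' i j)) * f i)
       - (\<Sum>i=Suc j..t. fps_const (fps_of_poly (n i j)) * f i)"
      using f(3)[OF j] f'(3)[OF j] eq[of "Suc j"] j
      by (simp add: column_relation_def h_def d_def right_diff_distrib)
    then have "(\<Sum>i=Suc j..t. fps_const (fps_X ^ d * s i - fps_of_poly (n' i j) + fps_of_poly (n i j)) * f i) = 0"
      unfolding s by (simp add: algebra_simps sum_distrib_left sum_subtractf sum.distrib flip: fps_const_add fps_const_sub fps_const_mult)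
    from lower_combination_eq_0[OF f(1) _ _ this]
    have z: "fps_X ^ d * s i = fps_of_poly (n' i j) - fps_of_poly (n i j)" if "i \<in> {Suc j..t}" for i using that j
      by (simp add: algebra_simps)
    have ni: "n i j = n' i j" if i: "i \<in> {Suc j..t}" for i
    proof (rule poly_eqI)
      fix k
      show "coeff (n i j) k = coeff (n' i j) k"
      proof (cases "k < d")
        case True
        then have "fps_nth (fps_X ^ d * s i) k = 0" by (simp add: fps_X_power_mult_nth)
        then show ?thesis unfolding z[OF i] by simp
      next
        case False
        then have "(i, j, k) \<notin> coords t m" by (auto simp: d_def coords_def)
        then show ?thesis using f(3)[OF j] f'(3)[OF j] i unfolding admissible_def by metis
      qed
    qed
    have "fps_X ^ d * s i = 0" if "i \<in> {Suc j..t}" for i using z[OF that] ni[OF that] by simp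
    then have "h = 0" unfolding s by (intro sum.neutral) auto
    then show ?thesis using ni by (simp add: h_def)
  qed
qed

section \<open>Signed maximal minors as solutions of the relations\<close>

lemma column_relation_scale:
  assumes "column_relation t m n g j"
  shows "column_relation t m n (\<lambda>i. c * g i) j"
proof -
  have "fps_const (fps_X ^ ddiff m (Suc j)) * (c * g j) = c * (fps_const (fps_X ^ ddiff m (Suc j)) * g j)"
    by (simp add: mult_ac)
  then show ?thesis using assms unfolding column_relation_def
    by (simp add: right_diff_distrib sum_distrib_left mult_ac)
qed

text \<open>The alternating sign is that of the Laplace expansion; the constant sign normalizes the
  last minor to y^(m t).\<close>

definition signed_minor :: "nat \<Rightarrow> 'k::field series mat \<Rightarrow> nat \<Rightarrow> 'k series" where
  "signed_minor t M i = (- 1) ^ t * ((- 1) ^ i * det (drop_row M i))"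

lemma ideal_span_signed_minors:
  assumes "M \<in> carrier_mat (Suc t) t"
  shows "ideal_span (minors t M) = ideal_span (signed_minor t M ` {..t})"
proof -
  have sq: "(- 1) ^ t * ((- 1) ^ i * signed_minor t M i) = det (drop_row M i)" for i
  proof -
    have "(- 1) ^ t * ((- 1) ^ i * signed_minor t M i) = ((- 1) ^ t * (- 1) ^ t) * (((- 1) ^ i * (- 1) ^ i) * det (drop_row M i))"
      unfolding signed_minor_def by (simp only: mult_ac)
    also have "\<dots> = det (drop_row M i)" by (simp flip: power_mult_distrib)
    finally show ?thesis .
  qed
  show ?thesis unfolding maximal_minors[OF assms]
  proof
    have "signed_minor t M i \<in> ideal_span (signed_minor t M ` {..t})" if "i \<le> t" for i
      using that by (intro ideal_span_base) auto
    then have "det (drop_row M i) \<in> ideal_span (signed_minor t M ` {..t})" if "i \<le> t" for i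
      using that by (subst sq[symmetric]) (intro is_ideal_mult is_ideal_span, blast)
    then show "ideal_span {det (drop_row M i) |i. i \<le> t} \<subseteq> ideal_span (signed_minor t M ` {..t})"
      by (intro ideal_span_minimal is_ideal_span) auto
    have "det (drop_row M i) \<in> ideal_span {det (drop_row M i) |i. i \<le> t}" if "i \<le> t" for i
      using that by (intro ideal_span_base) auto
    then have "signed_minor t M i \<in> ideal_span {det (drop_row M i) |i. i \<le> t}" if "i \<le> t" for i
      unfolding signed_minor_def using that by (intro is_ideal_mult is_ideal_span) blast
    then show "ideal_span (signed_minor t M ` {..t}) \<subseteq> ideal_span {det (drop_row M i) |i. i \<le> t}"
      by (intro ideal_span_minimal is_ideal_span) auto
  qed
qed

abbreviation HB_matrix :: "nat \<Rightarrow> (nat \<Rightarrow> nat) \<Rightarrow> 'k::field poly mat \<Rightarrow> 'k series mat" where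
  "HB_matrix t m N \<equiv> HB t m + map_mat from_ky N"

lemma HB_matrix_carrier: "N \<in> carrier_mat (t + 1) t \<Longrightarrow> HB_matrix t m N \<in> carrier_mat (Suc t) t"
  by (auto simp: HB_def)

lemma HB_matrix_entry:
  assumes "N \<in> carrier_mat (t + 1) t" "i \<le> t" "j < t"
  shows "HB_matrix t m N $$ (i, j) = (if i = j then fps_const (fps_X ^ ddiff m (Suc j)) else 0) +
    (if i = Suc j then - fps_X else 0) + fps_const (fps_of_poly (N $$ (i, j)))"
  using assms by (auto simp: HB_def vary_def varx_def from_ky_def)

lemma HB_params_lower: "N \<in> HB_params t m \<Longrightarrow> i \<le> j \<Longrightarrow> i \<le> t \<Longrightarrow> j < t \<Longrightarrow> N $$ (i, j) = 0"
  by (simp add: HB_params_def)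

text \<open>The syzygy of column j, with the diagonal and subdiagonal terms of H separated from the
  entries of N.\<close>

lemma signed_minor_relation:
  assumes N: "N \<in> HB_params t m" and j: "j < t"
  shows "column_relation t m (\<lambda>i j. N $$ (i, j)) (signed_minor t (HB_matrix t m N)) j"
proof -
  let ?M = "HB_matrix t m N"
  have Nc: "N \<in> carrier_mat (t + 1) t" using N by (simp add: HB_params_def)
  define g where "g i = (- 1) ^ i * det (drop_row ?M i)" for i
  have "0 = (\<Sum>i\<le>t. ?M $$ (i, j) * g i)"
    using maximal_minors_relation[OF HB_matrix_carrier[OF Nc] j] by (simp add: g_def)
  also have "\<dots> = (\<Sum>i\<le>t. (if i = j then fps_const (fps_X ^ ddiff m (Suc j)) * g j else 0) +
      (if i = Suc j then - (fps_X * g (Suc j)) else 0) + fps_const (fps_of_poly (N $$ (i, j))) * g i)"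
    using HB_matrix_entry[OF Nc _ j, of _ m] by (intro sum.cong refl) (simp add: distrib_right)
  also have "\<dots> = fps_const (fps_X ^ ddiff m (Suc j)) * g j - fps_X * g (Suc j) +
      (\<Sum>i\<le>t. fps_const (fps_of_poly (N $$ (i, j))) * g i)"
    using j by (simp add: sum.distrib)
  also have "(\<Sum>i\<le>t. fps_const (fps_of_poly (N $$ (i, j))) * g i) = (\<Sum>i=Suc j..t. fps_const (fps_of_poly (N $$ (i, j))) * g i)"
    using HB_params_lower[OF N _ _ j] by (intro sum.mono_neutral_right) (auto simp: not_le less_Suc_eq_le)
  finally have "column_relation t m (\<lambda>i j. N $$ (i, j)) g j"
    by (simp add: column_relation_def algebra_simps eq_neg_iff_add_eq_0)
  from column_relation_scale[OF this, of "(- 1) ^ t"] show ?thesis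
    unfolding g_def signed_minor_def[abs_def] .
qed

lemma sum_ddiff:
  assumes "lex_exponents t m" "l \<le> t"
  shows "(\<Sum>a<l. ddiff m (Suc a)) = m l"
  using assms(2)
proof (induction l)
  case (Suc l)
  then show ?case using ddiff_Suc[OF assms(1), of l] by simp
qed (use assms in \<open>simp add: lex_exponents_def\<close>)

text \<open>Without its last row, H + N is lower triangular with diagonal y^(d_1), ..., y^(d_t), and
  these exponents add up to m t.\<close>

lemma signed_minor_last:
  assumes N: "N \<in> HB_params t m" and lex: "lex_exponents t m"
  shows "signed_minor t (HB_matrix t m N) t = fps_const (fps_X ^ m t)"
proof -
  let ?M = "HB_matrix t m N"
  have Nc: "N \<in> carrier_mat (t + 1) t" using N by (simp add: HB_params_def)
  note Mc = HB_matrix_carrier[OF Nc, of m]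
  let ?A = "drop_row ?M t"
  have A: "?A \<in> carrier_mat t t" using Nc by (simp add: drop_row_def)
  have ent: "?A $$ (a, b) = ?M $$ (a, b)" if "a < t" "b < t" for a b using that Nc by (simp add: drop_row_def)
  have up: "?A $$ (a, b) = 0" if "a < b" "b < t" for a b
    using ent[of a b] HB_matrix_entry[OF Nc, of a b m] HB_params_lower[OF N, of a b] that by simp
  have dg: "?A $$ (a, a) = fps_const (fps_X ^ ddiff m (Suc a))" if "a < t" for a
    using ent[of a a] HB_matrix_entry[OF Nc, of a a m] HB_params_lower[OF N, of a a] that by simp
  have "det ?A = prod_list (diag_mat ?A)" by (rule det_lower_triangular[OF up A])
  also have "\<dots> = (\<Prod>a<t. fps_const (fps_X ^ ddiff m (Suc a)))"
    using A dg by (simp add: diag_mat_def prod.list_conv_set_nth atLeast0LessThan)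
  also have "\<dots> = (\<Prod>a<t. fps_const fps_X ^ ddiff m (Suc a))" by simp
  also have "\<dots> = fps_const fps_X ^ m t" by (simp only: power_sum[symmetric] sum_ddiff[OF lex order_refl])
  finally have "det ?A = fps_const (fps_X ^ m t)" by simp
  then show ?thesis unfolding signed_minor_def by (simp flip: mult.assoc power_mult_distrib)
qed

lemma HB_params_admissible:
  assumes "N \<in> HB_params t m" "j < t"
  shows "admissible t m (\<lambda>i j. N $$ (i, j)) j"
  using assms unfolding admissible_def HB_params_iff by auto

lemma signed_minor_system:
  assumes N: "N \<in> HB_params t m" and lex: "lex_exponents t m"
  shows "lex_system t m (signed_minor t (HB_matrix t m N))"
  using lex_system_of_relations[OF lex HB_params_admissible[OF N] signed_minor_relation[OF N] signed_minor_last[OF N lex]]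
  by simp

lemma Phi_eq_span:
  assumes N: "N \<in> HB_params t m"
  shows "Phi t m N = ideal_span (signed_minor t (HB_matrix t m N) ` {..t})"
  unfolding Phi_def using N
  by (intro ideal_span_signed_minors HB_matrix_carrier) (simp add: HB_params_def)

lemma Phi_eq_combinations:
  assumes N: "N \<in> HB_params t m" and lex: "lex_exponents t m"
  shows "Phi t m N = combinations t (signed_minor t (HB_matrix t m N))"
  unfolding Phi_eq_span[OF N]
  using span_eq_combinations[OF signed_minor_system[OF N lex] signed_minor_relation[OF N]] lex
  by (simp add: lex_exponents_def)

lemma Phi_ideal: "is_ideal (Phi t m N)"
  unfolding Phi_def by (rule is_ideal_span)

lemma signed_minor_in_Phi:
  assumes N: "N \<in> HB_params t m" and i: "i \<le> t"
  shows "signed_minor t (HB_matrix t m N) i \<in> Phi t m N"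
  unfolding Phi_eq_span[OF N] using i by (intro ideal_span_base) auto

text \<open>Injectivity is the uniqueness of the adapted generators and relations of one ideal. For
  surjectivity the relations of an ideal in the cell supply N, and the signed minors of H + N are
  recognized as its generators.\<close>

lemma Phi_bij_betw:
  assumes gt: "term_ordering gt" "gt (1, 0) (0, 1)" and lex: "lex_exponents t m"
  shows "bij_betw (Phi t m) (HB_params t m) (cell gt (lex_ideal t m :: 'k::field series set))"
  unfolding bij_betw_def
proof (intro conjI equalityI subsetI)
  have st: "stair_leads t m (Phi t m N)" if N: "N \<in> HB_params t m" for N :: "'k poly mat"
    unfolding Phi_eq_combinations[OF N lex] by (rule combinations_stair_leads[OF signed_minor_system[OF N lex]])
  show "inj_on (Phi t m) (HB_params t m :: 'k poly mat set)"
  proof (rule inj_onI)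
    fix N N' :: "'k poly mat"
    assume N: "N \<in> HB_params t m" and N': "N' \<in> HB_params t m" and eq: "Phi t m N = Phi t m N'"
    have "N $$ (i, j) = N' $$ (i, j)" if ij: "i \<le> t" "j < t" for i j
    proof (cases "i \<le> j")
      case True
      then show ?thesis using HB_params_lower[OF N] HB_params_lower[OF N'] ij by simp
    next
      case False
      then show ?thesis
        using relations_determined[OF lex Phi_ideal st[OF N] signed_minor_system[OF N lex] signed_minor_in_Phi[OF N]
            conjI[OF HB_params_admissible[OF N] signed_minor_relation[OF N]]
            signed_minor_system[OF N' lex] signed_minor_in_Phi[OF N', folded eq]
            conjI[OF HB_params_admissible[OF N'] signed_minor_relation[OF N']], of j] ij
        by auto
    qed
    then show "N = N'" using N N' by (intro eq_matI) (auto simp: HB_params_def)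
  qed
  show "J \<in> cell gt (lex_ideal t m)" if J: "J \<in> Phi t m ` HB_params t m" for J :: "'k series set"
  proof -
    obtain N where N: "N \<in> HB_params t m" "J = Phi t m N" using J by auto
    then show ?thesis unfolding cell_def
      using lead_ideal_of_system[OF gt lex st[OF N(1)] signed_minor_system[OF N(1) lex] signed_minor_in_Phi[OF N(1)]]
        Phi_ideal by auto
  qed
  show "J \<in> Phi t m ` HB_params t m" if J: "J \<in> cell gt (lex_ideal t m)" for J :: "'k series set"
  proof -
    have id: "is_ideal J" using J by (simp add: cell_def)
    note sl = cell_stair_leads[OF gt lex J]
    have "\<exists>f. lex_system t m f \<and> (\<forall>i\<le>t. f i \<in> J)"
    proof (rule reduced_system_exists[OF lex id sl])
      show "\<exists>F\<in>J. is_lead F (t - i, m i) \<and> mcoeff F (t - i, m i) = 1" if "i \<le> t" for i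
        by (rule cell_leads_exist[OF gt J that])
    qed
    from relations_exist[OF lex id sl this order_refl] obtain f n where f: "lex_system t m f" "\<And>i. i \<le> t \<Longrightarrow> f i \<in> J"
      and rel: "\<And>c. c < t \<Longrightarrow> admissible t m n c" "\<And>c. c < t \<Longrightarrow> column_relation t m n f c" by auto
    \<comment> \<open>The column relations only involve entries below the diagonal; the others are
      set to 0.\<close>
    define N where "N = mat (t + 1) t (\<lambda>(i, j). if j < i then n i j else 0)"
    have N: "N \<in> HB_params t m" unfolding HB_params_iff
    proof (intro conjI allI impI)
      fix i j k assume "i < t + 1" "j < t" "coeff (N $$ (i, j)) k \<noteq> 0"
      then show "(i, j, k) \<in> coords t m" using rel(1)[of j] by (auto simp: N_def admissible_def split: if_splits)
    qed (simp add: N_def)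
    have relN: "column_relation t m (\<lambda>i j. N $$ (i, j)) f c" if c: "c < t" for c
    proof -
      have "(\<Sum>i=Suc c..t. fps_const (fps_of_poly (N $$ (i, c))) * f i) = (\<Sum>i=Suc c..t. fps_const (fps_of_poly (n i c)) * f i)"
        using c by (intro sum.cong) (auto simp: N_def)
      then show ?thesis using rel(2)[OF c] by (simp add: column_relation_def)
    qed
    \<comment> \<open>Both families satisfy the same relations, so agreement at t propagates to all
      indices.\<close>
    have "signed_minor t (HB_matrix t m N) t = f t"
      using lex_system_last[OF f(1)] signed_minor_last[OF N lex] by simp
    then have "signed_minor t (HB_matrix t m N) i = f i" if "i \<le> t" for i
      using relations_unique[OF signed_minor_relation[OF N] relN] that by blast
    then have "signed_minor t (HB_matrix t m N) ` {..t} = f ` {..t}" by (intro image_cong) auto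
    then have "Phi t m N = ideal_span (f ` {..t})" unfolding Phi_eq_span[OF N] by simp
    moreover have "ideal_span (f ` {..t}) = J"
    proof
      show "ideal_span (f ` {..t}) \<subseteq> J" using f(2) by (intro ideal_span_minimal id) auto
      have "ideal_span (f ` {..t}) = combinations t f"
        using span_eq_combinations[OF f(1) rel(2)] lex by (simp add: lex_exponents_def)
      moreover have "J \<subseteq> combinations t f"
        using combination_exists[where f = f and m = m, OF _ id sl lex_system_lead[OF f(1)] f(2)] lex
        unfolding combinations_def lex_exponents_def by blast
      ultimately show "J \<subseteq> ideal_span (f ` {..t})" by simp
    qed
    ultimately show ?thesis using N by auto
  qed
qed

section \<open>Minimal number of generators\<close>

text \<open>The coordinates of \<open>h\<close> in the adapted basis, reduced to their constant
  terms. This is a relation because the expansion is only asserted to exist and indices beyond t do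
  not matter.\<close>

definition has_const_terms :: "nat \<Rightarrow> (nat \<Rightarrow> 'k::field series) \<Rightarrow> 'k series \<Rightarrow> (nat \<Rightarrow> 'k) \<Rightarrow> bool" where
  "has_const_terms t f h c \<longleftrightarrow> (\<exists>q0 q. h = q0 * f 0 + (\<Sum>i=1..t. fps_const (q i) * f i) \<and>
     (\<forall>i\<le>t. c i = (if i = 0 then mcoeff q0 (0, 0) else fps_nth (q i) 0)))"

lemma has_const_termsE:
  assumes "has_const_terms t f h c"
  obtains q0 q where "h = q0 * f 0 + (\<Sum>i=1..t. fps_const (q i) * f i)"
    "\<And>i. i \<le> t \<Longrightarrow> c i = (if i = 0 then mcoeff q0 (0, 0) else fps_nth (q i) 0)"
  using assms unfolding has_const_terms_def by blast

lemma has_const_terms_cong: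
  assumes "has_const_terms t f h c" "\<And>i. i \<le> t \<Longrightarrow> c i = c' i"
  shows "has_const_terms t f h c'"
proof -
  obtain q0 q where "h = q0 * f 0 + (\<Sum>i=1..t. fps_const (q i) * f i)"
      "\<And>i. i \<le> t \<Longrightarrow> c i = (if i = 0 then mcoeff q0 (0, 0) else fps_nth (q i) 0)"
    by (rule has_const_termsE[OF assms(1)]) blast
  then show ?thesis unfolding has_const_terms_def using assms(2)
    by (intro exI[of _ q0] exI[of _ q]) simp
qed

lemma has_const_terms_exists: "h \<in> combinations t f \<Longrightarrow> \<exists>c. has_const_terms t f h c"
proof -
  assume "h \<in> combinations t f"
  then obtain q0 q where "h = q0 * f 0 + (\<Sum>i=1..t. fps_const (q i) * f i)" by (auto simp: combinations_def)
  then show ?thesis unfolding has_const_terms_def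
    by (intro exI[of _ "\<lambda>i. if i = 0 then mcoeff q0 (0, 0) else fps_nth (q i) 0"] exI[of _ q0] exI[of _ q]) simp
qed

lemma has_const_terms_unique:
  assumes f: "lex_system t m f" and c: "has_const_terms t f h c" "has_const_terms t f h c'" and i: "i \<le> t"
  shows "c i = c' i"
proof -
  obtain q0 q where q: "h = q0 * f 0 + (\<Sum>i=1..t. fps_const (q i) * f i)"
      "\<And>i. i \<le> t \<Longrightarrow> c i = (if i = 0 then mcoeff q0 (0, 0) else fps_nth (q i) 0)"
    by (rule has_const_termsE[OF c(1)]) blast
  obtain p0 p where p: "h = p0 * f 0 + (\<Sum>i=1..t. fps_const (p i) * f i)"
      "\<And>i. i \<le> t \<Longrightarrow> c' i = (if i = 0 then mcoeff p0 (0, 0) else fps_nth (p i) 0)"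
    by (rule has_const_termsE[OF c(2)]) blast
  note u = combination_unique[where f = f and m = m, OF lex_system_lead(1)[OF f] trans[OF q(1)[symmetric] p(1)]]
  show ?thesis using u(1) u(2)[of i] q(2)[OF i] p(2)[OF i] i by auto
qed

lemma has_const_terms_add:
  assumes "has_const_terms t f h c" "has_const_terms t f h' c'"
  shows "has_const_terms t f (h + h') (\<lambda>i. c i + c' i)"
proof -
  obtain q0 q where q: "h = q0 * f 0 + (\<Sum>i=1..t. fps_const (q i) * f i)"
      "\<And>i. i \<le> t \<Longrightarrow> c i = (if i = 0 then mcoeff q0 (0, 0) else fps_nth (q i) 0)"
    by (rule has_const_termsE[OF assms(1)]) blast
  obtain p0 p where p: "h' = p0 * f 0 + (\<Sum>i=1..t. fps_const (p i) * f i)"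
      "\<And>i. i \<le> t \<Longrightarrow> c' i = (if i = 0 then mcoeff p0 (0, 0) else fps_nth (p i) 0)"
    by (rule has_const_termsE[OF assms(2)]) blast
  show ?thesis using q p unfolding has_const_terms_def
    by (intro exI[of _ "q0 + p0"] exI[of _ "\<lambda>i. q i + p i"])
      (simp add: algebra_simps sum.distrib flip: fps_const_add)
qed

lemma has_const_terms_const:
  assumes "has_const_terms t f h c"
  shows "has_const_terms t f (fps_const a * h) (\<lambda>i. fps_nth a 0 * c i)"
proof -
  obtain q0 q where "h = q0 * f 0 + (\<Sum>i=1..t. fps_const (q i) * f i)"
      "\<And>i. i \<le> t \<Longrightarrow> c i = (if i = 0 then mcoeff q0 (0, 0) else fps_nth (q i) 0)"
    by (rule has_const_termsE[OF assms]) blast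
  then show ?thesis unfolding has_const_terms_def
    by (intro exI[of _ "fps_const a * q0"] exI[of _ "\<lambda>i. a * q i"])
      (simp add: algebra_simps sum_distrib_left mcoeff_def flip: fps_const_mult)
qed

lemma has_const_terms_0: "has_const_terms t f (r * f 0) (\<lambda>i. if i = 0 then mcoeff r (0, 0) else 0)"
  unfolding has_const_terms_def by (intro exI[of _ r] exI[of _ "\<lambda>_. 0"]) simp

lemma has_const_terms_base:
  assumes "k \<le> t"
  shows "has_const_terms t f (f k) (\<lambda>i. if i = k then 1 else 0)"
proof (cases "k = 0")
  case True
  have "has_const_terms t f (1 * f 0) (\<lambda>i. if i = k then 1 else 0)"
    by (rule has_const_terms_cong[OF has_const_terms_0]) (use True in \<open>simp add: mcoeff_def\<close>)
  then show ?thesis using True by simp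
next
  case False
  have "f k = 0 * f 0 + (\<Sum>i=1..t. fps_const (if i = k then 1 else 0) * f i)"
    using False assms by (simp add: if_distrib if_distribR sum.delta cong: if_cong)
  then show ?thesis unfolding has_const_terms_def using False
    by (intro exI[of _ 0] exI[of _ "\<lambda>i. if i = k then 1 else 0"]) auto
qed

lemma has_const_terms_zero: "has_const_terms t f 0 (\<lambda>_. 0)"
proof -
  have "has_const_terms t f (0 * f 0) (\<lambda>_. 0)" by (rule has_const_terms_cong[OF has_const_terms_0]) simp
  then show ?thesis by simp
qed

lemma has_const_terms_sum:
  assumes "finite A" "\<And>x. x \<in> A \<Longrightarrow> has_const_terms t f (h x) (c x)"
  shows "has_const_terms t f (\<Sum>x\<in>A. h x) (\<lambda>i. \<Sum>x\<in>A. c x i)"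
  using assms
proof (induction A)
  case empty
  show ?case by (simp add: has_const_terms_zero)
next
  case (insert x A)
  then show ?case using has_const_terms_add[of t f "h x" "c x"] by simp
qed

text \<open>
  Constant terms modulo the column span below compute \<open>J\<close> modulo its product with the maximal ideal.
\<close>

lemma has_const_terms_X_mult:
  assumes rel: "\<And>j. j < t \<Longrightarrow> column_relation t m n f j" and lex: "lex_exponents t m"
    and lower: "\<And>i j. i \<le> j \<Longrightarrow> j < t \<Longrightarrow> n i j = 0"
    and h: "h \<in> combinations t f"
  shows "\<exists>b. has_const_terms t f (fps_X * h) (\<lambda>i. \<Sum>j<t. b j * coeff (n i j) 0)"
proof -
  \<comment> \<open>As d > 0, the term y^d f j contributes no constant term, and the coordinates of
    x f(j+1) reduce to column j of the constant part.\<close>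
  have Xf: "has_const_terms t f (fps_X * f (Suc j)) (\<lambda>i. coeff (n i j) 0)" if j: "j < t" for j
  proof -
    let ?d = "ddiff m (Suc j)"
    have "fps_X * f (Suc j) = fps_const (fps_X ^ ?d) * f j + (\<Sum>i=Suc j..t. fps_const (fps_of_poly (n i j)) * f i)"
      using rel[OF j] by (simp add: column_relation_def)
    moreover have "has_const_terms t f (fps_const (fps_X ^ ?d) * f j + (\<Sum>i=Suc j..t. fps_const (fps_of_poly (n i j)) * f i))
      (\<lambda>k. fps_nth (fps_X ^ ?d) 0 * (if k = j then 1 else 0) +
         (\<Sum>i=Suc j..t. fps_nth (fps_of_poly (n i j)) 0 * (if k = i then 1 else 0)))"
      using j by (intro has_const_terms_add has_const_terms_sum has_const_terms_const has_const_terms_base) auto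
    ultimately have "has_const_terms t f (fps_X * f (Suc j)) (\<lambda>k. fps_nth (fps_X ^ ?d) 0 * (if k = j then 1 else 0) +
         (\<Sum>i=Suc j..t. fps_nth (fps_of_poly (n i j)) 0 * (if k = i then 1 else 0)))" by simp
    then show ?thesis
    proof (rule has_const_terms_cong)
      fix k assume "k \<le> t"
      then show "fps_nth (fps_X ^ ?d) 0 * (if k = j then 1 else 0) +
         (\<Sum>i=Suc j..t. fps_nth (fps_of_poly (n i j)) 0 * (if k = i then 1 else 0)) = coeff (n k j) 0"
        using ddiff_Suc[OF lex j] lower[of k j] j
        by (cases "k \<le> j") (simp_all add: if_distrib[of "\<lambda>x. _ * x"] cong: if_cong)
    qed
  qed
  obtain q0 q where h': "h = q0 * f 0 + (\<Sum>i=1..t. fps_const (q i) * f i)" using h by (auto simp: combinations_def)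
  have "(\<Sum>i=1..t. fps_const (q i) * (fps_X * f i)) = (\<Sum>j<t. fps_const (q (Suc j)) * (fps_X * f (Suc j)))"
    by (rule sum.reindex_bij_witness[of _ Suc "\<lambda>i. i - 1"]) auto
  then have "fps_X * h = (fps_X * q0) * f 0 + (\<Sum>j<t. fps_const (q (Suc j)) * (fps_X * f (Suc j)))"
    unfolding h' by (simp add: algebra_simps sum_distrib_left)
  moreover have "has_const_terms t f ((fps_X * q0) * f 0 + (\<Sum>j<t. fps_const (q (Suc j)) * (fps_X * f (Suc j))))
     (\<lambda>i. (if i = 0 then mcoeff (fps_X * q0) (0, 0) else 0) + (\<Sum>j<t. fps_nth (q (Suc j)) 0 * coeff (n i j) 0))"
    by (intro has_const_terms_add has_const_terms_sum has_const_terms_const has_const_terms_0 Xf) auto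
  ultimately have "has_const_terms t f (fps_X * h) (\<lambda>i. \<Sum>j<t. fps_nth (q (Suc j)) 0 * coeff (n i j) 0)"
    by (auto elim!: has_const_terms_cong simp: mcoeff_def)
  then show ?thesis by (rule exI[of _ "\<lambda>j. fps_nth (q (Suc j)) 0"])
qed

text \<open>Write r as a series in y plus a multiple of x: the first scales the coordinates by its
  constant term, the second contributes a combination of columns.\<close>

lemma has_const_terms_mult:
  assumes rel: "\<And>j. j < t \<Longrightarrow> column_relation t m n f j" and lex: "lex_exponents t m"
    and f: "lex_system t m f" and lower: "\<And>i j. i \<le> j \<Longrightarrow> j < t \<Longrightarrow> n i j = 0"
    and h: "has_const_terms t f h c" "h \<in> combinations t f"
  shows "\<exists>b. has_const_terms t f (r * h) (\<lambda>i. mcoeff r (0, 0) * c i + (\<Sum>j<t. b j * coeff (n i j) 0))"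
proof -
  have "is_ideal (combinations t f)" using combinations_ideal[OF f rel] lex by (simp add: lex_exponents_def)
  then have "fps_shift 1 r * h \<in> combinations t f" using h(2) by (rule is_ideal_mult)
  from has_const_terms_X_mult[OF rel lex lower this] obtain b where
    "has_const_terms t f (fps_X * (fps_shift 1 r * h)) (\<lambda>i. \<Sum>j<t. b j * coeff (n i j) 0)" by blast
  then have "has_const_terms t f (fps_const (fps_nth r 0) * h + fps_X * (fps_shift 1 r * h))
      (\<lambda>i. fps_nth (fps_nth r 0) 0 * c i + (\<Sum>j<t. b j * coeff (n i j) 0))"
    by (intro has_const_terms_add has_const_terms_const h)
  moreover have "r = fps_const (fps_nth r 0) + fps_X * fps_shift 1 r" by (rule fps_ext) auto
  then have "r * h = fps_const (fps_nth r 0) * h + fps_X * (fps_shift 1 r * h)"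
    by (metis distrib_right mult.assoc)
  ultimately show ?thesis by (auto simp: mcoeff_def)
qed

definition const_part :: "'k::field poly mat \<Rightarrow> 'k mat" where
  "const_part N = map_mat (\<lambda>p. coeff p 0) N"

text \<open>The constant terms of generators together with the columns of the constant part must
  span k^(t+1), since those of \<open>f 0\<close>, ..., \<open>f t\<close> are the unit vectors.
  Otherwise a nonzero functional \<open>z\<close> would kill them all.\<close>

lemma min_gens_lower:
  fixes N :: "'k::field poly mat"
  assumes N: "N \<in> HB_params t m" and lex: "lex_exponents t m"
    and r: "\<forall>x\<in>minors (Suc r) (const_part N). x = 0" "\<exists>x\<in>minors r (const_part N). x \<noteq> 0"
    and G: "finite G" "ideal_span G = Phi t m N"
  shows "t + 1 \<le> card G + r"
proof (rule ccontr)
  assume less: "\<not> t + 1 \<le> card G + r"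
  define f where "f = signed_minor t (HB_matrix t m N)"
  define n where "n i j = (if i \<le> j then 0 else N $$ (i, j))" for i j
  have Nc: "N \<in> carrier_mat (t + 1) t" using N by (simp add: HB_params_def)
  have f: "lex_system t m f" unfolding f_def by (rule signed_minor_system[OF N lex])
  have rel: "column_relation t m n f j" if "j < t" for j
  proof -
    have "(\<Sum>i=Suc j..t. fps_const (fps_of_poly (n i j)) * f i) = (\<Sum>i=Suc j..t. fps_const (fps_of_poly (N $$ (i, j))) * f i)"
      by (intro sum.cong) (auto simp: n_def)
    then show ?thesis using signed_minor_relation[OF N that] by (simp add: column_relation_def f_def)
  qed
  have lower: "n i j = 0" if "i \<le> j" for i j using that by (simp add: n_def)
  have n0: "coeff (n i j) 0 = const_part N $$ (i, j)" if "i \<le> t" "j < t" for i j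
    using that Nc HB_params_lower[OF N, of i j] by (auto simp: n_def const_part_def)
  have J: "Phi t m N = combinations t f" unfolding f_def by (rule Phi_eq_combinations[OF N lex])
  have GJ: "g \<in> combinations t f" if "g \<in> G" for g using that G(2) J ideal_span_base[of g G] by simp
  then have "\<forall>g\<in>G. \<exists>c. has_const_terms t f g c" using has_const_terms_exists by blast
  then obtain \<gamma> where \<gamma>: "\<And>g. g \<in> G \<Longrightarrow> has_const_terms t f g (\<gamma> g)" by metis
  \<comment> \<open>The elements whose constant terms lie in that span. They form an ideal, so K
    contains everything generated by G.\<close>
  define K where "K = {h \<in> combinations t f. \<exists>c a b. has_const_terms t f h c \<and>
     (\<forall>i\<le>t. c i = (\<Sum>g\<in>G. a g * \<gamma> g i) + (\<Sum>j<t. b j * coeff (n i j) 0))}"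
  have KI: "h \<in> K" if "h \<in> combinations t f" "has_const_terms t f h c"
    "\<And>i. i \<le> t \<Longrightarrow> c i = (\<Sum>g\<in>G. a g * \<gamma> g i) + (\<Sum>j<t. b j * coeff (n i j) 0)" for h c a b
    using that unfolding K_def by blast
  have idT: "is_ideal (combinations t f)" using Phi_ideal[of t m N] J by simp
  have "is_ideal K" unfolding is_ideal_iff
  proof (intro conjI ballI allI)
    have "0 \<in> combinations t f" using idT by (simp add: is_ideal_iff)
    then show "0 \<in> K" using has_const_terms_zero unfolding K_def
      by (intro CollectI conjI exI[of _ "\<lambda>_. 0"]) auto
  next
    fix x y assume xy: "x \<in> K" "y \<in> K"
    obtain c a b where x: "has_const_terms t f x c"
      "\<And>i. i \<le> t \<Longrightarrow> c i = (\<Sum>g\<in>G. a g * \<gamma> g i) + (\<Sum>j<t. b j * coeff (n i j) 0)"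
      using xy(1) unfolding K_def by blast
    obtain c' a' b' where y: "has_const_terms t f y c'"
      "\<And>i. i \<le> t \<Longrightarrow> c' i = (\<Sum>g\<in>G. a' g * \<gamma> g i) + (\<Sum>j<t. b' j * coeff (n i j) 0)"
      using xy(2) unfolding K_def by blast
    have "x + y \<in> combinations t f" using xy by (auto simp: K_def intro: combinations_add)
    moreover have "c i + c' i = (\<Sum>g\<in>G. (a g + a' g) * \<gamma> g i) + (\<Sum>j<t. (b j + b' j) * coeff (n i j) 0)"
      if "i \<le> t" for i using x(2)[OF that] y(2)[OF that] by (simp add: distrib_right sum.distrib)
    ultimately show "x + y \<in> K" unfolding K_def
      using has_const_terms_add[OF x(1) y(1)] by (intro CollectI conjI exI) auto
  next
    fix s x assume xK: "x \<in> K"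
    obtain c a b where x: "has_const_terms t f x c"
      "\<And>i. i \<le> t \<Longrightarrow> c i = (\<Sum>g\<in>G. a g * \<gamma> g i) + (\<Sum>j<t. b j * coeff (n i j) 0)"
      using xK unfolding K_def by blast
    have xT: "x \<in> combinations t f" using xK by (simp add: K_def)
    obtain b' where b': "has_const_terms t f (s * x) (\<lambda>i. mcoeff s (0, 0) * c i + (\<Sum>j<t. b' j * coeff (n i j) 0))"
      using has_const_terms_mult[OF rel lex f lower x(1) xT] by blast
    have "mcoeff s (0, 0) * c i + (\<Sum>j<t. b' j * coeff (n i j) 0) = (\<Sum>g\<in>G. (mcoeff s (0, 0) * a g) * \<gamma> g i) +
        (\<Sum>j<t. (mcoeff s (0, 0) * b j + b' j) * coeff (n i j) 0)" if "i \<le> t" for i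
      using x(2)[OF that] by (simp add: algebra_simps sum.distrib sum_distrib_left)
    then show "s * x \<in> K" unfolding K_def
      using b' is_ideal_mult[OF idT xT] by (intro CollectI conjI exI) auto
  qed
  moreover have "G \<subseteq> K"
  proof
    fix g assume g: "g \<in> G"
    have "\<gamma> g i = (\<Sum>g'\<in>G. (if g' = g then 1 else 0) * \<gamma> g' i) + (\<Sum>j<t. 0 * coeff (n i j) 0)" for i
    proof -
      have "\<gamma> g i = (\<Sum>g'\<in>G. if g' = g then \<gamma> g i else 0)" using G(1) g by simp
      also have "\<dots> = (\<Sum>g'\<in>G. (if g' = g then 1 else 0) * \<gamma> g' i)" by (intro sum.cong) auto
      finally show ?thesis by simp
    qed
    then show "g \<in> K" by (rule KI[OF GJ[OF g] \<gamma>[OF g]])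
  qed
  ultimately have "combinations t f \<subseteq> K" using G(2) J ideal_span_minimal[of G K] by simp
  obtain q l where ql: "\<And>b. b < r \<Longrightarrow> q b < dim_col (const_part N)"
    "\<And>i j. i < dim_row (const_part N) \<Longrightarrow> j < dim_col (const_part N) \<Longrightarrow>
       const_part N $$ (i, j) = (\<Sum>b<r. l j b * const_part N $$ (i, q b))"
    using columns_in_span_of_minor[OF r] by blast
  \<comment> \<open>The vectors to be annihilated: one for each generator and one for each of the
    \<open>r\<close> columns that span the column space.\<close>
  define M where "M i x = (case x of Inl g \<Rightarrow> \<gamma> g i | Inr b \<Rightarrow> const_part N $$ (i, q b))" for i x
  have "finite (G <+> {..<r})" "card (G <+> {..<r}) < card {..t}" using G(1) less by (auto simp: card_Plus)
  from linear_dependence[OF this(1) finite_atMost this(2), of M] obtain z where z: "\<exists>i\<in>{..t}. z i \<noteq> 0"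
    "\<And>x. x \<in> G <+> {..<r} \<Longrightarrow> (\<Sum>i\<le>t. z i * M i x) = 0" by blast
  have zG: "(\<Sum>i\<le>t. z i * \<gamma> g i) = 0" if "g \<in> G" for g using z(2)[OF InlI[OF that]] by (simp add: M_def)
  have zN: "(\<Sum>i\<le>t. z i * const_part N $$ (i, j)) = 0" if "j < t" for j
  proof -
    have "(\<Sum>i\<le>t. z i * const_part N $$ (i, j)) = (\<Sum>i\<le>t. \<Sum>b<r. l j b * (z i * const_part N $$ (i, q b)))"
      using ql(2)[of _ j] that Nc by (intro sum.cong refl) (auto simp: const_part_def sum_distrib_left mult_ac)
    also have "\<dots> = (\<Sum>b<r. l j b * (\<Sum>i\<le>t. z i * const_part N $$ (i, q b)))"
      by (subst sum.swap) (simp add: sum_distrib_left)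
    also have "\<dots> = 0"
    proof (intro sum.neutral ballI)
      fix b assume "b \<in> {..<r}"
      from z(2)[OF InrI[OF this]] show "l j b * (\<Sum>i\<le>t. z i * const_part N $$ (i, q b)) = 0" by (simp add: M_def)
    qed
    finally show ?thesis .
  qed
  have "z k = 0" if k: "k \<le> t" for k
  proof -
    have "f k \<in> K" using \<open>combinations t f \<subseteq> K\<close> combinations_base[OF k, of f] by auto
    then obtain c a b where c: "has_const_terms t f (f k) c"
      "\<And>i. i \<le> t \<Longrightarrow> c i = (\<Sum>g\<in>G. a g * \<gamma> g i) + (\<Sum>j<t. b j * coeff (n i j) 0)"
      unfolding K_def by blast
    have ck: "c i = (if i = k then 1 else 0)" if "i \<le> t" for i
      using has_const_terms_unique[OF f c(1) has_const_terms_base[OF k] that] .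
    have "z k = (\<Sum>i\<le>t. z i * c i)" using k by (simp add: ck if_distrib[of "\<lambda>x. _ * x"] cong: if_cong)
    also have "\<dots> = (\<Sum>i\<le>t. (\<Sum>g\<in>G. a g * (z i * \<gamma> g i)) + (\<Sum>j<t. b j * (z i * const_part N $$ (i, j))))"
      by (intro sum.cong refl) (simp add: c(2) n0 distrib_left sum_distrib_left mult_ac)
    also have "\<dots> = (\<Sum>g\<in>G. a g * (\<Sum>i\<le>t. z i * \<gamma> g i)) + (\<Sum>j<t. b j * (\<Sum>i\<le>t. z i * const_part N $$ (i, j)))"
      unfolding sum.distrib
      by (subst (1 2) sum.swap) (simp add: sum_distrib_left)
    also have "\<dots> = 0" using zG zN by simp
    finally show ?thesis .
  qed
  then show False using z(1) by auto
qed

lemma comm_ring_hom_const_coeff: "comm_ring_hom (\<lambda>u :: 'k::field series. mcoeff u (0, 0))"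
  by unfold_locales (auto simp: mcoeff_def)

lemma series_unit:
  assumes "mcoeff (u :: 'k::field series) (0, 0) \<noteq> 0"
  shows "\<exists>w. w * u = 1"
proof -
  have "inverse (fps_nth u 0) * fps_nth u 0 = 1" using assms by (intro inverse_mult_eq_1) (simp add: mcoeff_def)
  then show ?thesis using fps_left_inverse by blast
qed

text \<open>
  Cramer's rule takes the place of Nakayama's lemma: a minor of the Hilbert-Burch matrix that is a
  unit expresses the generators belonging to its rows by the remaining ones.
\<close>

lemma min_gens_upper:
  fixes N :: "'k::field poly mat"
  assumes N: "N \<in> HB_params t m" and lex: "lex_exponents t m"
    and r: "\<exists>x\<in>minors r (const_part N). x \<noteq> 0"
  shows "r \<le> t \<and> (\<exists>G. finite G \<and> card G \<le> t + 1 - r \<and> ideal_span G = Phi t m N)"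
proof -
  define f where "f = signed_minor t (HB_matrix t m N)"
  let ?M = "HB_matrix t m N"
  have Nc: "N \<in> carrier_mat (t + 1) t" using N by (simp add: HB_params_def)
  have Mc: "?M \<in> carrier_mat (Suc t) t" by (rule HB_matrix_carrier[OF Nc])
  obtain I J where IJ: "I \<subseteq> {..<Suc t}" "J \<subseteq> {..<t}" "card I = r" "card J = r"
    and d: "det (submatrix (const_part N) I J) \<noteq> 0"
    using r Nc unfolding minors_def by (auto simp: const_part_def)
  have rt: "r \<le> t" using IJ card_mono[of "{..<t}" J] by simp
  \<comment> \<open>H has entries in the maximal ideal, because every d_j is positive; it leaves no
    trace in the constant terms.\<close>
  have cp: "const_part N = map_mat (\<lambda>u. mcoeff u (0, 0)) ?M"
  proof (rule eq_matI)
    fix i j assume "i < dim_row (map_mat (\<lambda>u. mcoeff u (0, 0)) ?M)" "j < dim_col (map_mat (\<lambda>u. mcoeff u (0, 0)) ?M)"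
    then have ij: "i \<le> t" "j < t" using Mc by auto
    then show "const_part N $$ (i, j) = map_mat (\<lambda>u. mcoeff u (0, 0)) ?M $$ (i, j)"
      using HB_matrix_entry[OF Nc ij, of m] ddiff_Suc[OF lex ij(2)] Nc Mc by (auto simp: const_part_def mcoeff_def)
  qed (use Nc Mc in \<open>auto simp: const_part_def\<close>)
  define B where "B = submatrix ?M I J"
  have B: "B = mat r r (\<lambda>(a, b). ?M $$ (pick I a, pick J b))"
    unfolding B_def using IJ Nc by (subst submatrix_subset) auto
  interpret h: comm_ring_hom "\<lambda>u :: 'k series. mcoeff u (0, 0)" by (rule comm_ring_hom_const_coeff)
  have "submatrix (const_part N) I J = map_mat (\<lambda>u. mcoeff u (0, 0)) B"
    unfolding cp B_def using IJ Nc pick_in_set_le[of _ I] pick_in_set_le[of _ J]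
    by (subst (1 2) submatrix_subset) (auto intro!: eq_matI simp: subset_iff)
  then have "mcoeff (det B) (0, 0) \<noteq> 0" using d h.hom_det[of B] by simp
  then obtain w where w: "w * det B = 1" using series_unit by blast
  define G where "G = f ` ({..<Suc t} - I)"
  have fin: "finite I" using IJ(1) finite_subset by blast
  have rel: "(\<Sum>i\<le>t. ?M $$ (i, j) * f i) = 0" if "j < t" for j
  proof -
    have "(\<Sum>i\<le>t. ?M $$ (i, j) * f i) = (- 1) ^ t * (\<Sum>i\<le>t. ?M $$ (i, j) * ((- 1) ^ i * det (drop_row ?M i)))"
      unfolding f_def signed_minor_def sum_distrib_left by (intro sum.cong refl) (simp only: mult_ac)
    then show ?thesis using maximal_minors_relation[OF Mc that] by simp
  qed
  have fG: "f i \<in> ideal_span G" if "i \<le> t" for i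
  proof (cases "i \<in> I")
    case False
    then show ?thesis using that by (intro ideal_span_base) (auto simp: G_def)
  next
    case True
    have bij: "bij_betw (pick I) {..<r} I" using bij_betw_pick[OF fin] IJ by simp
    obtain c where c: "c < r" "pick I c = i" using True bij unfolding bij_betw_def by (metis imageE lessThan_iff)
    \<comment> \<open>By the syzygies these sums over the rows in I equal negated sums over the
      remaining rows, so they lie in the ideal generated by G; the adjugate then solves for the
      \<open>f i\<close> with i in I.\<close>
    define y where "y b = (\<Sum>a<r. B $$ (a, b) * f (pick I a))" for b
    have y: "y b \<in> ideal_span G" if b: "b < r" for b
    proof -
      have pJ: "pick J b < t" using pick_in_set_le[of b J] b IJ by auto
      have "y b = (\<Sum>a<r. ?M $$ (pick I a, pick J b) * f (pick I a))" unfolding y_def B using b by simp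
      also have "\<dots> = (\<Sum>i\<in>I. ?M $$ (i, pick J b) * f i)" by (rule sum.reindex_bij_betw[OF bij])
      also have "\<dots> = - (\<Sum>i\<in>{..<Suc t} - I. ?M $$ (i, pick J b) * f i)"
        using rel[OF pJ] sum.subset_diff[OF IJ(1), of "\<lambda>i. ?M $$ (i, pick J b) * f i"]
        by (simp add: lessThan_Suc_atMost eq_neg_iff_add_eq_0 add.commute)
      also have "\<dots> \<in> ideal_span G"
        by (intro is_ideal_uminus is_ideal_sum is_ideal_mult is_ideal_span ideal_span_base) (auto simp: G_def)
      finally show ?thesis .
    qed
    have Bc: "B \<in> carrier_mat r r" by (simp add: B)
    note adj = adj_mat[OF Bc]
    have prod: "(\<Sum>b<r. B $$ (a, b) * adj_mat B $$ (b, c)) = (if a = c then det B else 0)" if "a < r" for a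
    proof -
      have "(B * adj_mat B) $$ (a, c) = (\<Sum>b<r. B $$ (a, b) * adj_mat B $$ (b, c))"
        using that c(1) Bc adj(1) by (simp add: scalar_prod_def atLeast0LessThan)
      then show ?thesis using adj(2) that c(1) by (cases "a = c") auto
    qed
    have "(\<Sum>b<r. adj_mat B $$ (b, c) * y b) = (\<Sum>a<r. (\<Sum>b<r. B $$ (a, b) * adj_mat B $$ (b, c)) * f (pick I a))"
      unfolding y_def sum_distrib_left sum_distrib_right by (subst sum.swap) (simp add: mult_ac)
    also have "\<dots> = (\<Sum>a<r. if a = c then det B * f (pick I a) else 0)" by (intro sum.cong refl) (simp add: prod)
    also have "\<dots> = det B * f i" using c by simp
    finally have "det B * f i = (\<Sum>b<r. adj_mat B $$ (b, c) * y b)" ..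
    then have "f i = w * (\<Sum>b<r. adj_mat B $$ (b, c) * y b)" using w by (metis mult.assoc mult_1)
    also have "\<dots> \<in> ideal_span G" by (intro is_ideal_mult is_ideal_sum is_ideal_span y) auto
    finally show ?thesis .
  qed
  have "ideal_span G = Phi t m N"
  proof
    have "Phi t m N = ideal_span (f ` {..t})" unfolding f_def by (rule Phi_eq_span[OF N])
    then show "Phi t m N \<subseteq> ideal_span G" using fG ideal_span_minimal[OF _ is_ideal_span, of "f ` {..t}" G] by auto
    show "ideal_span G \<subseteq> Phi t m N"
      using signed_minor_in_Phi[OF N] by (intro ideal_span_minimal Phi_ideal) (auto simp: G_def f_def)
  qed
  moreover have "card G \<le> t + 1 - r"
    using card_image_le[of "{..<Suc t} - I" f] IJ fin by (simp add: G_def card_Diff_subset)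
  moreover have "finite G" by (simp add: G_def)
  ultimately show ?thesis using rt by blast
qed

lemma min_gens_Phi:
  fixes N :: "'k::field poly mat"
  assumes N: "N \<in> HB_params t m" and lex: "lex_exponents t m"
    and r: "\<forall>x\<in>minors (Suc r) (const_part N). x = 0" "\<exists>x\<in>minors r (const_part N). x \<noteq> 0"
  shows "r \<le> t" "min_gens (Phi t m N) = t + 1 - r"
proof -
  obtain G where G: "finite G" "card G \<le> t + 1 - r" "ideal_span G = Phi t m N" and rt: "r \<le> t"
    using min_gens_upper[OF N lex r(2)] by blast
  have low: "t + 1 - r \<le> card G'" if "finite G'" "ideal_span G' = Phi t m N" for G'
    using min_gens_lower[OF N lex r that] by simp
  show "r \<le> t" by fact
  show "min_gens (Phi t m N) = t + 1 - r"
    unfolding min_gens_def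
  proof (rule Least_equality)
    show "\<exists>G. finite G \<and> card G = t + 1 - r \<and> ideal_span G = Phi t m N"
      using G low[OF G(1,3)] by (intro exI[of _ G]) auto
  qed (use low in blast)
qed

text \<open>The two conditions on minors say that the constant part has rank t + 1 - d. Conversely
  the rank is found as the largest size of a nonzero minor.\<close>

lemma min_gens_Phi_iff:
  fixes N :: "'k::field poly mat"
  assumes N: "N \<in> HB_params t m" and lex: "lex_exponents t m" and d: "1 \<le> d" "d \<le> t + 1"
  shows "min_gens (Phi t m N) = d \<longleftrightarrow>
    (\<forall>x\<in>minors (t + 2 - d) (const_part N). x = 0) \<and> \<not> (\<forall>x\<in>minors (t + 1 - d) (const_part N). x = 0)"
proof
  have Nc: "N \<in> carrier_mat (t + 1) t" using N by (simp add: HB_params_def)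
  define P where "P r \<longleftrightarrow> (\<exists>x\<in>minors r (const_part N). x \<noteq> 0)" for r
  have P0: "P 0" by (simp add: P_def minors_0)
  have Pt: "r \<le> t" if "P r" for r using that Nc minors_gt[of "const_part N" r] by (fastforce simp: P_def const_part_def)
  define r where "r = (GREATEST r. P r)"
  have r: "P r" "\<not> P (Suc r)"
    using GreatestI_nat[of P 0 t] Greatest_le_nat[of P "Suc r" t] P0 Pt by (auto simp: r_def)
  then have "min_gens (Phi t m N) = t + 1 - r" "r \<le> t" using min_gens_Phi[OF N lex, of r] by (auto simp: P_def)
  moreover assume "min_gens (Phi t m N) = d"
  ultimately have "t + 2 - d = Suc r" "t + 1 - d = r" using d by auto
  then show "(\<forall>x\<in>minors (t + 2 - d) (const_part N). x = 0) \<and> \<not> (\<forall>x\<in>minors (t + 1 - d) (const_part N). x = 0)"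
    using r by (auto simp: P_def)
next
  assume h: "(\<forall>x\<in>minors (t + 2 - d) (const_part N). x = 0) \<and> \<not> (\<forall>x\<in>minors (t + 1 - d) (const_part N). x = 0)"
  have "t + 2 - d = Suc (t + 1 - d)" using d by simp
  then show "min_gens (Phi t m N) = d" using h min_gens_Phi(2)[OF N lex, of "t + 1 - d"] d by auto
qed

section \<open>Coordinates and Betti strata\<close>

lemma HB_params_coeff_0:
  assumes "N \<in> HB_params t m" "i \<le> t" "j < t" "(i, j, k) \<notin> coords t m"
  shows "coeff (N $$ (i, j)) k = 0"
  using assms unfolding HB_params_iff by (metis Suc_eq_plus1 less_Suc_eq_le)

lemma coeff_general_element:
  assumes "i \<le> t" "j < t"
  shows "coeff (general_element t D e $$ (i, j)) k = (\<Sum>\<nu><D. if e \<nu> = (i, j, k) then mvar \<nu> else 0)"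
proof -
  have "coeff (general_element t D e $$ (i, j)) k =
    (\<Sum>\<nu><D. coeff (case e \<nu> of (i', j', k) \<Rightarrow> if i' = i \<and> j' = j then Polynomial.monom (mvar \<nu>) k else 0) k)"
    using assms by (simp add: general_element_def Polynomial.coeff_sum)
  also have "\<dots> = (\<Sum>\<nu><D. if e \<nu> = (i, j, k) then mvar \<nu> else 0)"
    by (intro sum.cong refl) (auto split: prod.splits)
  finally show ?thesis .
qed

lemma general_element_dim [simp]:
  "dim_row (general_element t D e) = t + 1" "dim_col (general_element t D e) = t"
  by (simp_all add: general_element_def)

lemma coeff_specialize:
  assumes "i \<le> t" "j < t"
  shows "coeff (specialize (general_element t D e) v $$ (i, j)) k =
    (\<Sum>\<nu><D. if e \<nu> = (i, j, k) then vec_index v \<nu> else 0)"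
proof -
  have "coeff (specialize (general_element t D e) v $$ (i, j)) k =
      eval_at v (coeff (general_element t D e $$ (i, j)) k)"
    using assms by (simp add: specialize_def coeff_map_poly)
  also have "\<dots> = (\<Sum>\<nu><D. if e \<nu> = (i, j, k) then vec_index v \<nu> else 0)"
    unfolding coeff_general_element[OF assms] eval_at_sum by (intro sum.cong refl) simp
  finally show ?thesis .
qed

lemma coeff_specialize_coord:
  assumes e: "bij_betw e {..<D} (coords t m)" and \<nu>: "\<nu> < D" "e \<nu> = (i, j, k)"
  shows "i \<le> t" "j < t" "coeff (specialize (general_element t D e) v $$ (i, j)) k = vec_index v \<nu>"
proof -
  have "(i, j, k) \<in> coords t m" using e \<nu> by (metis bij_betwE lessThan_iff)
  then show ij: "i \<le> t" "j < t" by (auto simp: coords_def)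
  have "e \<nu>' = (i, j, k) \<longleftrightarrow> \<nu>' = \<nu>" if "\<nu>' < D" for \<nu>'
    using e \<nu> that unfolding bij_betw_def inj_on_def by (metis lessThan_iff)
  then have "(\<Sum>\<nu>'<D. if e \<nu>' = (i, j, k) then vec_index v \<nu>' else 0) = (\<Sum>\<nu>'<D. if \<nu>' = \<nu> then vec_index v \<nu> else 0)"
    by (intro sum.cong refl) auto
  then show "coeff (specialize (general_element t D e) v $$ (i, j)) k = vec_index v \<nu>"
    unfolding coeff_specialize[OF ij] using \<nu> by simp
qed

lemma coeff_specialize_outside:
  assumes e: "bij_betw e {..<D} (coords t m)" and "i \<le> t" "j < t" "(i, j, k) \<notin> coords t m"
  shows "coeff (specialize (general_element t D e) v $$ (i, j)) k = 0"
proof -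
  have "e \<nu> \<noteq> (i, j, k)" if "\<nu> < D" for \<nu> using e assms(4) that by (metis bij_betwE lessThan_iff)
  then show ?thesis unfolding coeff_specialize[OF assms(2,3)] by (intro sum.neutral) auto
qed

lemma specialize_bij_betw:
  fixes e :: "nat \<Rightarrow> nat \<times> nat \<times> nat"
  assumes e: "bij_betw e {..<D} (coords t m)"
  shows "bij_betw (specialize (general_element t D e)) (carrier_vec D) (HB_params t m :: 'k::field poly mat set)"
  unfolding bij_betw_def
proof (intro conjI equalityI subsetI)
  show "inj_on (specialize (general_element t D e)) (carrier_vec D :: 'k vec set)"
  proof (rule inj_onI)
    fix v w :: "'k vec"
    assume vw: "v \<in> carrier_vec D" "w \<in> carrier_vec D"
      and eq: "specialize (general_element t D e) v = specialize (general_element t D e) w"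
    show "v = w"
    proof (rule eq_vecI)
      fix \<nu> assume "\<nu> < dim_vec w"
      then have \<nu>: "\<nu> < D" using vw by simp
      obtain i j k where ijk: "e \<nu> = (i, j, k)" by (cases "e \<nu>")
      show "vec_index v \<nu> = vec_index w \<nu>"
        using coeff_specialize_coord(3)[OF e \<nu> ijk, of v] coeff_specialize_coord(3)[OF e \<nu> ijk, of w] eq by simp
    qed (use vw in auto)
  qed
  show "N \<in> HB_params t m" if N: "N \<in> specialize (general_element t D e) ` carrier_vec D" for N :: "'k poly mat"
  proof -
    obtain v where v: "N = specialize (general_element t D e) v" using N by auto
    show ?thesis unfolding HB_params_iff v
    proof (intro conjI allI impI)
      fix i j k assume "i < t + 1" "j < t" "coeff (specialize (general_element t D e) v $$ (i, j)) k \<noteq> 0"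
      then show "(i, j, k) \<in> coords t m" using coeff_specialize_outside[OF e, of i j k v] by auto
    qed (auto simp: specialize_def)
  qed
  show "N \<in> specialize (general_element t D e) ` carrier_vec D" if N: "N \<in> HB_params t m" for N :: "'k poly mat"
  proof -
    define v where "v = vec D (\<lambda>\<nu>. case e \<nu> of (i, j, k) \<Rightarrow> coeff (N $$ (i, j)) k)"
    have Nc: "N \<in> carrier_mat (t + 1) t" using N by (simp add: HB_params_def)
    have "specialize (general_element t D e) v = N"
    proof (rule eq_matI)
      fix i j assume "i < dim_row N" "j < dim_col N"
      then have ij: "i \<le> t" "j < t" using Nc by auto
      show "specialize (general_element t D e) v $$ (i, j) = N $$ (i, j)"
      proof (rule poly_eqI)
        fix k
        show "coeff (specialize (general_element t D e) v $$ (i, j)) k = coeff (N $$ (i, j)) k"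
        proof (cases "(i, j, k) \<in> coords t m")
          case True
          then obtain \<nu> where \<nu>: "\<nu> < D" "e \<nu> = (i, j, k)" using e unfolding bij_betw_def by (metis imageE lessThan_iff)
          then show ?thesis using coeff_specialize_coord(3)[OF e \<nu>, of v] by (simp add: v_def)
        next
          case False
          have "coeff (N $$ (i, j)) k = 0" by (rule HB_params_coeff_0[OF N ij False])
          then show ?thesis using coeff_specialize_outside[OF e ij False] by simp
        qed
      qed
    qed (use Nc in \<open>auto simp: specialize_def\<close>)
    moreover have "v \<in> carrier_vec D" by (simp add: v_def)
    ultimately show ?thesis by auto
  qed
qed

lemma const_terms_entry:
  assumes "i \<le> t" "j < t"
  shows "const_terms (general_element t D e) $$ (i, j) = (\<Sum>\<nu><D. if e \<nu> = (i, j, 0) then mvar \<nu> else 0)"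
  using assms coeff_general_element[OF assms, of D e 0] by (simp add: const_terms_def)

lemma const_part_specialize:
  "const_part (specialize (general_element t D e) v) = map_mat (eval_at v) (const_terms (general_element t D e))"
  by (rule eq_matI) (auto simp: const_part_def specialize_def const_terms_def coeff_map_poly)

lemma const_terms_polys:
  assumes "i < dim_row (const_terms (general_element t D e))" "j < dim_col (const_terms (general_element t D e))"
  shows "const_terms (general_element t D e) $$ (i, j) \<in> polys D"
proof -
  have "i \<le> t" "j < t" using assms by (auto simp: const_terms_def)
  then show ?thesis by (simp add: const_terms_entry) (auto intro!: polys_sum polys_mvar)
qed

lemma cell_chart_in_cell:
  assumes gt: "term_ordering gt" "gt (1, 0) (0, 1)" and lex: "lex_exponents t m"
    and e: "bij_betw e {..<D} (coords t m)" and v: "v \<in> carrier_vec D"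
  shows "cell_chart t m D e v \<in> cell gt (lex_ideal t m)"
  using bij_betwE[OF Phi_bij_betw[OF gt lex]] bij_betwE[OF specialize_bij_betw[OF e]] v
  unfolding cell_chart_def by blast

lemma stratum_coords_iff:
  fixes v :: "'k::field vec"
  assumes gt: "term_ordering gt" "gt (1, 0) (0, 1)" and lex: "lex_exponents t m"
    and e: "bij_betw e {..<D} (coords t m)" and d: "1 \<le> d" "d \<le> t + 1"
  defines "Nb \<equiv> \<lambda>v. map_mat (eval_at v) (const_terms (general_element t D e))"
  shows "v \<in> stratum_coords gt t m D e d \<longleftrightarrow> v \<in> carrier_vec D \<and>
    (\<forall>x\<in>minors (t + 2 - d) (Nb v). x = 0) \<and> \<not> (\<forall>x\<in>minors (t + 1 - d) (Nb v). x = 0)"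
proof (cases "v \<in> carrier_vec D")
  case True
  have N: "specialize (general_element t D e) v \<in> HB_params t m"
    using specialize_bij_betw[OF e] True by (meson bij_betwE)
  show ?thesis
    using True cell_chart_in_cell[OF gt lex e True] min_gens_Phi_iff[OF N lex d]
    by (simp add: stratum_coords_def betti_stratum_def cell_chart_def Nb_def const_part_specialize)
qed (simp add: stratum_coords_def)

lemma stratum_coords_eq:
  assumes "term_ordering gt" "gt (1, 0) (0, 1)" "lex_exponents t m"
    and "bij_betw e {..<D} (coords t m)" "1 \<le> d" "d \<le> t + 1"
  shows "(stratum_coords gt t m D e d :: 'k::field vec set) = vanishing D (det_ideal D (t + 2 - d) (const_terms (general_element t D e))) -
     vanishing D (det_ideal D (t + 1 - d) (const_terms (general_element t D e)))"
  by (intro Set.set_eqI) (simp add: stratum_coords_iff[OF assms] vanishing_det_ideal, blast)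

lemma quasi_affine_stratum:
  assumes "term_ordering gt" "gt (1, 0) (0, 1)" "lex_exponents t m"
    and "bij_betw e {..<D} (coords t m)" "1 \<le> d" "d \<le> t + 1"
  shows "quasi_affine D (stratum_coords gt t m D e d :: 'k::field vec set)"
proof -
  have "zariski_closed D (vanishing D (det_ideal D k (const_terms (general_element t D e :: 'k mpoly poly mat))))" for k
    by (rule zariski_closed_det_ideal) (rule const_terms_polys)
  then show ?thesis unfolding quasi_affine_def stratum_coords_eq[OF assms] by auto
qed

lemma betti_stratum_eq_image:
  assumes gt: "term_ordering gt" "gt (1, 0) (0, 1)" and lex: "lex_exponents t m"
    and e: "bij_betw e {..<D} (coords t m)"
  shows "betti_stratum gt (lex_ideal t m :: 'k::field series set) d = cell_chart t m D e ` stratum_coords gt t m D e d"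
    (is "?A = ?B")
proof
  show "?A \<subseteq> ?B"
  proof
    fix J :: "'k series set" assume J: "J \<in> betti_stratum gt (lex_ideal t m) d"
    then have "J \<in> cell gt (lex_ideal t m)" by (simp add: betti_stratum_def)
    then obtain N where N: "N \<in> HB_params t m" "J = Phi t m N"
      using bij_betw_imp_surj_on[OF Phi_bij_betw[OF gt lex, where ?'k = 'k]] by (metis imageE)
    from N(1) obtain v where v: "v \<in> carrier_vec D" "N = specialize (general_element t D e) v"
      using bij_betw_imp_surj_on[OF specialize_bij_betw[OF e, where ?'k = 'k]] by (metis imageE)
    then have "J = cell_chart t m D e v" by (simp add: N cell_chart_def)
    with v(1) show "J \<in> cell_chart t m D e ` stratum_coords gt t m D e d" using J by (auto simp: stratum_coords_def)
  qed
qed (auto simp: stratum_coords_def)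

lemma minors_1_eq_0_iff:
  fixes A :: "'a::comm_ring_1 mat"
  shows "(\<forall>x\<in>minors 1 A. x = 0) \<longleftrightarrow> (\<forall>i<dim_row A. \<forall>j<dim_col A. A $$ (i, j) = 0)"
proof
  assume z: "\<forall>x\<in>minors 1 A. x = 0"
  show "\<forall>i<dim_row A. \<forall>j<dim_col A. A $$ (i, j) = 0"
  proof (intro allI impI)
    fix i j assume "i < dim_row A" "j < dim_col A"
    then have "fminor A 1 (\<lambda>_. i) (\<lambda>_. j) = 0" by (intro fminor_eq_0[OF z])
    then show "A $$ (i, j) = 0" by (simp add: fminor_def det_single)
  qed
next
  assume z: "\<forall>i<dim_row A. \<forall>j<dim_col A. A $$ (i, j) = 0"
  show "\<forall>x\<in>minors 1 A. x = 0"
    \<comment> \<open>The whole matrix serves as the zero block.\<close>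
    using minors_zero_block[of "dim_row A" 0 A 1] z by simp
qed

lemma is_affine_space_coordinate_subspace:
  assumes "Z \<subseteq> {..<D}"
  shows "is_affine_space D {v \<in> carrier_vec D. \<forall>\<nu>\<in>Z. vec_index v \<nu> = (0 :: 'k::field)}"
    (is "is_affine_space D ?X")
proof -
  define C where "C = {..<D} - Z"
  define r where "r = card C"
  have "finite C" by (simp add: C_def)
  then obtain b where b: "bij_betw b {..<r} C" using ex_bij_betw_nat_finite[of C] by (auto simp: r_def atLeast0LessThan)
  define f where "f i = (if i \<in> C then mvar (inv_into {..<r} b i) else 0 :: 'k mpoly)" for i
  define g where "g j = (mvar (b j) :: 'k mpoly)" for j
  have inv: "inv_into {..<r} b i < r" "b (inv_into {..<r} b i) = i" if "i \<in> C" for i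
    using that b inv_into_into[of i b "{..<r}"] f_inv_into_f[of i b "{..<r}"] by (auto simp: bij_betw_def)
  have bC: "b j \<in> C" "inv_into {..<r} b (b j) = j" if "j < r" for j
    using that b by (auto simp: bij_betw_def)
  have "zariski_closed D ?X"
  proof -
    have "mvar ` Z \<subseteq> (polys D :: 'k mpoly set)" using assms by (auto intro: polys_mvar)
    moreover have "?X = vanishing D (mvar ` Z)" by (auto simp: vanishing_def)
    ultimately show ?thesis unfolding zariski_closed_def by blast
  qed
  moreover have "\<forall>i<D. f i \<in> polys r" using inv by (auto simp: f_def intro: polys_mvar)
  moreover have "\<forall>j<r. g j \<in> polys D" using bC by (auto simp: g_def C_def intro!: polys_mvar)
  moreover have "\<forall>v\<in>carrier_vec r. poly_map D f v \<in> ?X \<and> poly_map r g (poly_map D f v) = v"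
  proof
    fix v :: "'k vec" assume v: "v \<in> carrier_vec r"
    have "poly_map D f v \<in> ?X" using assms by (auto simp: poly_map_def f_def C_def)
    moreover have "poly_map r g (poly_map D f v) = v"
    proof (rule eq_vecI)
      fix j assume "j < dim_vec v"
      then have j: "j < r" using v by simp
      moreover have "b j < D" using bC(1)[OF j] by (simp add: C_def)
      ultimately show "vec_index (poly_map r g (poly_map D f v)) j = vec_index v j"
        using bC[OF j] by (simp add: poly_map_def f_def g_def)
    qed (use v in \<open>simp add: poly_map_def\<close>)
    ultimately show "poly_map D f v \<in> ?X \<and> poly_map r g (poly_map D f v) = v" ..
  qed
  moreover have "\<forall>w\<in>?X. poly_map D f (poly_map r g w) = w"
  proof
    fix w assume w: "w \<in> ?X"
    show "poly_map D f (poly_map r g w) = w"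
    proof (rule eq_vecI)
      fix i assume "i < dim_vec w"
      then have i: "i < D" using w by auto
      show "vec_index (poly_map D f (poly_map r g w)) i = vec_index w i"
      proof (cases "i \<in> C")
        case True
        then show ?thesis using inv[OF True] i by (simp add: poly_map_def f_def g_def)
      next
        case False
        then show ?thesis using w i by (simp add: poly_map_def f_def C_def)
      qed
    qed (use w in \<open>auto simp: poly_map_def\<close>)
  qed
  ultimately show ?thesis unfolding is_affine_space_def by blast
qed

text \<open>For d = t + 1 the open condition concerns the empty minor and always holds, while the
  closed one says that all constant terms are 0. The stratum is the coordinate subspace where the
  coefficients of y^0 vanish.\<close>

lemma is_affine_space_top_stratum:
  assumes gt: "term_ordering gt" "gt (1, 0) (0, 1)" and lex: "lex_exponents t m"
    and e: "bij_betw e {..<D} (coords t m)"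
  shows "is_affine_space D (stratum_coords gt t m D e (t + 1) :: 'k::field vec set)"
proof -
  let ?Z = "{\<nu>. \<nu> < D \<and> snd (snd (e \<nu>)) = 0}"
  have "stratum_coords gt t m D e (t + 1) = {v \<in> carrier_vec D. \<forall>\<nu>\<in>?Z. vec_index v \<nu> = (0 :: 'k)}"
  proof (rule Set.set_eqI)
    fix v :: "'k vec"
    let ?A = "const_part (specialize (general_element t D e) v)"
    have A: "?A $$ (i, j) = coeff (specialize (general_element t D e) v $$ (i, j)) 0" if "i \<le> t" "j < t" for i j
      using that by (simp add: const_part_def specialize_def)
    have dim: "dim_row ?A = t + 1" "dim_col ?A = t" by (simp_all add: const_part_def specialize_def)
    have "(\<forall>i<t+1. \<forall>j<t. ?A $$ (i, j) = 0) \<longleftrightarrow> (\<forall>\<nu>\<in>?Z. vec_index v \<nu> = 0)"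
    proof
      assume h: "\<forall>i<t+1. \<forall>j<t. ?A $$ (i, j) = 0"
      show "\<forall>\<nu>\<in>?Z. vec_index v \<nu> = 0"
      proof
        fix \<nu> assume \<nu>: "\<nu> \<in> ?Z"
        then obtain i j where ij: "\<nu> < D" "e \<nu> = (i, j, 0)" by (cases "e \<nu>") auto
        show "vec_index v \<nu> = 0"
          using coeff_specialize_coord(1,2)[OF e ij] coeff_specialize_coord(3)[OF e ij, of v] h A[of i j] by simp
      qed
    next
      assume h: "\<forall>\<nu>\<in>?Z. vec_index v \<nu> = 0"
      show "\<forall>i<t+1. \<forall>j<t. ?A $$ (i, j) = 0"
      proof (intro allI impI)
        fix i j assume "i < t + 1" "j < t"
        then have ij: "i \<le> t" "j < t" by auto
        show "?A $$ (i, j) = 0" unfolding A[OF ij] coeff_specialize[OF ij]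
          using h by (intro sum.neutral) auto
      qed
    qed
    then show "v \<in> stratum_coords gt t m D e (t + 1) \<longleftrightarrow> v \<in> {v \<in> carrier_vec D. \<forall>\<nu>\<in>?Z. vec_index v \<nu> = (0 :: 'k)}"
      using stratum_coords_iff[OF gt lex e, of "t + 1" v] minors_1_eq_0_iff[of ?A] dim
      by (simp add: minors_0 const_part_specialize)
  qed
  then show ?thesis using is_affine_space_coordinate_subspace[of ?Z D, where ?'k = 'k] by auto
qed

text \<open>The inequality is u > 0 in subtraction-free form: the entry must then be divisible by
  y.\<close>

lemma const_part_zero:
  assumes N: "N \<in> HB_params t m" and "i \<le> t" "j < t" and z: "m i + j < m (Suc j) + i"
  shows "const_part N $$ (i, j) = 0"
proof -
  have "(i, j, 0) \<notin> coords t m" using z by (auto simp: coords_def udeg_def)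
  moreover have "N \<in> carrier_mat (t + 1) t" using N by (simp add: HB_params_def)
  ultimately show ?thesis using HB_params_coeff_0[OF N assms(2,3)] assms(2,3) by (simp add: const_part_def)
qed

text \<open>
  The hypotheses on \<open>p\<close> say that \<open>i \<mapsto> m i - i\<close> is constant on \<open>p, ..., p + \<Delta> - 1\<close>. Counting from zero,
  the constant part then vanishes in the rows above \<open>p + \<Delta>\<close> and the columns from \<open>p - 1\<close> on.
\<close>

lemma const_part_minors_vanish:
  assumes N: "N \<in> HB_params t m" and lex: "lex_exponents t m"
    and p: "1 \<le> p" "1 \<le> \<Delta>" "p + \<Delta> - 1 \<le> t" "m (p + \<Delta> - 1) = m p + (\<Delta> - 1)"
  shows "\<forall>x\<in>minors (t + 1 - \<Delta>) (const_part N). x = 0"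
\<comment> \<open>With t + 1 rows, a zero block of p + \<Delta> rows and t - p + 1 columns kills
  exactly the sizes from t + 1 - \<Delta> on by this count.\<close>
proof (rule minors_zero_block[where \<alpha> = "p + \<Delta>" and \<beta> = "p - 1"])
  have Nc: "N \<in> carrier_mat (t + 1) t" using N by (simp add: HB_params_def)
  show "const_part N $$ (i, j) = 0" if "i < p + \<Delta>" "p - 1 \<le> j" "i < dim_row (const_part N)" "j < dim_col (const_part N)" for i j
  proof (rule const_part_zero[OF N])
    show ij: "i \<le> t" "j < t" using that Nc by (auto simp: const_part_def)
    have "m p + Suc j \<le> m (Suc j) + p" using that ij p by (intro lex_exponents_diff_mono[OF lex]) auto
    moreover have "m i + (p + \<Delta> - 1) \<le> m (p + \<Delta> - 1) + i" using that ij p by (intro lex_exponents_diff_mono[OF lex]) auto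
    ultimately show "m i + j < m (Suc j) + i" using p by linarith
  qed
  show "p + \<Delta> \<le> dim_row (const_part N)" "dim_row (const_part N) + (p - 1) < t + 1 - \<Delta> + (p + \<Delta>)"
    using Nc p by (auto simp: const_part_def)
qed

text \<open>The witness has ones on the diagonal \<Delta> + 1 steps below the main one. The gap
  hypothesis makes u \<le> 0 at these places, so constants are allowed there, and they form an
  identity matrix of size t - \<Delta>.\<close>

lemma const_part_minor_nonzero:
  assumes lex: "lex_exponents t m" and \<Delta>: "\<Delta> \<le> t"
    and gap: "\<And>p. 1 \<le> p \<Longrightarrow> p + \<Delta> \<le> t \<Longrightarrow> m p + \<Delta> < m (p + \<Delta>)"
  shows "\<exists>N \<in> HB_params t m. \<not> (\<forall>x\<in>minors (t - \<Delta>) (const_part N :: 'k::field mat). x = 0)"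
proof
  define N :: "'k poly mat" where "N = mat (t + 1) t (\<lambda>(i, j). if i = j + Suc \<Delta> then 1 else 0)"
  show "N \<in> HB_params t m" unfolding HB_params_iff
  proof (intro conjI allI impI)
    fix i j k assume "i < t + 1" "j < t" "coeff (N $$ (i, j)) k \<noteq> 0"
    then have i: "i = j + Suc \<Delta>" "k = 0" "i \<le> t" "j < t" by (auto simp: N_def split: if_splits)
    show "(i, j, k) \<in> coords t m"
      using gap[of "Suc j"] ddiff_Suc[OF lex i(4)] i by (auto simp: coords_def udeg_def)
  qed (simp add: N_def)
  show "\<not> (\<forall>x\<in>minors (t - \<Delta>) (const_part N). x = 0)"
  proof
    assume "\<forall>x\<in>minors (t - \<Delta>) (const_part N). x = 0"
    then have "fminor (const_part N) (t - \<Delta>) (\<lambda>a. a + Suc \<Delta>) (\<lambda>b. b) = 0"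
      by (rule fminor_eq_0) (auto simp: const_part_def N_def)
    moreover have "mat (t - \<Delta>) (t - \<Delta>) (\<lambda>(a, b). const_part N $$ (a + Suc \<Delta>, b)) = 1\<^sub>m (t - \<Delta>)"
      by (rule eq_matI) (auto simp: const_part_def N_def)
    ultimately show False by (simp add: fminor_def)
  qed
qed

section \<open>Hilbert functions and colength\<close>

definition k_subspace :: "'k::field series set \<Rightarrow> bool" where
  "k_subspace W \<longleftrightarrow> 0 \<in> W \<and> (\<forall>a\<in>W. \<forall>b\<in>W. a + b \<in> W) \<and> (\<forall>c. \<forall>a\<in>W. kscale c a \<in> W)"

lemma kscale_add_right: "kscale c (a + b) = kscale c a + kscale c b"
  and kscale_mult: "kscale c (kscale d a) = kscale (c * d) a"
  and kscale_one: "kscale 1 a = a"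
  and kscale_zero: "kscale 0 a = 0"
  by (rule series_eqI, simp add: algebra_simps)+

lemma kscale_sum: "kscale c (\<Sum>x\<in>A. f x) = (\<Sum>x\<in>A. kscale c (f x))"
  by (rule series_eqI) (simp add: mcoeff_sum sum_distrib_left)

lemma kscale_sum_left: "kscale (\<Sum>x\<in>A. c x) a = (\<Sum>x\<in>A. kscale (c x) a)"
  by (rule series_eqI) (simp add: mcoeff_sum sum_distrib_right)

lemma kscale_uminus_one: "kscale (- 1) a = - a"
  by (rule series_eqI) simp

lemma kscale_diff: "kscale c (a - b) = kscale c a - kscale c b"
  by (rule series_eqI) (simp add: algebra_simps)

lemma k_subspace_add: "k_subspace W \<Longrightarrow> a \<in> W \<Longrightarrow> b \<in> W \<Longrightarrow> a + b \<in> W"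
  and k_subspace_scale: "k_subspace W \<Longrightarrow> a \<in> W \<Longrightarrow> kscale c a \<in> W"
  and k_subspace_zero: "k_subspace W \<Longrightarrow> 0 \<in> W"
  by (auto simp: k_subspace_def)

lemma k_subspace_diff: "k_subspace W \<Longrightarrow> a \<in> W \<Longrightarrow> b \<in> W \<Longrightarrow> a - b \<in> W"
  using k_subspace_scale[of W b "- 1"] k_subspace_add[of W a "- b"] by (simp add: kscale_uminus_one)

lemma k_subspace_sum: "k_subspace W \<Longrightarrow> (\<And>x. x \<in> A \<Longrightarrow> f x \<in> W) \<Longrightarrow> (\<Sum>x\<in>A. f x) \<in> W"
  by (induction A rule: infinite_finite_induct) (auto intro: k_subspace_add k_subspace_zero)

lemma k_subspace_ideal: "is_ideal J \<Longrightarrow> k_subspace J"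
  by (auto simp: is_ideal_iff k_subspace_def kscale_def)

lemma k_subspace_sum_set:
  assumes "k_subspace V" "k_subspace W"
  shows "k_subspace {a + b | a b. a \<in> V \<and> b \<in> W}"
  unfolding k_subspace_def
proof (intro conjI ballI allI)
  show "0 \<in> {a + b | a b. a \<in> V \<and> b \<in> W}" using assms by (auto intro!: exI[of _ 0] k_subspace_zero)
  fix x assume "x \<in> {a + b | a b. a \<in> V \<and> b \<in> W}"
  then obtain a b where x: "x = a + b" "a \<in> V" "b \<in> W" by blast
  show "kscale c x \<in> {a + b | a b. a \<in> V \<and> b \<in> W}" for c
    unfolding x(1) kscale_add_right using x assms by (blast intro: k_subspace_scale)
  fix y assume "y \<in> {a + b | a b. a \<in> V \<and> b \<in> W}"
  then obtain a' b' where y: "y = a' + b'" "a' \<in> V" "b' \<in> W" by blast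
  have "x + y = (a + a') + (b + b')" using x y by simp
  then show "x + y \<in> {a + b | a b. a \<in> V \<and> b \<in> W}" using x y assms by (blast intro: k_subspace_add)
qed

text \<open>Steinitz comparison of a spanning with an independent family modulo W. Indexed families
  instead of sets permit repeated vectors, such as powers of one series.\<close>

lemma has_quot_dim_le:
  assumes W: "k_subspace W"
    and B: "finite B" "\<And>v. v \<in> V \<Longrightarrow> \<exists>c. v - (\<Sum>b\<in>B. kscale (c b) (u b)) \<in> W"
    and C: "finite C" "\<And>x. x \<in> C \<Longrightarrow> w x \<in> V"
      "\<And>z. (\<Sum>x\<in>C. kscale (z x) (w x)) \<in> W \<Longrightarrow> \<forall>x\<in>C. z x = 0"
  shows "card C \<le> card B"
proof (rule ccontr)
  assume "\<not> card C \<le> card B"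
  then have less: "card B < card C" by simp
  have "\<forall>x\<in>C. \<exists>c. w x - (\<Sum>b\<in>B. kscale (c b) (u b)) \<in> W" using B(2) C(2) by blast
  then obtain c where c: "\<And>x. x \<in> C \<Longrightarrow> w x - (\<Sum>b\<in>B. kscale (c x b) (u b)) \<in> W" by metis
  from linear_dependence[OF B(1) C(1) less, of c] obtain z where z: "\<exists>x\<in>C. z x \<noteq> 0"
    "\<And>b. b \<in> B \<Longrightarrow> (\<Sum>x\<in>C. z x * c x b) = 0" by blast
  have "(\<Sum>x\<in>C. kscale (z x) (w x)) = (\<Sum>x\<in>C. kscale (z x) (w x - (\<Sum>b\<in>B. kscale (c x b) (u b)))) +
      (\<Sum>x\<in>C. \<Sum>b\<in>B. kscale (z x * c x b) (u b))"
    by (simp add: kscale_diff kscale_sum kscale_mult sum_subtractf)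
  also have "(\<Sum>x\<in>C. \<Sum>b\<in>B. kscale (z x * c x b) (u b)) = (\<Sum>b\<in>B. kscale (\<Sum>x\<in>C. z x * c x b) (u b))"
    by (subst sum.swap) (simp add: kscale_sum_left)
  also have "\<dots> = 0" using z(2) by (simp add: kscale_zero)
  finally have "(\<Sum>x\<in>C. kscale (z x) (w x)) \<in> W"
    using c W by (auto intro!: k_subspace_sum k_subspace_scale)
  then show False using C(3) z(1) by blast
qed

lemma has_quot_dim_unique:
  assumes W: "k_subspace W" and "has_quot_dim V W a" "has_quot_dim V W b"
  shows "a = b"
proof -
  obtain B where B: "finite B" "card B = a" "B \<subseteq> V" "\<And>v. v \<in> V \<Longrightarrow> \<exists>c. v - (\<Sum>b\<in>B. kscale (c b) b) \<in> W"
      "\<And>c. (\<Sum>b\<in>B. kscale (c b) b) \<in> W \<Longrightarrow> \<forall>b\<in>B. c b = 0"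
    using assms(2) unfolding has_quot_dim_def by blast
  obtain C where C: "finite C" "card C = b" "C \<subseteq> V" "\<And>v. v \<in> V \<Longrightarrow> \<exists>c. v - (\<Sum>b\<in>C. kscale (c b) b) \<in> W"
      "\<And>c. (\<Sum>b\<in>C. kscale (c b) b) \<in> W \<Longrightarrow> \<forall>b\<in>C. c b = 0"
    using assms(3) unfolding has_quot_dim_def by blast
  have "card C \<le> card B" by (rule has_quot_dim_le[OF W B(1,4) C(1) _ C(5)]) (use C in auto)
  moreover have "card B \<le> card C" by (rule has_quot_dim_le[OF W C(1,4) B(1) _ B(5)]) (use B in auto)
  ultimately show ?thesis using B C by simp
qed

text \<open>A spanning set of least cardinality is linearly independent.\<close>

lemma has_quot_dim_exists:
  assumes W: "k_subspace W" and B0: "finite B0" "B0 \<subseteq> V" "\<And>v. v \<in> V \<Longrightarrow> \<exists>c. v - (\<Sum>b\<in>B0. kscale (c b) b) \<in> W"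
  shows "\<exists>n. has_quot_dim V W n"
proof -
  define P where "P B \<longleftrightarrow> finite B \<and> B \<subseteq> V \<and> (\<forall>v\<in>V. \<exists>c. v - (\<Sum>b\<in>B. kscale (c b) b) \<in> W)" for B
  have "P B0" using B0 by (auto simp: P_def)
  then obtain B where B: "P B" "\<And>C. P C \<Longrightarrow> card B \<le> card C"
    using ex_has_least_nat[of P B0 card] by blast
  have "\<forall>b\<in>B. c b = 0" if c: "(\<Sum>b\<in>B. kscale (c b) b) \<in> W" for c
  proof (rule ccontr)
    assume "\<not> ?thesis"
    then obtain p where p: "p \<in> B" "c p \<noteq> 0" by blast
    define B' where "B' = B - {p}"
    have BB: "B = insert p B'" "p \<notin> B'" "finite B'" using B p by (auto simp: B'_def P_def)
    have "P B'" unfolding P_def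
    proof (intro conjI ballI)
      fix v assume "v \<in> V"
      then obtain a where a: "v - (\<Sum>b\<in>B. kscale (a b) b) \<in> W" using B(1) by (auto simp: P_def)
      let ?s = "a p / c p"
      have "v - (\<Sum>b\<in>B. kscale (a b) b) + kscale ?s (\<Sum>b\<in>B. kscale (c b) b) \<in> W"
        using a c W by (intro k_subspace_add k_subspace_scale)
      also have "v - (\<Sum>b\<in>B. kscale (a b) b) + kscale ?s (\<Sum>b\<in>B. kscale (c b) b) =
          v - (\<Sum>b\<in>B'. kscale (a b - ?s * c b) b)"
        using p(2) unfolding BB(1) sum.insert[OF BB(3,2)]
        by (intro series_eqI) (simp add: mcoeff_sum algebra_simps sum_subtractf sum_distrib_left)
      finally show "\<exists>c. v - (\<Sum>b\<in>B'. kscale (c b) b) \<in> W" by (rule exI[of _ "\<lambda>b. a b - ?s * c b"])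
    qed (use B BB in \<open>auto simp: P_def\<close>)
    then show False using B(2)[of B'] BB by simp
  qed
  then show ?thesis using B(1) unfolding has_quot_dim_def P_def by blast
qed

text \<open>The union of the two bases works; they are disjoint because the first is independent
  modulo V and the second lies in V.\<close>

lemma has_quot_dim_trans:
  assumes V: "k_subspace V" and sub: "W \<subseteq> V" "V \<subseteq> U"
    and UV: "has_quot_dim U V a" and VW: "has_quot_dim V W b"
  shows "has_quot_dim U W (a + b)"
proof -
  obtain B where B: "finite B" "card B = a" "B \<subseteq> U" "\<And>v. v \<in> U \<Longrightarrow> \<exists>c. v - (\<Sum>b\<in>B. kscale (c b) b) \<in> V"
      "\<And>c. (\<Sum>b\<in>B. kscale (c b) b) \<in> V \<Longrightarrow> \<forall>b\<in>B. c b = 0"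
    using UV unfolding has_quot_dim_def by blast
  obtain C where C: "finite C" "card C = b" "C \<subseteq> V" "\<And>v. v \<in> V \<Longrightarrow> \<exists>c. v - (\<Sum>b\<in>C. kscale (c b) b) \<in> W"
      "\<And>c. (\<Sum>b\<in>C. kscale (c b) b) \<in> W \<Longrightarrow> \<forall>b\<in>C. c b = 0"
    using VW unfolding has_quot_dim_def by blast
  have disj: "B \<inter> C = {}"
  proof (rule ccontr)
    assume "B \<inter> C \<noteq> {}"
    then obtain p where p: "p \<in> B" "p \<in> C" by blast
    have "(\<Sum>b\<in>B. kscale (if b = p then 1 else 0) b) = (\<Sum>b\<in>B. if b = p then p else 0)"
      by (intro sum.cong) (auto simp: kscale_one kscale_zero)
    also have "\<dots> = p" using B(1) p by simp
    finally have "(\<Sum>b\<in>B. kscale (if b = p then 1 else 0) b) \<in> V" using p C(3) by auto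
    from B(5)[OF this] p(1) show False by auto
  qed
  show ?thesis unfolding has_quot_dim_def
  proof (intro exI[of _ "B \<union> C"] conjI ballI allI impI)
    fix v assume "v \<in> U"
    then obtain c where c: "v - (\<Sum>b\<in>B. kscale (c b) b) \<in> V" using B(4) by blast
    then obtain d where d: "v - (\<Sum>b\<in>B. kscale (c b) b) - (\<Sum>b\<in>C. kscale (d b) b) \<in> W" using C(4) by blast
    let ?c = "\<lambda>b. if b \<in> B then c b else d b"
    have "(\<Sum>b\<in>B \<union> C. kscale (?c b) b) = (\<Sum>b\<in>B. kscale (c b) b) + (\<Sum>b\<in>C. kscale (d b) b)"
      using B(1) C(1) disj by (subst sum.union_disjoint) (auto intro!: arg_cong2[where f = "(+)"] sum.cong)
    then have "v - (\<Sum>b\<in>B \<union> C. kscale (?c b) b) \<in> W" using d by (simp add: algebra_simps)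
    then show "\<exists>c. v - (\<Sum>b\<in>B \<union> C. kscale (c b) b) \<in> W" by (rule exI[of _ ?c])
  next
    fix c x assume c: "(\<Sum>b\<in>B \<union> C. kscale (c b) b) \<in> W" and x: "x \<in> B \<union> C"
    have eq: "(\<Sum>b\<in>B \<union> C. kscale (c b) b) = (\<Sum>b\<in>B. kscale (c b) b) + (\<Sum>b\<in>C. kscale (c b) b)"
      using B(1) C(1) disj by (rule sum.union_disjoint)
    have sC: "(\<Sum>b\<in>C. kscale (c b) b) \<in> V" using C(3) V by (auto intro!: k_subspace_sum k_subspace_scale)
    have "(\<Sum>b\<in>B \<union> C. kscale (c b) b) \<in> V" using c sub by blast
    from k_subspace_diff[OF V this sC] have "(\<Sum>b\<in>B. kscale (c b) b) \<in> V" by (simp add: eq)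
    then have cB: "\<forall>b\<in>B. c b = 0" by (rule B(5))
    then have "(\<Sum>b\<in>C. kscale (c b) b) \<in> W" using c unfolding eq by (simp add: kscale_zero)
    then have "\<forall>b\<in>C. c b = 0" by (rule C(5))
    then show "c x = 0" using cB x by auto
  qed (use B C disj sub in \<open>auto simp: card_Un_disjoint\<close>)
qed

section \<open>Powers of the maximal ideal and graded pieces\<close>

lemma is_ideal_deg_ge: "is_ideal {f. deg_ge i f}"
  unfolding is_ideal_iff
proof (intro conjI ballI allI)
  fix r a :: "'a series" assume a: "a \<in> {f. deg_ge i f}"
  show "r * a \<in> {f. deg_ge i f}"
    unfolding deg_ge_def
  proof (intro CollectI allI impI)
    fix \<mu> assume "mcoeff (r * a) \<mu> \<noteq> 0"
    from mcoeff_mult_nonzero[OF this] obtain \<alpha> \<beta> where "\<mu> = \<alpha> + \<beta>" "mcoeff a \<beta> \<noteq> 0" by blast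
    then show "i \<le> fst \<mu> + snd \<mu>" using a by (force simp: deg_ge_def)
  qed
qed (auto simp: deg_ge_iff)

text \<open>Separates the terms divisible by x^a, those of the rest divisible by y^b, and a finite
  box. When the order makes the box empty, the series lies in the ideal generated by x^a and
  y^b.\<close>

lemma series_split:
  fixes f :: "'k::field series"
  shows "f = fps_X ^ a * fps_shift a f + fps_const (fps_X ^ b) * Abs_fps (\<lambda>i. if i < a then fps_shift b (fps_nth f i) else 0)
     + Abs_fps (\<lambda>i. if i < a then fps_cutoff b (fps_nth f i) else 0)"
proof (rule fps_ext)
  fix i
  show "fps_nth f i = fps_nth (fps_X ^ a * fps_shift a f + fps_const (fps_X ^ b) * Abs_fps (\<lambda>i. if i < a then fps_shift b (fps_nth f i) else 0)
     + Abs_fps (\<lambda>i. if i < a then fps_cutoff b (fps_nth f i) else 0)) i"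
    by (cases "i < a") (auto simp: fps_X_power_mult_nth fps_shift_cutoff mult.commute[of "fps_X ^ b"])
qed

lemma mpow_eq: "mpow i = {f :: 'k::field series. deg_ge i f}"
proof (induction i)
  case (Suc i)
  let ?S = "{a * b | a b :: 'k series. a \<in> ideal_span {varx, vary} \<and> b \<in> mpow i}"
  have xy: "deg_ge 1 a" if "a \<in> ideal_span {varx, vary :: 'k series}" for a
  proof -
    have "{varx, vary :: 'k series} \<subseteq> {f. deg_ge 1 f}"
      by (auto simp: deg_ge_def varx_def vary_def mcoeff_def fps_X_nth split: if_splits)
    then show ?thesis using ideal_span_minimal[OF _ is_ideal_deg_ge] that by blast
  qed
  have "deg_ge (Suc i) (a * b)" if "deg_ge 1 a" "deg_ge i b" for a b :: "'k series"
    unfolding deg_ge_def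
  proof (intro allI impI)
    fix \<mu> assume "mcoeff (a * b) \<mu> \<noteq> 0"
    from mcoeff_mult_nonzero[OF this] obtain \<alpha> \<beta> where "\<mu> = \<alpha> + \<beta>" "mcoeff a \<alpha> \<noteq> 0" "mcoeff b \<beta> \<noteq> 0" by blast
    then show "Suc i \<le> fst \<mu> + snd \<mu>" using that by (force simp: deg_ge_def)
  qed
  then have "?S \<subseteq> {f. deg_ge (Suc i) f}" using xy Suc by auto
  then have "mpow (Suc i) \<subseteq> {f :: 'k series. deg_ge (Suc i) f}"
    unfolding mpow.simps by (intro ideal_span_minimal is_ideal_deg_ge)
  moreover have "f \<in> mpow (Suc i)" if f: "deg_ge (Suc i) f" for f :: "'k series"
  proof -
    let ?g = "fps_shift 1 f" and ?h = "Abs_fps (\<lambda>k. if k < 1 then fps_shift 1 (fps_nth f k) else 0)"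
    have c: "fps_nth (fps_nth f a) b = 0" if "a + b < Suc i" for a b
      using f[unfolded deg_ge_iff, rule_format, of "(a, b)"] that by (simp add: mcoeff_def)
    have "Abs_fps (\<lambda>k. if k < 1 then fps_cutoff 1 (fps_nth f k) else 0) = 0"
      by (intro fps_ext) (use c[of 0 0] in \<open>auto simp: fps_cutoff_nth\<close>)
    then have "f = varx * ?g + vary * ?h"
      using series_split[of f 1 1] by (simp add: varx_def vary_def)
    moreover have "deg_ge i ?g" "deg_ge i ?h"
      by (auto simp: deg_ge_iff mcoeff_def intro!: c)
    then have "varx * ?g \<in> ?S" "vary * ?h \<in> ?S" using Suc ideal_span_base[of varx "{varx, vary}"] ideal_span_base[of vary "{varx, vary}"] by auto
    ultimately show ?thesis unfolding mpow.simps
      by (metis (no_types, lifting) ideal_span_base is_ideal_add is_ideal_span)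
  qed
  ultimately show ?case by blast
qed (auto simp: deg_ge_iff)

abbreviation graded_denom :: "'k::field series set \<Rightarrow> nat \<Rightarrow> 'k series set" where
  "graded_denom J i \<equiv> {a + b | a b. a \<in> mpow (Suc i) \<and> b \<in> J \<inter> mpow i}"

lemma k_subspace_mpow: "k_subspace (mpow i :: 'k::field series set)"
  unfolding mpow_eq by (intro k_subspace_ideal is_ideal_deg_ge)

lemma k_subspace_Int: "k_subspace V \<Longrightarrow> k_subspace W \<Longrightarrow> k_subspace (V \<inter> W)"
  by (auto simp: k_subspace_def)

lemma k_subspace_graded_denom: "is_ideal J \<Longrightarrow> k_subspace (graded_denom J i)"
  by (intro k_subspace_sum_set k_subspace_Int k_subspace_mpow k_subspace_ideal)

lemma hilbert_fun_eqI: "is_ideal J \<Longrightarrow> has_quot_dim (mpow i) (graded_denom J i) n \<Longrightarrow> hilbert_fun J i = n"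
  unfolding hilbert_fun_def by (rule the_equality) (auto intro: has_quot_dim_unique[OF k_subspace_graded_denom])

lemma homogeneous_part:
  fixes v :: "'k::field series"
  assumes v: "deg_ge i v"
  shows "deg_ge (Suc i) (v - (\<Sum>a\<le>i. kscale (mcoeff v (a, i - a)) (monomial (a, i - a))))"
proof -
  have "mcoeff (\<Sum>a\<le>i. kscale (mcoeff v (a, i - a)) (monomial (a, i - a))) \<mu> = mcoeff v \<mu>"
    if "fst \<mu> + snd \<mu> < Suc i" for \<mu>
  proof (cases "fst \<mu> + snd \<mu> = i")
    case True
    have "mcoeff (\<Sum>a\<le>i. kscale (mcoeff v (a, i - a)) (monomial (a, i - a))) \<mu> = (\<Sum>a\<le>i. if a = fst \<mu> then mcoeff v \<mu> else 0)"
      unfolding mcoeff_sum using True by (intro sum.cong) (auto simp: mcoeff_monomial prod_eq_iff)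
    then show ?thesis using True by simp
  next
    case False
    then have "mcoeff v \<mu> = 0" using v that by (auto simp: deg_ge_iff)
    moreover have "mcoeff (\<Sum>a\<le>i. kscale (mcoeff v (a, i - a)) (monomial (a, i - a))) \<mu> = 0"
      unfolding mcoeff_sum using False by (intro sum.neutral) (auto simp: mcoeff_monomial)
    ultimately show ?thesis by simp
  qed
  then show ?thesis by (simp add: deg_ge_iff)
qed

lemma deg_ge_monomial: "deg_ge d (monomial (a, b)) \<longleftrightarrow> d \<le> a + b"
  by (auto simp: deg_ge_def mcoeff_monomial)

text \<open>The monomials of degree i span the graded piece, so the dimension exists and the
  description in \<open>hilbert_fun\<close> is a proper one.\<close>

lemma hilbert_fun_has_quot_dim:
  fixes J :: "'k::field series set"
  assumes J: "is_ideal J"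
  shows "has_quot_dim (mpow i) (graded_denom J i) (hilbert_fun J i)"
proof -
  let ?M = "\<lambda>a. monomial (a, i - a) :: 'k series"
  have inj: "inj_on ?M {..i}"
  proof (rule inj_onI)
    fix a b assume "?M a = ?M b"
    then have "mcoeff (?M a) (a, i - a) = mcoeff (?M b) (a, i - a)" by simp
    then show "a = b" by (auto simp: mcoeff_monomial split: if_splits)
  qed
  have "\<exists>n. has_quot_dim (mpow i) (graded_denom J i) n"
  proof (rule has_quot_dim_exists[OF k_subspace_graded_denom[OF J]])
    show "?M ` {..i} \<subseteq> mpow i" by (auto simp: mpow_eq deg_ge_monomial)
    fix v :: "'k series" assume v: "v \<in> mpow i"
    define c where "c b = mcoeff v (inv_into {..i} ?M b, i - inv_into {..i} ?M b)" for b
    have "(\<Sum>b\<in>?M ` {..i}. kscale (c b) b) = (\<Sum>a\<le>i. kscale (mcoeff v (a, i - a)) (?M a))"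
      by (subst sum.reindex[OF inj]) (auto simp: c_def inv_into_f_f[OF inj] intro!: sum.cong)
    then have "v - (\<Sum>b\<in>?M ` {..i}. kscale (c b) b) \<in> mpow (Suc i)"
      using homogeneous_part[of i v] v by (simp add: mpow_eq)
    moreover have "0 \<in> J \<inter> mpow i" using J by (simp add: is_ideal_iff mpow_eq deg_ge_iff)
    ultimately have "v - (\<Sum>b\<in>?M ` {..i}. kscale (c b) b) \<in> graded_denom J i"
      by (metis (mono_tags, lifting) add.right_neutral mem_Collect_eq)
    then show "\<exists>c. v - (\<Sum>b\<in>?M ` {..i}. kscale (c b) b) \<in> graded_denom J i" by blast
  qed simp
  then obtain n where "has_quot_dim (mpow i) (graded_denom J i) n" ..
  then show ?thesis using hilbert_fun_eqI[OF J, of i n] by simp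
qed

text \<open>The monomials of degree i outside the staircase form a basis of the graded piece; they
  are counted by j, where t - j is their power of x.\<close>

lemma hilbert_fun_lex_ideal:
  assumes lex: "lex_exponents t m"
  shows "hilbert_fun (lex_ideal t m :: 'k::field series set) i = card {j \<in> {1..t}. t - j \<le> i \<and> i < t - j + m j}"
proof -
  let ?L = "lex_ideal t m :: 'k series set"
  have L: "is_ideal ?L" unfolding lex_ideal_def by (rule is_ideal_span)
  let ?M = "\<lambda>a. monomial (a, i - a) :: 'k series"
  define A where "A = {a. a \<le> i \<and> \<not> stair t m (a, i - a)}"
  have A: "finite A" "A \<subseteq> {..i}" by (auto simp: A_def)
  have inj: "inj_on ?M {..i}"
  proof (rule inj_onI)
    fix a b assume "?M a = ?M b"
    then have "mcoeff (?M a) (a, i - a) = mcoeff (?M b) (a, i - a)" by simp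
    then show "a = b" by (auto simp: mcoeff_monomial split: if_splits)
  qed
  have injA: "inj_on ?M A" using inj A(2) by (rule inj_on_subset)
  have "has_quot_dim (mpow i) (graded_denom ?L i) (card A)"
    unfolding has_quot_dim_def
  proof (intro exI[of _ "?M ` A"] conjI ballI allI impI)
    show "card (?M ` A) = card A" by (rule card_image[OF injA])
    show "?M ` A \<subseteq> mpow i" using A by (auto simp: mpow_eq deg_ge_monomial)
  next
    fix v :: "'k series" assume v: "v \<in> mpow i"
    define c where "c b = mcoeff v (inv_into A ?M b, i - inv_into A ?M b)" for b
    have s: "(\<Sum>b\<in>?M ` A. kscale (c b) b) = (\<Sum>a\<in>A. kscale (mcoeff v (a, i - a)) (?M a))"
      by (subst sum.reindex[OF injA]) (auto simp: c_def inv_into_f_f[OF injA] intro!: sum.cong)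
    let ?r = "v - (\<Sum>a\<le>i. kscale (mcoeff v (a, i - a)) (?M a))"
    let ?l = "\<Sum>a\<in>{..i} - A. kscale (mcoeff v (a, i - a)) (?M a)"
    have "v - (\<Sum>b\<in>?M ` A. kscale (c b) b) = ?r + ?l"
      unfolding s using sum.subset_diff[OF A(2), of "\<lambda>a. kscale (mcoeff v (a, i - a)) (?M a)"] by simp
    moreover have "?r \<in> mpow (Suc i)" using homogeneous_part[of i v] v by (simp add: mpow_eq)
    moreover have "?M a \<in> ?L \<inter> mpow i" if "a \<in> {..i} - A" for a
      using that by (auto simp: lex_ideal_iff[OF lex] mcoeff_monomial A_def mpow_eq deg_ge_monomial split: if_splits)
    then have "?l \<in> ?L \<inter> mpow i"
      using k_subspace_Int[OF k_subspace_ideal[OF L] k_subspace_mpow[of i]] by (intro k_subspace_sum k_subspace_scale)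
    ultimately show "\<exists>c. v - (\<Sum>b\<in>?M ` A. kscale (c b) b) \<in> graded_denom ?L i"
      by (intro exI[of _ c]) blast
  next
    fix c and x :: "'k series" assume c: "(\<Sum>b\<in>?M ` A. kscale (c b) b) \<in> graded_denom ?L i" and "x \<in> ?M ` A"
    then obtain a where a: "a \<in> A" "x = ?M a" by blast
    from c obtain u w where uw: "(\<Sum>b\<in>?M ` A. kscale (c b) b) = u + w" "u \<in> mpow (Suc i)" "w \<in> ?L" by blast
    have "mcoeff (\<Sum>b\<in>?M ` A. kscale (c b) b) (a, i - a) = (\<Sum>a'\<in>A. if a' = a then c (?M a) else 0)"
      by (subst sum.reindex[OF injA]) (auto simp: mcoeff_sum mcoeff_monomial intro!: sum.cong)
    then have "c (?M a) = mcoeff (u + w) (a, i - a)" using a A(1) uw(1) by simp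
    moreover have "mcoeff u (a, i - a) = 0" using uw(2) a by (auto simp: mpow_eq deg_ge_iff A_def)
    moreover have "mcoeff w (a, i - a) = 0" using uw(3) a by (auto simp: lex_ideal_iff[OF lex] A_def)
    ultimately show "c x = 0" using a by simp
  qed (use A in simp)
  then have "hilbert_fun ?L i = card A" by (rule hilbert_fun_eqI[OF L])
  also have "bij_betw (\<lambda>j. t - j) {j \<in> {1..t}. t - j \<le> i \<and> i < t - j + m j} A"
    by (rule bij_betw_byWitness[where f' = "\<lambda>a. t - a"]) (auto simp: A_def stair_def not_le)
  then have "card A = card {j \<in> {1..t}. t - j \<le> i \<and> i < t - j + m j}" by (rule bij_betw_same_card[symmetric])
  finally show ?thesis .
qed

text \<open>The powers up to the exponent n are dependent modulo J. In a dependence the lowest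
  occurring power can be factored out, and the cofactor has nonzero constant term, hence is a
  unit.\<close>

lemma power_in_finite_colength:
  fixes J :: "'k::field series set"
  assumes J: "is_ideal J" "has_colength J n" and u: "mcoeff u (0, 0) = 0"
  shows "\<exists>k. u ^ k \<in> J"
proof -
  obtain B where B: "finite B" "card B = n" "\<And>v. \<exists>c. v - (\<Sum>b\<in>B. kscale (c b) b) \<in> J"
    using J(2) unfolding has_colength_def has_quot_dim_def by blast
  have "\<exists>z. (\<Sum>k\<le>n. kscale (z k) (u ^ k)) \<in> J \<and> (\<exists>k\<le>n. z k \<noteq> 0)"
  proof (rule ccontr)
    assume "\<not> ?thesis"
    then have "card {..n} \<le> card B"
      using B(3) by (intro has_quot_dim_le[OF k_subspace_ideal[OF J(1)] B(1), where V = UNIV and w = "\<lambda>k. u ^ k"]) auto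
    then show False using B(2) by simp
  qed
  then obtain z where z: "(\<Sum>k\<le>n. kscale (z k) (u ^ k)) \<in> J" "\<exists>k\<le>n. z k \<noteq> 0" by blast
  define k0 where "k0 = (LEAST k. k \<le> n \<and> z k \<noteq> 0)"
  have k0: "k0 \<le> n" "z k0 \<noteq> 0" "\<And>k. k < k0 \<Longrightarrow> k \<le> n \<Longrightarrow> z k = 0"
    using LeastI_ex[of "\<lambda>k. k \<le> n \<and> z k \<noteq> 0"] z(2) not_less_Least[of _ "\<lambda>k. k \<le> n \<and> z k \<noteq> 0"] unfolding k0_def by blast+
  define w where "w = (\<Sum>k\<in>{k0..n}. kscale (z k) (u ^ (k - k0)))"
  have "(\<Sum>k\<le>n. kscale (z k) (u ^ k)) = (\<Sum>k\<in>{k0..n}. kscale (z k) (u ^ k))"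
    using k0(3) by (intro sum.mono_neutral_right) (auto simp: kscale_zero)
  also have "\<dots> = w * u ^ k0" unfolding w_def sum_distrib_right
    by (intro sum.cong refl) (simp add: kscale_def mult.assoc flip: power_add)
  finally have wu: "w * u ^ k0 \<in> J" using z(1) by simp
  interpret h: comm_ring_hom "\<lambda>u :: 'k series. mcoeff u (0, 0)" by (rule comm_ring_hom_const_coeff)
  have "mcoeff w (0, 0) = (\<Sum>k\<in>{k0..n}. if k = k0 then z k0 else 0)"
    unfolding w_def mcoeff_sum by (intro sum.cong refl) (auto simp: h.hom_power u power_0_left)
  then have "mcoeff w (0, 0) \<noteq> 0" using k0 by simp
  then obtain w' where "w' * w = 1" using series_unit by blast
  then have "u ^ k0 = w' * (w * u ^ k0)" by (metis mult.assoc mult_1)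
  then show ?thesis using is_ideal_mult[OF J(1) wu] by metis
qed

lemma mpow_subset_finite_colength:
  fixes J :: "'k::field series set"
  assumes J: "is_ideal J" "has_colength J n"
  shows "\<exists>K. mpow K \<subseteq> J"
proof -
  obtain a b where a: "fps_X ^ a \<in> J" and b: "fps_const fps_X ^ b \<in> J"
    using power_in_finite_colength[OF J, of fps_X] power_in_finite_colength[OF J, of "fps_const fps_X"]
    by (auto simp: mcoeff_def)
  have "f \<in> J" if f: "deg_ge (a + b) f" for f
  proof -
    have "Abs_fps (\<lambda>i. if i < a then fps_cutoff b (fps_nth f i) else 0) = 0"
      using f by (intro series_eqI) (auto simp: mcoeff_def deg_ge_iff)
    then have eq: "f = fps_X ^ a * fps_shift a f + fps_const (fps_X ^ b) * Abs_fps (\<lambda>i. if i < a then fps_shift b (fps_nth f i) else 0)"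
      using series_split[of f a b] by simp
    have "fps_X ^ a * fps_shift a f \<in> J" using is_ideal_mult[OF J(1) a] by (metis mult.commute)
    moreover have "fps_const (fps_X ^ b) * Abs_fps (\<lambda>i. if i < a then fps_shift b (fps_nth f i) else 0) \<in> J"
      using is_ideal_mult[OF J(1) b] by (metis mult.commute fps_const_power)
    ultimately show ?thesis by (subst eq) (rule is_ideal_add[OF J(1)])
  qed
  then show ?thesis by (intro exI[of _ "a + b"]) (auto simp: mpow_eq)
qed

text \<open>The filtration m^i + J of the ring has the graded pieces as successive quotients and
  reaches J after finitely many steps. The claim for all large k lets the bound be combined with the
  end of the Hilbert function.\<close>

lemma colength_eq_sum_hilbert_fun:
  fixes J :: "'k::field series set"
  assumes J: "is_ideal J" "has_colength J n"
  shows "\<exists>K. \<forall>k\<ge>K. n = (\<Sum>i<k. hilbert_fun J i)"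
proof -
  let ?A = "\<lambda>i. {a + b | a b. a \<in> mpow i \<and> b \<in> J}"
  have A: "k_subspace (?A i)" for i
    by (intro k_subspace_sum_set k_subspace_mpow k_subspace_ideal J(1))
  have mono: "mpow (Suc i) \<subseteq> (mpow i :: 'k series set)" for i by (auto simp: mpow_eq intro: deg_ge_mono)
  have J0: "0 \<in> J" using J(1) by (simp add: is_ideal_iff)
  have step: "has_quot_dim (?A i) (?A (Suc i)) (hilbert_fun J i)" for i
  proof -
    obtain B where B: "finite B" "card B = hilbert_fun J i" "B \<subseteq> mpow i"
      "\<And>v. v \<in> mpow i \<Longrightarrow> \<exists>c. v - (\<Sum>b\<in>B. kscale (c b) b) \<in> graded_denom J i"
      "\<And>c. (\<Sum>b\<in>B. kscale (c b) b) \<in> graded_denom J i \<Longrightarrow> \<forall>b\<in>B. c b = 0"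
      using hilbert_fun_has_quot_dim[OF J(1), of i] unfolding has_quot_dim_def by blast
    show ?thesis unfolding has_quot_dim_def
    proof (intro exI[of _ B] conjI allI impI ballI)
      show "B \<subseteq> ?A i"
      proof
        fix b assume "b \<in> B"
        then have "b = b + 0" "b \<in> mpow i" using B(3) by auto
        then show "b \<in> ?A i" using J0 by blast
      qed
    next
      fix v assume "v \<in> ?A i"
      then obtain a b where ab: "v = a + b" "a \<in> mpow i" "b \<in> J" by blast
      obtain c where "a - (\<Sum>b\<in>B. kscale (c b) b) \<in> graded_denom J i" using B(4)[OF ab(2)] by blast
      then obtain p q where pq: "a - (\<Sum>b\<in>B. kscale (c b) b) = p + q" "p \<in> mpow (Suc i)" "q \<in> J" by blast
      have "v - (\<Sum>b\<in>B. kscale (c b) b) = p + (q + b)" using pq(1) ab(1) by (simp add: algebra_simps)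
      moreover have "q + b \<in> J" using pq ab J(1) by (intro is_ideal_add)
      ultimately show "\<exists>c. v - (\<Sum>b\<in>B. kscale (c b) b) \<in> ?A (Suc i)" using pq(2) by blast
    next
      fix c x assume c: "(\<Sum>b\<in>B. kscale (c b) b) \<in> ?A (Suc i)" and x: "x \<in> B"
      obtain a b where ab: "(\<Sum>b\<in>B. kscale (c b) b) = a + b" "a \<in> mpow (Suc i)" "b \<in> J" using c by blast
      have "(\<Sum>b\<in>B. kscale (c b) b) \<in> mpow i"
        using B(3) by (intro k_subspace_sum k_subspace_scale k_subspace_mpow) auto
      moreover have "a \<in> mpow i" using ab(2) mono by blast
      ultimately have "b \<in> mpow i" using k_subspace_diff[OF k_subspace_mpow[of i]] ab(1) by (metis add_diff_cancel_left')
      then have "(\<Sum>b\<in>B. kscale (c b) b) \<in> graded_denom J i" using ab by blast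
      then show "c x = 0" using B(5) x by blast
    qed (use B in auto)
  qed
  have sum: "has_quot_dim (?A 0) (?A k) (\<Sum>i<k. hilbert_fun J i)" for k
  proof (induction k)
    case 0
    show ?case unfolding has_quot_dim_def by (intro exI[of _ "{}"]) auto
  next
    case (Suc k)
    have sub: "?A (Suc k) \<subseteq> ?A k" using mono by blast
    have "?A k \<subseteq> ?A 0" by auto
    from has_quot_dim_trans[OF A sub this Suc step] show ?case by simp
  qed
  obtain K where K: "mpow K \<subseteq> J" using mpow_subset_finite_colength[OF J] by blast
  have "n = (\<Sum>i<k. hilbert_fun J i)" if k: "K \<le> k" for k
  proof -
    have "mpow k \<subseteq> J" using K k by (auto simp: mpow_eq intro: deg_ge_mono)
    then have "?A k \<subseteq> J" using J(1) by (auto intro: is_ideal_add)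
    moreover have "J \<subseteq> ?A k"
    proof
      fix b assume "b \<in> J"
      moreover have "b = 0 + b" "(0 :: 'k series) \<in> mpow k" using k_subspace_mpow[of k] by (auto simp: k_subspace_def)
      ultimately show "b \<in> ?A k" by blast
    qed
    ultimately have Ak: "?A k = J" by blast
    have A0: "?A 0 = UNIV"
    proof (intro equalityI subsetI)
      fix f :: "'k series"
      have "f = f + 0" by simp
      then show "f \<in> ?A 0" using J0 by (metis (mono_tags, lifting) UNIV_I mem_Collect_eq mpow.simps(1))
    qed simp
    show ?thesis
      using has_quot_dim_unique[OF k_subspace_ideal[OF J(1)], of UNIV] J(2) sum[of k]
      unfolding has_colength_def Ak A0 by blast
  qed
  then show ?thesis by blast
qed

section \<open>Jumps of the Hilbert function\<close>

definition gen_deg :: "nat \<Rightarrow> (nat \<Rightarrow> nat) \<Rightarrow> nat \<Rightarrow> nat" where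
  "gen_deg t m j = t - j + m j"

text \<open>The generators of equal degree, that is, a block on which m j - j is constant. The index
  0 is omitted, since the Hilbert function counts the powers x^(t-j) with j from 1 to t.\<close>

definition level :: "nat \<Rightarrow> (nat \<Rightarrow> nat) \<Rightarrow> nat \<Rightarrow> nat set" where
  "level t m c = {j \<in> {1..t}. gen_deg t m j = c}"

lemma finite_level [simp]: "finite (level t m c)"
  by (simp add: level_def)

lemma gen_deg_mono: "lex_exponents t m \<Longrightarrow> i \<le> j \<Longrightarrow> j \<le> t \<Longrightarrow> gen_deg t m i \<le> gen_deg t m j"
  using lex_exponents_diff_mono[of t m i j] by (simp add: gen_deg_def)

lemma gen_deg_ge: "lex_exponents t m \<Longrightarrow> j \<le> t \<Longrightarrow> t \<le> gen_deg t m j"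
  using gen_deg_mono[of t m 0 j] by (simp add: gen_deg_def lex_exponents_def)

text \<open>Counts the pairs j \<le> i in S, with the diagonal.\<close>

lemma sum_card_upper:
  fixes S :: "nat set"
  assumes "finite S"
  shows "(\<Sum>j\<in>S. card {i \<in> S. j \<le> i}) = (card S choose 2) + card S"
  using assms
proof (induction S rule: finite_linorder_max_induct)
  case (insert b S)
  have "{i \<in> insert b S. j \<le> i} = insert b {i \<in> S. j \<le> i}" if "j \<in> S" for j using that insert.hyps by auto
  moreover have "{i \<in> insert b S. b \<le> i} = {b}" using insert.hyps by auto
  moreover have "b \<notin> S" using insert.hyps by auto
  ultimately have "(\<Sum>j\<in>insert b S. card {i \<in> insert b S. j \<le> i}) = 1 + (\<Sum>j\<in>S. card {i \<in> S. j \<le> i} + 1)"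
    using insert.hyps by simp
  also have "\<dots> = 1 + (card S choose 2) + card S + card S" using insert.IH by (subst sum.distrib) simp
  also have "\<dots> = (card (insert b S) choose 2) + card (insert b S)"
    using insert.hyps \<open>b \<notin> S\<close> by (simp add: numeral_2_eq_2)
  finally show ?case .
qed simp

context
  fixes t s :: nat and m h :: "nat \<Rightarrow> nat"
  assumes lex: "lex_exponents t m"
    and h: "\<And>i. h i = card {j \<in> {1..t}. t - j \<le> i \<and> i < gen_deg t m j}"
    and shape: "hilbert_shape h t s"
begin

lemma shape_t_pos: "1 \<le> t"
proof (rule ccontr)
  assume "\<not> 1 \<le> t"
  then have "t = 0" by simp
  then show False using shape by (auto simp: hilbert_shape_def)
qed

lemma gen_deg_le:
  assumes "j \<in> {1..t}"
  shows "gen_deg t m j \<le> s + 1"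
proof (rule ccontr)
  assume c: "\<not> gen_deg t m j \<le> s + 1"
  have "t - j \<le> gen_deg t m j - 1" using gen_deg_ge[OF lex, of j] assms by auto
  then have "j \<in> {j' \<in> {1..t}. t - j' \<le> gen_deg t m j - 1 \<and> gen_deg t m j - 1 < gen_deg t m j'}"
    using c assms by auto
  then have "card {j' \<in> {1..t}. t - j' \<le> gen_deg t m j - 1 \<and> gen_deg t m j - 1 < gen_deg t m j'} \<noteq> 0"
    by (subst card_0_eq) auto
  then have "h (gen_deg t m j - 1) \<noteq> 0" by (simp only: h not_False_eq_True)
  moreover have "h (gen_deg t m j - 1) = 0" using shape c by (simp add: hilbert_shape_def)
  ultimately show False by simp
qed

text \<open>From degree t on, no new power of x starts to contribute, and the power x^(t-j) stops
  contributing exactly at the degree of its generator.\<close>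

lemma jump_ge:
  assumes i: "t \<le> i"
  shows "jump h i = card (level t m i)"
proof -
  have "{j \<in> {1..t}. t - j \<le> i - 1 \<and> i - 1 < gen_deg t m j} =
      {j \<in> {1..t}. t - j \<le> i \<and> i < gen_deg t m j} \<union> level t m i"
    using i by (auto simp: level_def)
  moreover have "card \<dots> = card {j \<in> {1..t}. t - j \<le> i \<and> i < gen_deg t m j} + card (level t m i)"
    by (rule card_Un_disjoint) (auto simp: level_def)
  ultimately have "h (i - 1) = h i + card (level t m i)" unfolding h by simp
  then show ?thesis by (simp add: jump_def)
qed

lemma jump_lt: "1 \<le> i \<Longrightarrow> i < t \<Longrightarrow> jump h i = 1"
  using shape by (auto simp: hilbert_shape_def jump_def)

lemma jump_le_max: "i \<in> {1..s+1} \<Longrightarrow> jump h i \<le> max_jump h s"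
  unfolding max_jump_def by (intro Max_ge) auto

lemma card_level_le: "card (level t m c) \<le> max_jump h s"
proof (cases "level t m c = {}")
  case False
  then obtain j where j: "j \<in> {1..t}" "gen_deg t m j = c" by (auto simp: level_def)
  then have "t \<le> c" "c \<le> s + 1" using gen_deg_ge[OF lex, of j] gen_deg_le[OF j(1)] by auto
  then show ?thesis using jump_ge[of c] jump_le_max[of c] shape_t_pos by auto
qed simp

lemma max_jump_pos: "1 \<le> max_jump h s"
proof -
  have "1 \<in> level t m (gen_deg t m 1)" using shape_t_pos by (simp add: level_def)
  then have "card (level t m (gen_deg t m 1)) \<noteq> 0" by (metis card_0_eq empty_iff finite_level)
  then show ?thesis using card_level_le[of "gen_deg t m 1"] by linarith
qed

text \<open>If the maximum is attained in degree at least t, the corresponding level spans an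
  interval on which the monotone \<open>gen_deg\<close> is constant. If it is attained earlier, the
  height is 1 and the block is a single index.\<close>

lemma maximal_block:
  obtains p where "1 \<le> p" "p + max_jump h s - 1 \<le> t" "m (p + max_jump h s - 1) = m p + (max_jump h s - 1)"
proof -
  let ?\<Delta> = "max_jump h s"
  have "max_jump h s \<in> jump h ` {1..s+1}" unfolding max_jump_def by (rule Max_in) auto
  then obtain i where i: "i \<in> {1..s+1}" "jump h i = ?\<Delta>" by force
  show ?thesis
  proof (cases "i < t")
    case True
    then have "?\<Delta> = 1" using i jump_lt[of i] by simp
    then show ?thesis using that[of 1] shape_t_pos by simp
  next
    case False
    then have c: "card (level t m i) = ?\<Delta>" using jump_ge i by simp
    then have ne: "level t m i \<noteq> {}" using max_jump_pos by auto
    define p q where "p = Min (level t m i)" and "q = Max (level t m i)"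
    have pq: "p \<in> level t m i" "q \<in> level t m i" using ne by (simp_all add: p_def q_def)
    have "level t m i \<subseteq> {p..q}" by (auto simp: p_def q_def)
    then have "?\<Delta> \<le> q + 1 - p" using card_mono[of "{p..q}" "level t m i"] c by simp
    then have le: "p + ?\<Delta> - 1 \<le> q" "p \<le> p + ?\<Delta> - 1" using max_jump_pos by auto
    have pt: "1 \<le> p" "q \<le> t" "gen_deg t m p = i" "gen_deg t m q = i" using pq by (auto simp: level_def)
    have "gen_deg t m p \<le> gen_deg t m (p + ?\<Delta> - 1)" "gen_deg t m (p + ?\<Delta> - 1) \<le> gen_deg t m q"
      using gen_deg_mono[OF lex le(2)] gen_deg_mono[OF lex le(1) pt(2)] le pt by auto
    then have "gen_deg t m (p + ?\<Delta> - 1) = gen_deg t m p" using pt by simp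
    then have "m (p + ?\<Delta> - 1) = m p + (?\<Delta> - 1)" using le pt max_jump_pos by (simp add: gen_deg_def)
    then show ?thesis using that[of p] le pt by auto
  qed
qed

text \<open>Otherwise p, ..., p + \<Delta> would be \<Delta> + 1 indices in one level, more than any
  jump allows.\<close>

lemma block_gap:
  assumes "1 \<le> p" "p + max_jump h s \<le> t"
  shows "m p + max_jump h s < m (p + max_jump h s)"
proof (rule ccontr)
  let ?\<Delta> = "max_jump h s"
  assume c: "\<not> ?thesis"
  then have eq: "gen_deg t m (p + ?\<Delta>) \<le> gen_deg t m p" using assms by (simp add: gen_deg_def)
  have "j \<in> level t m (gen_deg t m p)" if "j \<in> {p..p + ?\<Delta>}" for j
  proof -
    have "gen_deg t m p \<le> gen_deg t m j" "gen_deg t m j \<le> gen_deg t m (p + ?\<Delta>)"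
      using that assms by (auto intro!: gen_deg_mono[OF lex])
    then show ?thesis using eq that assms by (auto simp: level_def)
  qed
  then have "card {p..p + ?\<Delta>} \<le> card (level t m (gen_deg t m p))" by (intro card_mono) auto
  then show False using card_level_le[of "gen_deg t m p"] by simp
qed

text \<open>The bound u equals 1 if i and j + 1 lie in the same block and is at most 0 otherwise; so
  an entry loses just the constant coefficient, and only within a block.\<close>

lemma card_coords_column:
  assumes "j < i" "i \<le> t"
  shows "card {k. udeg m (Suc i) (Suc j) \<le> int k \<and> k < ddiff m (Suc j)} +
    (if gen_deg t m i = gen_deg t m (Suc j) then 1 else 0) = ddiff m (Suc j)"
proof -
  have le: "gen_deg t m (Suc j) \<le> gen_deg t m i" using assms by (intro gen_deg_mono[OF lex]) auto
  have u: "udeg m (Suc i) (Suc j) = 1 + int (gen_deg t m (Suc j)) - int (gen_deg t m i)"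
    using assms by (simp add: udeg_def gen_deg_def of_nat_diff)
  show ?thesis
  proof (cases "gen_deg t m i = gen_deg t m (Suc j)")
    case True
    then have "{k. udeg m (Suc i) (Suc j) \<le> int k \<and> k < ddiff m (Suc j)} = {1..<ddiff m (Suc j)}" using u by auto
    moreover have "0 < ddiff m (Suc j)" using ddiff_Suc[OF lex, of j] assms by simp
    ultimately show ?thesis using True by simp
  next
    case False
    then have "{k. udeg m (Suc i) (Suc j) \<le> int k \<and> k < ddiff m (Suc j)} = {..<ddiff m (Suc j)}" using u le by auto
    then show ?thesis using False by simp
  qed
qed

lemma card_coords_eq: "card (coords t m) = (\<Sum>j<t. \<Sum>i=Suc j..t. card {k. udeg m (Suc i) (Suc j) \<le> int k \<and> k < ddiff m (Suc j)})"
proof -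
  let ?K = "\<lambda>i j. {k. udeg m (Suc i) (Suc j) \<le> int k \<and> k < ddiff m (Suc j)}"
  let ?S = "SIGMA j:{..<t}. SIGMA i:{Suc j..t}. ?K i j"
  have fin: "finite (?K i j)" for i j by (rule finite_subset[of _ "{..<ddiff m (Suc j)}"]) auto
  have "bij_betw (\<lambda>(j, i, k). (i, j, k)) ?S (coords t m)"
    by (rule bij_betw_byWitness[where f' = "\<lambda>(i, j, k). (j, i, k)"]) (auto simp: coords_def)
  then have "card (coords t m) = card ?S" by (rule bij_betw_same_card[symmetric])
  also have "\<dots> = (\<Sum>j<t. \<Sum>i=Suc j..t. card (?K i j))" using fin by simp
  finally show ?thesis .
qed

lemma sum_jump_choose:
  "(\<Sum>l=2..max_jump h s. num_jumps h s l * (l choose 2)) = (\<Sum>i=1..s+1. jump h i choose 2)"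
proof -
  have "(\<Sum>i=1..s+1. jump h i choose 2) =
      (\<Sum>l=0..max_jump h s. \<Sum>i\<in>{i \<in> {1..s+1}. jump h i = l}. jump h i choose 2)"
    by (rule sum.group[symmetric]) (use jump_le_max in auto)
  also have "\<dots> = (\<Sum>l=0..max_jump h s. num_jumps h s l * (l choose 2))"
    by (intro sum.cong refl) (simp add: num_jumps_def)
  also have "\<dots> = (\<Sum>l=2..max_jump h s. num_jumps h s l * (l choose 2))"
  proof (rule sum.mono_neutral_right)
    show "\<forall>l\<in>{0..max_jump h s} - {2..max_jump h s}. num_jumps h s l * (l choose 2) = 0"
    proof
      fix l assume "l \<in> {0..max_jump h s} - {2..max_jump h s}"
      then have "l < 2" by auto
      then show "num_jumps h s l * (l choose 2) = 0" by (simp add: binomial_eq_0)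
    qed
  qed auto
  finally show ?thesis by simp
qed

text \<open>Pairs of generators of equal degree are grouped by level. Degrees below t may be added
  to the sum because their jumps are 1 and contribute nothing.\<close>

lemma sum_pairs:
  "(\<Sum>j=1..t. card {i \<in> {j..t}. gen_deg t m i = gen_deg t m j}) = t + (\<Sum>i=1..s+1. jump h i choose 2)"
proof -
  have img: "gen_deg t m ` {1..t} \<subseteq> {t..s+1}" using gen_deg_ge[OF lex] gen_deg_le by force
  have "(\<Sum>j=1..t. card {i \<in> {j..t}. gen_deg t m i = gen_deg t m j}) =
      (\<Sum>c=t..s+1. \<Sum>j\<in>{j \<in> {1..t}. gen_deg t m j = c}. card {i \<in> {j..t}. gen_deg t m i = gen_deg t m j})"
    by (rule sum.group[symmetric]) (use img in auto)
  also have "\<dots> = (\<Sum>c=t..s+1. \<Sum>j\<in>level t m c. card {i \<in> level t m c. j \<le> i})"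
  proof (intro sum.cong)
    fix c j assume "j \<in> level t m c"
    then have "{i \<in> {j..t}. gen_deg t m i = gen_deg t m j} = {i \<in> level t m c. j \<le> i}"
      by (auto simp: level_def)
    then show "card {i \<in> {j..t}. gen_deg t m i = gen_deg t m j} = card {i \<in> level t m c. j \<le> i}" by simp
  qed (auto simp: level_def)
  also have "\<dots> = (\<Sum>c=t..s+1. (card (level t m c) choose 2)) + (\<Sum>c=t..s+1. card (level t m c))"
    by (simp add: sum_card_upper sum.distrib)
  also have "(\<Sum>c=t..s+1. card (level t m c)) = t"
    using sum.group[of "{1..t}" "{t..s+1}" "gen_deg t m" "\<lambda>_. 1::nat"] img by (simp add: level_def)
  also have "(\<Sum>c=t..s+1. (card (level t m c) choose 2)) = (\<Sum>c=t..s+1. jump h c choose 2)"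
    by (intro sum.cong) (auto simp: jump_ge)
  also have "\<dots> = (\<Sum>i=1..s+1. jump h i choose 2)"
    using jump_lt shape_t_pos by (intro sum.mono_neutral_left) (auto simp: binomial_eq_0)
  finally show ?thesis by simp
qed

text \<open>Allowing all exponents below d_j in each entry below the diagonal gives the sum of the m
  i; one coefficient is lost for each pair in a common block, diagonal pairs accounting for
  t.\<close>

lemma card_coords_sum:
  "card (coords t m) + (t + (\<Sum>l=2..max_jump h s. num_jumps h s l * (l choose 2))) = (\<Sum>i=1..t. m i)"
proof -
  let ?K = "\<lambda>i j. card {k. udeg m (Suc i) (Suc j) \<le> int k \<and> k < ddiff m (Suc j)}"
  let ?e = "\<lambda>i j. if gen_deg t m i = gen_deg t m (Suc j) then 1 else 0 :: nat"
  have "(\<Sum>j<t. \<Sum>i=Suc j..t. ?e i j) = (\<Sum>j<t. card {i \<in> {Suc j..t}. gen_deg t m i = gen_deg t m (Suc j)})"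
    by (intro sum.cong refl, subst sum.inter_filter[symmetric]) auto
  also have "\<dots> = (\<Sum>j=1..t. card {i \<in> {j..t}. gen_deg t m i = gen_deg t m j})"
    by (rule sum.reindex_bij_witness[of _ "\<lambda>j. j - 1" Suc]) auto
  finally have e: "(\<Sum>j<t. \<Sum>i=Suc j..t. ?e i j) = t + (\<Sum>l=2..max_jump h s. num_jumps h s l * (l choose 2))"
    using sum_pairs sum_jump_choose by simp
  have "card (coords t m) + (\<Sum>j<t. \<Sum>i=Suc j..t. ?e i j) = (\<Sum>j<t. \<Sum>i=Suc j..t. ?K i j + ?e i j)"
    unfolding card_coords_eq by (simp add: sum.distrib)
  also have "\<dots> = (\<Sum>j<t. \<Sum>i=Suc j..t. ddiff m (Suc j))"
    by (intro sum.cong refl card_coords_column) auto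
  also have "\<dots> = (\<Sum>j<t. \<Sum>i\<in>{i \<in> {1..t}. j < i}. ddiff m (Suc j))"
    by (intro sum.cong refl) auto
  also have "\<dots> = (\<Sum>i=1..t. \<Sum>j\<in>{j \<in> {..<t}. j < i}. ddiff m (Suc j))"
    by (rule sum.swap_restrict) auto
  also have "\<dots> = (\<Sum>i=1..t. m i)"
  proof (intro sum.cong refl)
    fix i assume i: "i \<in> {1..t}"
    then have "{j \<in> {..<t}. j < i} = {..<i}" by auto
    then show "(\<Sum>j\<in>{j \<in> {..<t}. j < i}. ddiff m (Suc j)) = m i" using sum_ddiff[OF lex, of i] i by simp
  qed
  finally show ?thesis unfolding e .
qed

text \<open>Double counting of the monomials outside the staircase, by degree and by power of
  x.\<close>

lemma sum_hilbert_fun: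
  assumes k: "s + 1 \<le> k"
  shows "(\<Sum>i<k. h i) = (\<Sum>j=1..t. m j)"
proof -
  have "(\<Sum>i<k. h i) = (\<Sum>i<k. \<Sum>j\<in>{j \<in> {1..t}. t - j \<le> i \<and> i < gen_deg t m j}. 1)"
    by (simp add: h)
  also have "\<dots> = (\<Sum>j=1..t. \<Sum>i\<in>{i \<in> {..<k}. t - j \<le> i \<and> i < gen_deg t m j}. 1)"
    by (rule sum.swap_restrict) auto
  also have "\<dots> = (\<Sum>j=1..t. m j)"
  proof (intro sum.cong refl)
    fix j assume "j \<in> {1..t}"
    then have "{i \<in> {..<k}. t - j \<le> i \<and> i < gen_deg t m j} = {t - j..<t - j + m j}"
      using gen_deg_le[of j] k by (auto simp: gen_deg_def)
    then show "(\<Sum>i\<in>{i \<in> {..<k}. t - j \<le> i \<and> i < gen_deg t m j}. 1) = m j" by simp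
  qed
  finally show ?thesis .
qed

end

text \<open>The bijections identifying the cell with affine space are part of the conclusion, so the
  parametrization is proved and not assumed. The formula for D is over the integers to avoid
  truncated subtraction.\<close>

theorem theorem3p10:
  fixes gt :: "nat \<times> nat \<Rightarrow> nat \<times> nat \<Rightarrow> bool"
    and J0 L :: "'k::field_char_0 series set"
    and h m :: "nat \<Rightarrow> nat"
    and t s n D :: nat
    and e :: "nat \<Rightarrow> nat \<times> nat \<times> nat"
    and Nbar :: "'k mpoly mat"
  assumes gt: "term_ordering gt" "gt (1, 0) (0, 1)"
    and J0: "is_ideal J0" "J0 \<noteq> UNIV" "has_colength J0 n"
    and h: "h = hilbert_fun J0" "hilbert_shape h t s"
    and L: "lex_exponents t m" "L = lex_ideal t m" "hilbert_fun L = h"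
    and e: "bij_betw e {..<D} (coords t m)"
    and Nbar: "Nbar = const_terms (general_element t D e)"
  shows "int D = int n - int t - (\<Sum>l=2..max_jump h s. int (num_jumps h s l * (l choose 2))) \<and>
    bij_betw (specialize (general_element t D e)) (carrier_vec D) (HB_params t m :: 'k poly mat set) \<and>
    bij_betw (Phi t m) (HB_params t m) (cell gt L) \<and>
    (\<forall>d. max_jump h s + 1 \<le> d \<and> d \<le> t + 1 \<longrightarrow>
       betti_stratum gt L d = cell_chart t m D e ` stratum_coords gt t m D e d \<and>
       stratum_coords gt t m D e d =
         vanishing D (det_ideal D (t + 2 - d) Nbar) - vanishing D (det_ideal D (t + 1 - d) Nbar) \<and>
       quasi_affine D (stratum_coords gt t m D e d :: 'k vec set)) \<and>
    is_affine_space D (stratum_coords gt t m D e (t + 1) :: 'k vec set) \<and>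
    stratum_coords gt t m D e (max_jump h s + 1) =
      carrier_vec D - vanishing D (det_ideal D (t - max_jump h s) Nbar) \<and>
    quasi_affine D (stratum_coords gt t m D e (max_jump h s + 1) :: 'k vec set) \<and>
    has_dimension D (stratum_coords gt t m D e (max_jump h s + 1) :: 'k vec set) D"
proof -
  let ?\<Delta> = "max_jump h s"
  note lex = L(1)
  have hc: "h i = card {j \<in> {1..t}. t - j \<le> i \<and> i < gen_deg t m j}" for i
    using hilbert_fun_lex_ideal[OF lex, where ?'k = 'k, of i] L by (simp add: gen_deg_def)
  have dimD: "int D = int n - int t - (\<Sum>l=2..?\<Delta>. int (num_jumps h s l * (l choose 2)))"
  proof -
    obtain K where K: "\<And>k. K \<le> k \<Longrightarrow> n = (\<Sum>i<k. h i)"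
      using colength_eq_sum_hilbert_fun[OF J0(1,3)] h(1) by blast
    \<comment> \<open>Partial sums of h equal the colength of J0 beyond K, and the sum of the
      exponents beyond s + 1.\<close>
    have "n = (\<Sum>j=1..t. m j)"
      using K[of "max K (s + 1)"] sum_hilbert_fun[OF lex hc h(2), of "max K (s + 1)"] by simp
    moreover have "D = card (coords t m)" using bij_betw_same_card[OF e] by simp
    ultimately have "D + (t + (\<Sum>l=2..?\<Delta>. num_jumps h s l * (l choose 2))) = n"
      using card_coords_sum[OF lex hc h(2)] by simp
    then have "int D + (int t + int (\<Sum>l=2..?\<Delta>. num_jumps h s l * (l choose 2))) = int n"
      by (metis of_nat_add)
    then show ?thesis unfolding of_nat_sum by linarith
  qed
  have \<Delta>1: "1 \<le> ?\<Delta>" by (rule max_jump_pos[OF lex hc h(2)])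
  obtain p where p: "1 \<le> p" "p + ?\<Delta> - 1 \<le> t" "m (p + ?\<Delta> - 1) = m p + (?\<Delta> - 1)"
    by (rule maximal_block[OF lex hc h(2)])
  then have \<Delta>t: "?\<Delta> \<le> t" by simp
  \<comment> \<open>The rank never exceeds t - \<Delta>, so the closed condition for d = \<Delta> +
    1 holds on all of affine space and this stratum is open.\<close>
  have top: "vanishing D (det_ideal D (t + 1 - ?\<Delta>) Nbar) = carrier_vec D"
  proof (intro equalityI subsetI)
    fix v :: "'k vec" assume v: "v \<in> carrier_vec D"
    have "specialize (general_element t D e) v \<in> HB_params t m"
      using bij_betwE[OF specialize_bij_betw[OF e]] v by blast
    from const_part_minors_vanish[OF this lex p(1) \<Delta>1 p(2,3)]
    show "v \<in> vanishing D (det_ideal D (t + 1 - ?\<Delta>) Nbar)"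
      using v by (simp add: vanishing_det_ideal Nbar const_part_specialize)
  qed (simp add: vanishing_def)
  have generic: "stratum_coords gt t m D e (?\<Delta> + 1) = carrier_vec D - vanishing D (det_ideal D (t - ?\<Delta>) Nbar)"
    using stratum_coords_eq[OF gt lex e, of "?\<Delta> + 1", where ?'k = 'k] \<Delta>t top by (simp add: Nbar)
  \<comment> \<open>One matrix of rank t - \<Delta> makes the open stratum nonempty, as its
    dimension requires.\<close>
  have "\<exists>v. v \<in> carrier_vec D \<and> v \<notin> vanishing D (det_ideal D (t - ?\<Delta>) Nbar)"
  proof -
    obtain N :: "'k poly mat" where N: "N \<in> HB_params t m" "\<not> (\<forall>x\<in>minors (t - ?\<Delta>) (const_part N). x = 0)"
      using const_part_minor_nonzero[OF lex \<Delta>t block_gap[OF lex hc h(2)]] by blast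
    from N(1) obtain v where v: "v \<in> carrier_vec D" "N = specialize (general_element t D e) v"
      using bij_betw_imp_surj_on[OF specialize_bij_betw[OF e, where ?'k = 'k]] by (metis imageE)
    then show ?thesis using N(2) by (auto simp: vanishing_det_ideal Nbar const_part_specialize)
  qed
  then have ne: "stratum_coords gt t m D e (?\<Delta> + 1) \<noteq> ({} :: 'k vec set)" unfolding generic by blast
  have "zariski_closed D (vanishing D (det_ideal D (t - ?\<Delta>) Nbar))"
    unfolding Nbar by (rule zariski_closed_det_ideal) (rule const_terms_polys)
  then have dim: "has_dimension D (stratum_coords gt t m D e (?\<Delta> + 1) :: 'k vec set) D"
    using generic ne by (rule has_dimension_open)
  have strata: "betti_stratum gt L d = cell_chart t m D e ` stratum_coords gt t m D e d \<and>
       stratum_coords gt t m D e d =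
         vanishing D (det_ideal D (t + 2 - d) Nbar) - vanishing D (det_ideal D (t + 1 - d) Nbar) \<and>
       quasi_affine D (stratum_coords gt t m D e d :: 'k vec set)" if "?\<Delta> + 1 \<le> d" "d \<le> t + 1" for d
    using that betti_stratum_eq_image[OF gt lex e, of d, where ?'k = 'k] stratum_coords_eq[OF gt lex e, of d, where ?'k = 'k]
      quasi_affine_stratum[OF gt lex e, of d, where ?'k = 'k] by (simp add: L(2) Nbar)
  have quasi: "quasi_affine D (stratum_coords gt t m D e (?\<Delta> + 1) :: 'k vec set)"
    using strata[of "?\<Delta> + 1"] \<Delta>t by (metis add_le_mono1 order_refl)
  have phi: "bij_betw (Phi t m) (HB_params t m) (cell gt L)"
    unfolding L(2) by (rule Phi_bij_betw[OF gt lex])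
  show ?thesis
    by (intro conjI allI impI dimD specialize_bij_betw[OF e] phi is_affine_space_top_stratum[OF gt lex e]
        generic quasi dim strata[THEN conjunct1] strata[THEN conjunct2, THEN conjunct1]
        strata[THEN conjunct2, THEN conjunct2]) auto
qed

end
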